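(* Let $d\ge2$ and let $f(\mathbf{x},t):\mathbb{R}^{d-1}\times[0,\infty)\to\mathbb{R}$ be a smooth function with $f(0,0)=0$ and $\nabla f(0,0)=0$ (spatial gradient), whose graph moves by mean curvature, i.e. $$f_t=\Delta f-\frac{\sum_{i,j}f_{x_i}f_{x_j}f_{x_ix_j}}{1+|\nabla f|^2}.$$ Let $\Sigma^0=\{(\mathbf{x},x_d): x_d\le f(\mathbf{x},0)\}\subset\mathbb{R}^d$. For $t>0$ let $$\bar\Sigma=\Big\{p\in\mathbb{R}^d:\ (G_{t/2}*\mathbf{1}_{\Sigma^0})(p)\ge\tfrac12\Big\},\qquad \Sigma^1=\Big\{p\in\mathbb{R}^d:\ \frac{\sqrt2\,(G_{t/2}*\mathbf{1}_{\bar\Sigma})(p)-(G_t*\mathbf{1}_{\Sigma^0})(p)}{\sqrt2-1}\ge\tfrac12\Big\}$$ be the result of one step, with time step size $t$, of the natural two kernel extrapolation algorithm. Let $z(t)$ be the location, near the origin and for small $t$, at which $\partial\Sigma^1$ meets the $x_d$-axis $\{\mathbf{x}=0\}$. Then the algorithm is second order accurate for motion by mean curvature, i.e. $$z(t)=f(0,t)+O(t^3)\qquad\text{as }t\to0^+.$$ In the case $d=3$, writing $f=f(x,y,t)$, explicitly $$z(t)=t\,[f_{xx}+f_{yy}]+t^2\Big[\tfrac12(f_{xxxx}+2f_{xxyy}+f_{yyyy})-(f_{xx}^3+3f_{xx}f_{xy}^2+3f_{yy}f_{xy}^2+f_{yy}^3)\Big]+O(t^3),$$ with all derivatives evaluated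 at $(x,y,t)=(0,0,0)$.
   Context: $G_t(p)=\frac{1}{(4\pi t)^{d/2}}e^{-|p|^2/(4t)}$ is the Gaussian kernel on $\mathbb{R}^d$, $*$ denotes convolution, and $\mathbf{1}_\Sigma$ is the characteristic function of $\Sigma$. For small $t$ the boundaries of $\bar\Sigma$ and $\Sigma^1$ near the origin are graphs over the $\mathbf{x}$-variables; $z(t)$ is the height of $\partial\Sigma^1$ over $\mathbf{x}=0$. *)

theory Defs
  imports "HOL-Analysis.Analysis" "HOL-Library.Landau_Symbols"
begin

(* Space-time points (x,t) and space points (x, x_d) both live in (real^'n) * real, where
   CARD('n) = d - 1 >= 1, so d >= 2 is automatic; the product norm is the Euclidean one and
   lborel is d-dimensional Lebesgue measure. *)

definition dir_deriv ::
  "'a::real_normed_vector set \<Rightarrow> 'a \<Rightarrow> ('a \<Rightarrow> 'b::real_normed_vector) \<Rightarrow> 'a \<Rightarrow> 'b" where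
  "dir_deriv S v f p = frechet_derivative f (at p within S) v"

primrec times_differentiable_on ::
  "'a::real_normed_vector set \<Rightarrow> nat \<Rightarrow> ('a \<Rightarrow> 'b::real_normed_vector) \<Rightarrow> bool" where
  "times_differentiable_on S 0 f \<longleftrightarrow> continuous_on S f"
| "times_differentiable_on S (Suc k) f \<longleftrightarrow>
     f differentiable_on S \<and> (\<forall>v. times_differentiable_on S k (dir_deriv S v f))"

(* The derivative within S is only unique when S is thick at each of its points.  It is
   applied below to the closed half-space t >= 0, where this means C^infinity up to the boundary,
   with one-sided derivatives in t at t = 0. *)
definition smooth_on :: "'a::real_normed_vector set \<Rightarrow> ('a \<Rightarrow> 'b::real_normed_vector) \<Rightarrow> bool" where
  "smooth_on S f \<longleftrightarrow> (\<forall>k. times_differentiable_on S k f)"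

definition half_space :: "('v::real_normed_vector \<times> real) set" where
  "half_space = UNIV \<times> {0..}"

abbreviation Dx :: "'n::finite \<Rightarrow> ((real^'n) \<times> real \<Rightarrow> real) \<Rightarrow> (real^'n) \<times> real \<Rightarrow> real" where
  "Dx i \<equiv> dir_deriv half_space (axis i 1, 0)"

abbreviation Dt :: "((real^'n::finite) \<times> real \<Rightarrow> real) \<Rightarrow> (real^'n) \<times> real \<Rightarrow> real" where
  "Dt \<equiv> dir_deriv half_space (0, 1)"

definition graph_mcf :: "((real^'n::finite) \<times> real \<Rightarrow> real) \<Rightarrow> bool" where
  "graph_mcf f \<longleftrightarrow> (\<forall>p\<in>half_space.
     Dt f p = (\<Sum>i\<in>UNIV. Dx i (Dx i f) p)
       - (\<Sum>i\<in>UNIV. \<Sum>j\<in>UNIV. Dx i f p * Dx j f p * Dx j (Dx i f) p)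
           / (1 + (\<Sum>i\<in>UNIV. (Dx i f p)\<^sup>2)))"

definition gauss_kernel :: "real \<Rightarrow> 'a::euclidean_space \<Rightarrow> real" where
  "gauss_kernel t p =
     1 / (4 * pi * t) powr (real DIM('a) / 2) * exp (- (norm p)\<^sup>2 / (4 * t))"

definition convolve :: "('a::euclidean_space \<Rightarrow> real) \<Rightarrow> ('a \<Rightarrow> real) \<Rightarrow> 'a \<Rightarrow> real" where
  "convolve g h p = (\<integral>q. g (p - q) * h q \<partial>lborel)"

definition subgraph :: "((real^'n::finite) \<times> real \<Rightarrow> real) \<Rightarrow> ((real^'n) \<times> real) set" where
  "subgraph f = {(x, h). h \<le> f (x, 0)}"

definition half_step :: "real \<Rightarrow> 'a::euclidean_space set \<Rightarrow> 'a set" where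
  "half_step t S = {p. convolve (gauss_kernel (t / 2)) (indicator S) p \<ge> 1 / 2}"

definition two_kernel_step :: "real \<Rightarrow> 'a::euclidean_space set \<Rightarrow> 'a set" where
  "two_kernel_step t S = {p.
     (sqrt 2 * convolve (gauss_kernel (t / 2)) (indicator (half_step t S)) p
        - convolve (gauss_kernel t) (indicator S) p) / (sqrt 2 - 1) \<ge> 1 / 2}"

end

theory Submission
  imports Defs "HOL-Probability.Probability"
begin

text \<open>
  The Gaussian convolution of the subgraph of \<open>g\<close> at \<open>(x, h)\<close> is
  \<open>1/2 + E \<psi>((g(x - \<surd>(2s) n) - h)/\<surd>(2s))/\<surd>(2\<pi>)\<close>, where \<open>n\<close> is a standard Gaussian vector and
  \<open>\<psi>(a)\<close> is the integral of \<open>exp(-k\<^sup>2/2)\<close> from 0 to \<open>a\<close>. It is strictly decreasing in \<open>h\<close>, so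
  the set after a half step is again a subgraph, globally and without growth conditions on \<open>g\<close>.

  Put \<open>\<tau> = \<surd>t\<close>, \<open>x = \<tau> m\<close>, \<open>h = \<tau>\<^sup>2 k\<close>. Since \<open>\<psi>(\<tau> W)/\<tau> = W - \<tau>\<^sup>2 W\<^sup>3/6 + O(\<tau>\<^sup>4 W\<^sup>5)\<close>, the rescaled
  height \<open>k(m)\<close> after the half step satisfies \<open>k(m) = E W' - \<tau>\<^sup>2/6 E W\<^sup>3 + O(\<tau>\<^sup>4)\<close> with
  \<open>W' = g(\<tau>(m - n))/\<tau>\<^sup>2\<close> and \<open>W = W' - k(m)\<close>, with errors of polynomial growth in \<open>m\<close>. In the means of
  the cubes only the even part of \<open>W\<close> matters at leading order: the odd part is \<open>O(\<tau>)\<close> and enters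
  quadratically. The remaining Gaussian moments are computed by Wick's formula. They show that the
  step function at height \<open>\<tau>\<^sup>2 k\<close> over the origin vanishes to order \<open>\<tau>\<^sup>4\<close> at
  \<open>k = tr H + \<tau>\<^sup>2 (\<Delta>\<^sup>2 g(0)/2 - tr H\<^sup>3)\<close>, \<open>H\<close> being the Hessian of \<open>g\<close> at 0, and its derivative in \<open>k\<close> is
  bounded away from 0. On the other hand, differentiating the evolution equation in \<open>t\<close> at the origin
  gives \<open>f\<^sub>t = tr H\<close> and \<open>f\<^sub>t\<^sub>t = \<Delta>\<^sup>2 f - 2 tr H\<^sup>3\<close>.
\<close>

section \<open>Calculus on the closed half-space\<close>

text \<open>Second order accuracy is Richardson extrapolation in disguise. Across a nearly flat
  graph the convolution at time t/2 is sqrt 2 times as steep as the one at time t, so weights sqrt 2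
  and -1 on the convolutions act as weights 2 and -1 on heights. In the rescaled height all
  candidates agree to order \<tau>^2 except for the multiple of tr H^3: it is -1 for the flow, -2/3
  for one full step and -2/3 - 1/6 = -5/6 for two half steps, and 2 * 5/6 - 2/3 = 1. Two obstacles
  shape the proof. The half-step graph is known only as a zero level, so none of its derivatives is
  ever taken: its mean, and its even and odd parts under reflection, are estimated instead, and
  these determine the required moments. Moreover the step function is a difference of two decreasing
  functions of the height, so a unique zero over the origin is not automatic: where |\<tau> k| is at
  most 1/2 the half-step term is shown to win with a definite slope, and beyond that range the sign
  is the one for a flat graph.\<close>

abbreviation dd :: "(real^'n::finite) \<times> real \<Rightarrow> ((real^'n) \<times> real \<Rightarrow> real) \<Rightarrow> (real^'n) \<times> real \<Rightarrow> real"
  where "dd \<equiv> dir_deriv half_space"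

lemma half_space_iff: "p \<in> half_space \<longleftrightarrow> 0 \<le> snd p"
  by (cases p) (auto simp: half_space_def)

lemma half_space_ray:
  assumes "p \<in> half_space" "0 \<le> snd v" "0 \<le> r"
  shows "p + r *\<^sub>R v \<in> half_space"
  using assms by (auto simp: half_space_iff)

text \<open>Uniqueness of a derivative within a set only asks for short steps inside the set along
  each basis vector. Basis vectors have nonnegative time component, so small positive steps do, even
  from the boundary.\<close>

lemma half_space_derivative_unique:
  fixes f :: "(real^'n::finite) \<times> real \<Rightarrow> real"
  assumes "p \<in> half_space"
    and "(f has_derivative f') (at p within half_space)"
    and "(f has_derivative f'') (at p within half_space)"
  shows "f' = f''"
proof (rule frechet_derivative_unique_within[OF assms(2,3)])
  fix i :: "(real^'n) \<times> real" and e :: real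
  assume i: "i \<in> Basis" and e: "e > 0"
  have "0 \<le> snd i" using i by (auto simp: Basis_prod_def)
  then have "p + (e/2) *\<^sub>R i \<in> half_space"
    using half_space_ray[OF assms(1), of i "e/2"] e by simp
  then show "\<exists>d. 0 < \<bar>d\<bar> \<and> \<bar>d\<bar> < e \<and> p + d *\<^sub>R i \<in> half_space"
    using e by (intro exI[of _ "e/2"]) auto
qed

lemma dd_eqI:
  fixes f :: "(real^'n::finite) \<times> real \<Rightarrow> real"
  assumes "p \<in> half_space" "(f has_derivative f') (at p within half_space)"
  shows "dd v f p = f' v"
proof -
  have "f differentiable (at p within half_space)"
    using assms(2) by (auto simp: differentiable_def)
  then have "(f has_derivative frechet_derivative f (at p within half_space)) (at p within half_space)"
    by (simp add: frechet_derivative_works)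
  then have "frechet_derivative f (at p within half_space) = f'"
    by (rule half_space_derivative_unique[OF assms(1) _ assms(2)])
  then show ?thesis by (simp add: dir_deriv_def)
qed

text \<open>\<open>frechet_derivative\<close> is a choice from a predicate that sees only values on
  the half-space. Identities valid for nonnegative time may therefore be differentiated.\<close>

lemma dd_cong:
  fixes f g :: "(real^'n::finite) \<times> real \<Rightarrow> real"
  assumes "\<And>p. p \<in> half_space \<Longrightarrow> f p = g p" "p \<in> half_space"
  shows "dd v f p = dd v g p"
proof -
  have "(f has_derivative D) (at p within half_space) \<longleftrightarrow> (g has_derivative D) (at p within half_space)" for D
    using assms has_derivative_transform[of p half_space] by metis
  then show ?thesis by (simp add: dir_deriv_def frechet_derivative_def)
qed

lemma times_differentiable_on_has_derivative:
  assumes "times_differentiable_on half_space (Suc k) f" "p \<in> half_space"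
  shows "(f has_derivative (\<lambda>v. dd v f p)) (at p within half_space)"
  using assms by (auto simp: differentiable_on_def frechet_derivative_works dir_deriv_def)

lemma times_differentiable_on_dd:
  "times_differentiable_on half_space (Suc k) f \<Longrightarrow> times_differentiable_on half_space k (dd v f)"
  unfolding times_differentiable_on.simps by blast

lemma times_differentiable_on_cong:
  fixes f g :: "(real^'n::finite) \<times> real \<Rightarrow> real"
  assumes "\<And>p. p \<in> half_space \<Longrightarrow> f p = g p" "times_differentiable_on half_space k f"
  shows "times_differentiable_on half_space k g"
  using assms
proof (induction k arbitrary: f g)
  case 0
  then show ?case using continuous_on_cong[of half_space half_space f g] by simp
next
  case (Suc k)
  have "g differentiable (at p within half_space)" if p: "p \<in> half_space" for p
  proof -
    have "(f has_derivative (\<lambda>v. dd v f p)) (at p within half_space)"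
      using times_differentiable_on_has_derivative[OF Suc.prems(2) p] .
    then have "(g has_derivative (\<lambda>v. dd v f p)) (at p within half_space)"
      using has_derivative_transform[of p half_space g f] Suc.prems(1) p by auto
    then show ?thesis by (auto simp: differentiable_def)
  qed
  then have "g differentiable_on half_space" by (simp add: differentiable_on_def)
  moreover have "times_differentiable_on half_space k (dd v g)" for v
  proof (rule Suc.IH)
    show "times_differentiable_on half_space k (dd v f)"
      using Suc.prems(2) by (rule times_differentiable_on_dd)
    show "dd v f p = dd v g p" if "p \<in> half_space" for p
      using dd_cong[of f g p v] Suc.prems(1) that by auto
  qed
  ultimately show ?case by simp
qed

lemma smooth_has_derivative:
  fixes f :: "(real^'n::finite) \<times> real \<Rightarrow> real"
  assumes "smooth_on half_space f" "p \<in> half_space"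
  shows "(f has_derivative (\<lambda>v. dd v f p)) (at p within half_space)"
  using assms times_differentiable_on_has_derivative[of 0 f p] unfolding smooth_on_def by blast

lemma smooth_dd:
  assumes "smooth_on half_space f"
  shows "smooth_on half_space (dd v f)"
proof -
  have "times_differentiable_on half_space (Suc k) f" for k
    using assms unfolding smooth_on_def by blast
  then show ?thesis unfolding smooth_on_def using times_differentiable_on_dd by blast
qed

lemma smooth_continuous: "smooth_on half_space f \<Longrightarrow> continuous_on half_space f"
  unfolding smooth_on_def by (metis times_differentiable_on.simps(1))

lemma dd_add:
  fixes f g :: "(real^'n::finite) \<times> real \<Rightarrow> real"
  assumes "(f has_derivative (\<lambda>v. dd v f p)) (at p within half_space)"
    "(g has_derivative (\<lambda>v. dd v g p)) (at p within half_space)" "p \<in> half_space"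
  shows "dd v (\<lambda>x. f x + g x) p = dd v f p + dd v g p"
  using dd_eqI[OF assms(3) has_derivative_add[OF assms(1,2)]] by simp

lemma dd_cmult:
  fixes f :: "(real^'n::finite) \<times> real \<Rightarrow> real"
  assumes "(f has_derivative (\<lambda>v. dd v f p)) (at p within half_space)" "p \<in> half_space"
  shows "dd v (\<lambda>x. c * f x) p = c * dd v f p"
  using dd_eqI[OF assms(2) has_derivative_mult_right[OF assms(1), of c]] by simp

lemma times_differentiable_on_add:
  fixes f g :: "(real^'n::finite) \<times> real \<Rightarrow> real"
  assumes "times_differentiable_on half_space k f" "times_differentiable_on half_space k g"
  shows "times_differentiable_on half_space k (\<lambda>x. f x + g x)"
  using assms
proof (induction k arbitrary: f g)
  case 0
  then show ?case by (simp add: continuous_on_add)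
next
  case (Suc k)
  note d = times_differentiable_on_has_derivative[OF Suc.prems(1)]
    times_differentiable_on_has_derivative[OF Suc.prems(2)]
  have "times_differentiable_on half_space k (dd v (\<lambda>x. f x + g x))" for v
    by (rule times_differentiable_on_cong[of "\<lambda>p. dd v f p + dd v g p"])
      (use Suc.IH Suc.prems[THEN times_differentiable_on_dd] d in \<open>simp_all add: dd_add\<close>)
  then show ?case using Suc.prems by auto
qed

lemma times_differentiable_on_cmult:
  fixes f :: "(real^'n::finite) \<times> real \<Rightarrow> real"
  assumes "times_differentiable_on half_space k f"
  shows "times_differentiable_on half_space k (\<lambda>x. c * f x)"
  using assms
proof (induction k arbitrary: f)
  case 0
  then show ?case by (simp add: continuous_on_mult_left)
next
  case (Suc k)
  note d = times_differentiable_on_has_derivative[OF Suc.prems(1)]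
  have "times_differentiable_on half_space k (dd v (\<lambda>x. c * f x))" for v
    by (rule times_differentiable_on_cong[of "\<lambda>p. c * dd v f p"])
      (use Suc.IH Suc.prems[THEN times_differentiable_on_dd] d in \<open>simp_all add: dd_cmult\<close>)
  then show ?case
    using Suc.prems unfolding times_differentiable_on.simps differentiable_on_def differentiable_def
    by (blast intro: has_derivative_mult_right)
qed

lemma smooth_add:
  fixes f g :: "(real^'n::finite) \<times> real \<Rightarrow> real"
  shows "smooth_on half_space f \<Longrightarrow> smooth_on half_space g \<Longrightarrow> smooth_on half_space (\<lambda>x. f x + g x)"
  by (simp add: smooth_on_def times_differentiable_on_add)

lemma smooth_cmult:
  fixes f :: "(real^'n::finite) \<times> real \<Rightarrow> real"
  shows "smooth_on half_space f \<Longrightarrow> smooth_on half_space (\<lambda>x. c * f x)"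
  by (simp add: smooth_on_def times_differentiable_on_cmult)

lemma smooth_zero: "smooth_on half_space (\<lambda>x :: (real^'n::finite) \<times> real. 0 :: real)"
proof -
  have "times_differentiable_on half_space k (\<lambda>x :: (real^'n::finite) \<times> real. 0 :: real)" for k
  proof (induction k)
    case (Suc k)
    have "dd v (\<lambda>x. 0) p = 0" if "p \<in> half_space" for v p :: "(real^'n) \<times> real"
      using dd_eqI[OF that, of "\<lambda>x. 0" "\<lambda>x. 0"] by simp
    then show ?case
      using times_differentiable_on_cong[OF _ Suc] by (auto simp: differentiable_on_def)
  qed simp
  then show ?thesis by (simp add: smooth_on_def)
qed

lemma smooth_sum:
  fixes F :: "'i \<Rightarrow> (real^'n::finite) \<times> real \<Rightarrow> real"
  assumes "finite I" "\<And>i. i \<in> I \<Longrightarrow> smooth_on half_space (F i)"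
  shows "smooth_on half_space (\<lambda>x. \<Sum>i\<in>I. c i * F i x)"
  using assms by (induction I rule: finite_induct) (simp_all add: smooth_zero smooth_add smooth_cmult)

lemma dd_sum:
  fixes F :: "'i \<Rightarrow> (real^'n::finite) \<times> real \<Rightarrow> real"
  assumes "\<And>i. i \<in> I \<Longrightarrow> smooth_on half_space (F i)" "p \<in> half_space"
  shows "dd v (\<lambda>x. \<Sum>i\<in>I. c i * F i x) p = (\<Sum>i\<in>I. c i * dd v (F i) p)"
proof -
  have "((\<lambda>x. \<Sum>i\<in>I. c i * F i x) has_derivative (\<lambda>v. \<Sum>i\<in>I. c i * dd v (F i) p)) (at p within half_space)"
    using assms by (intro has_derivative_sum has_derivative_mult_right smooth_has_derivative)
  then show ?thesis by (rule dd_eqI[OF assms(2)])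
qed

lemma dd_scaleR:
  fixes f :: "(real^'n::finite) \<times> real \<Rightarrow> real"
  assumes "smooth_on half_space f" "p \<in> half_space"
  shows "dd (c *\<^sub>R v) f p = c * dd v f p"
  using linear_cmul[OF bounded_linear.linear, OF has_derivative_bounded_linear[OF smooth_has_derivative[OF assms]], of c v]
  by simp

lemma dd_spatial:
  fixes f :: "(real^'n::finite) \<times> real \<Rightarrow> real"
  assumes "smooth_on half_space f" "p \<in> half_space"
  shows "dd (z, 0) f p = (\<Sum>i\<in>UNIV. z $ i * Dx i f p)"
proof -
  interpret bounded_linear "\<lambda>v. dd v f p"
    using has_derivative_bounded_linear[OF smooth_has_derivative[OF assms]] .
  have "(z, 0) = (\<Sum>i\<in>UNIV. z $ i *\<^sub>R (axis i 1 :: real^'n, 0 :: real))"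
    by (simp add: prod_eq_iff fst_sum snd_sum scalar_mult_eq_scaleR[symmetric] basis_expansion)
  then have "dd (z, 0) f p = (\<Sum>i\<in>UNIV. dd (z $ i *\<^sub>R (axis i 1 :: real^'n, 0 :: real)) f p)"
    using sum[of "\<lambda>i. z $ i *\<^sub>R (axis i 1 :: real^'n, 0 :: real)" UNIV] by simp
  then show ?thesis by (simp only: scaleR)(simp)
qed

text \<open>Reduces calculus on the half-space to one variable. The parameter 0 is included with a
  one-sided derivative, which covers time derivatives at time 0.\<close>

lemma ray_derivative:
  fixes f :: "(real^'n::finite) \<times> real \<Rightarrow> real"
  assumes f: "smooth_on half_space f" and p: "p \<in> half_space" and v: "0 \<le> snd v" and s: "0 \<le> s"
  shows "((\<lambda>r. f (p + r *\<^sub>R v)) has_real_derivative dd v f (p + s *\<^sub>R v)) (at s within {0..})"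
proof -
  have 1: "((\<lambda>r. p + r *\<^sub>R v) has_derivative (\<lambda>r. r *\<^sub>R v)) (at s within {0..})"
    by (auto intro!: derivative_eq_intros)
  have 2: "(\<lambda>r. p + r *\<^sub>R v) ` {0..} \<subseteq> half_space" using half_space_ray[OF p v] by auto
  have ps: "p + s *\<^sub>R v \<in> half_space" using half_space_ray[OF p v s] .
  have "(f has_derivative (\<lambda>w. dd w f (p + s *\<^sub>R v))) (at (p + s *\<^sub>R v) within (\<lambda>r. p + r *\<^sub>R v) ` {0..})"
    using smooth_has_derivative[OF f ps] 2 by (rule has_derivative_subset)
  from has_derivative_in_compose[OF 1 this]
  show ?thesis
    using dd_scaleR[OF f ps] by (simp add: has_field_derivative_def mult.commute[of _ "dd v f _"])
qed

lemma one_sided_mvt: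
  fixes f f' :: "real \<Rightarrow> real"
  assumes "a < b" "\<And>x. a \<le> x \<Longrightarrow> x \<le> b \<Longrightarrow> (f has_real_derivative f' x) (at x within {a..})"
  obtains x where "a < x" "x < b" "f b - f a = (b - a) * f' x"
proof -
  have c: "continuous_on {a..b} f"
  proof (rule DERIV_continuous_on)
    fix x assume "x \<in> {a..b}"
    then show "(f has_real_derivative f' x) (at x within {a..b})"
      using assms(2)[of x] by (auto intro: has_field_derivative_subset)
  qed
  have d: "(f has_real_derivative f' x) (at x)" if "a < x" "x < b" for x
  proof -
    have "(f has_real_derivative f' x) (at x within {a<..<b})"
      using assms(2)[of x] that by (auto intro: has_field_derivative_subset)
    then show ?thesis using at_within_open[of x "{a<..<b}"] that by simp
  qed
  have D: "(f has_derivative (\<lambda>h. h * f' x)) (at x)" if "a < x" "x < b" for x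
    using d[OF that] by (simp add: has_field_derivative_def mult_commute_abs)
  obtain x where "a < x" "x < b" "f b - f a = (b - a) * f' x"
    using mvt[OF assms(1) c D] by blast
  then show ?thesis using that by blast
qed

text \<open>Schwarz's theorem up to the boundary: the second difference \<open>Q\<close> is
  symmetric in the two directions, and \<open>Q\<close> divided by \<open>e\<^sup>2\<close> tends to
  either mixed derivative. Both directions point into the half-space so that the whole parallelogram
  at a boundary point stays inside.\<close>

theorem dd_commute:
  fixes f :: "(real^'n::finite) \<times> real \<Rightarrow> real"
  assumes f: "smooth_on half_space f" and p: "p \<in> half_space" and u: "0 \<le> snd u" and v: "0 \<le> snd v"
  shows "dd u (dd v f) p = dd v (dd u f) p"
proof -
  define Q where "Q u v e = f (p + e *\<^sub>R u + e *\<^sub>R v) - f (p + e *\<^sub>R u) - f (p + e *\<^sub>R v) + f p" for u v and e :: real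
  have Qsym: "Q u v = Q v u" for u v by (simp add: Q_def fun_eq_iff algebra_simps)
  have lim: "((\<lambda>e. Q u v e / e\<^sup>2) \<longlongrightarrow> dd v (dd u f) p) (at_right 0)" if u: "0 \<le> snd u" and v: "0 \<le> snd v" for u v
  proof (rule tendstoI)
    fix d :: real assume d: "0 < d"
    have "continuous_on half_space (dd v (dd u f))"
      using f by (intro smooth_continuous smooth_dd)
    then obtain e0 where e0: "e0 > 0" "\<And>q. q \<in> half_space \<Longrightarrow> dist q p < e0 \<Longrightarrow> dist (dd v (dd u f) q) (dd v (dd u f) p) < d"
      using p d unfolding continuous_on_iff by blast
    define e1 where "e1 = e0 / (norm u + norm v + 1)"
    have e1: "e1 > 0" using e0 by (simp add: e1_def add_nonneg_pos)
    have "dist (Q u v e / e\<^sup>2) (dd v (dd u f) p) < d" if e: "0 < e" "e < e1" for e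
    proof -
      \<comment> \<open>The mean value theorem is applied twice: along \<open>u\<close> to the
        increment in direction \<open>v\<close>, then along \<open>v\<close> to the resulting
        derivative.\<close>
      define \<phi> where "\<phi> r = f (p + e *\<^sub>R v + r *\<^sub>R u) - f (p + r *\<^sub>R u)" for r
      have pv: "p + e *\<^sub>R v \<in> half_space" using half_space_ray[OF p v] e by simp
      have "(\<phi> has_real_derivative (dd u f (p + e *\<^sub>R v + x *\<^sub>R u) - dd u f (p + x *\<^sub>R u))) (at x within {0..})" if "0 \<le> x" for x
        unfolding \<phi>_def by (intro DERIV_diff ray_derivative f pv p u that)
      from one_sided_mvt[OF e(1) this]
      obtain x where x: "0 < x" "x < e" "\<phi> e - \<phi> 0 = e * (dd u f (p + e *\<^sub>R v + x *\<^sub>R u) - dd u f (p + x *\<^sub>R u))"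
        by (metis diff_zero)
      have px: "p + x *\<^sub>R u \<in> half_space" using half_space_ray[OF p u] x by simp
      have "((\<lambda>r. dd u f (p + x *\<^sub>R u + r *\<^sub>R v)) has_real_derivative dd v (dd u f) (p + x *\<^sub>R u + y *\<^sub>R v)) (at y within {0..})" if "0 \<le> y" for y
        by (rule ray_derivative[OF smooth_dd[OF f] px v that])
      from one_sided_mvt[OF e(1) this]
      obtain y where y: "0 < y" "y < e" "dd u f (p + x *\<^sub>R u + e *\<^sub>R v) - dd u f (p + x *\<^sub>R u + 0 *\<^sub>R v) = e * dd v (dd u f) (p + x *\<^sub>R u + y *\<^sub>R v)"
        by (metis diff_zero)
      define q where "q = p + x *\<^sub>R u + y *\<^sub>R v"
      have q: "q \<in> half_space" using half_space_ray[OF px v] y by (simp add: q_def)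
      have "dist q p = norm (x *\<^sub>R u + y *\<^sub>R v)" by (simp add: q_def dist_norm algebra_simps)
      also have "\<dots> \<le> x * norm u + y * norm v"
        using norm_triangle_ineq[of "x *\<^sub>R u" "y *\<^sub>R v"] x y by simp
      also have "\<dots> \<le> e * norm u + e * norm v" using x y by (intro add_mono mult_right_mono) auto
      also have "\<dots> < e * (norm u + norm v + 1)" using e by (simp add: algebra_simps)
      also have "\<dots> \<le> e1 * (norm u + norm v + 1)" using e by (intro mult_right_mono) (auto)
      also have "\<dots> = e0"
      proof -
        have "norm u + norm v + 1 > 0" by (simp add: add_nonneg_pos)
        then show ?thesis by (simp add: e1_def)
      qed
      finally have "dist (dd v (dd u f) q) (dd v (dd u f) p) < d" using e0(2)[OF q] by simp
      moreover have "Q u v e = \<phi> e - \<phi> 0" by (simp add: Q_def \<phi>_def algebra_simps)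
      then have "Q u v e = e * (e * dd v (dd u f) q)"
        using x(3) y(3) by (simp add: q_def algebra_simps)
      then have "Q u v e / e\<^sup>2 = dd v (dd u f) q" using e by (simp add: power2_eq_square)
      ultimately show ?thesis by simp
    qed
    then show "\<forall>\<^sub>F e in at_right 0. dist (Q u v e / e\<^sup>2) (dd v (dd u f) p) < d"
      using e1 unfolding eventually_at_right_field by (auto intro!: exI[of _ e1])
  qed
  show ?thesis
    using tendsto_unique[OF _ lim[OF v u] lim[OF u v, unfolded Qsym[of u v]]] by simp
qed


section \<open>Iterated directional derivatives and Taylor expansions along rays\<close>

lemma funpow_dd_smooth: "smooth_on half_space f \<Longrightarrow> smooth_on half_space ((dd v ^^ k) f)"
  by (induction k) (auto intro: smooth_dd)

lemma funpow_dd_cong: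
  fixes f g :: "(real^'n::finite) \<times> real \<Rightarrow> real"
  assumes "\<And>p. p \<in> half_space \<Longrightarrow> f p = g p" "p \<in> half_space"
  shows "(dd v ^^ k) f p = (dd v ^^ k) g p"
  using assms(2)
proof (induction k arbitrary: p)
  case (Suc k)
  then show ?case using dd_cong[of "(dd v ^^ k) f" "(dd v ^^ k) g" p v] by simp
qed (simp add: assms)

lemma funpow_dd_sum:
  fixes F :: "'i \<Rightarrow> (real^'n::finite) \<times> real \<Rightarrow> real"
  assumes "\<And>i. i \<in> I \<Longrightarrow> smooth_on half_space (F i)" "p \<in> half_space"
  shows "(dd v ^^ k) (\<lambda>x. \<Sum>i\<in>I. c i * F i x) p = (\<Sum>i\<in>I. c i * (dd v ^^ k) (F i) p)"
  using assms(2)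
proof (induction k arbitrary: p)
  case (Suc k)
  have "(dd v ^^ Suc k) (\<lambda>x. \<Sum>i\<in>I. c i * F i x) p = dd v (\<lambda>x. \<Sum>i\<in>I. c i * (dd v ^^ k) (F i) x) p"
    using dd_cong[of "(dd v ^^ k) (\<lambda>x. \<Sum>i\<in>I. c i * F i x)" "\<lambda>x. \<Sum>i\<in>I. c i * (dd v ^^ k) (F i) x" p v] Suc by simp
  also have "\<dots> = (\<Sum>i\<in>I. c i * dd v ((dd v ^^ k) (F i)) p)"
    using assms Suc by (intro dd_sum funpow_dd_smooth) auto
  finally show ?case by simp
qed simp

lemma funpow_dd_scaleR:
  fixes f :: "(real^'n::finite) \<times> real \<Rightarrow> real"
  assumes "smooth_on half_space f" "p \<in> half_space"
  shows "(dd (c *\<^sub>R v) ^^ k) f p = c ^ k * (dd v ^^ k) f p"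
  using assms(2)
proof (induction k arbitrary: p)
  case (Suc k)
  have "(dd (c *\<^sub>R v) ^^ Suc k) f p = dd (c *\<^sub>R v) (\<lambda>x. c ^ k * (dd v ^^ k) f x) p"
    using dd_cong[of "(dd (c *\<^sub>R v) ^^ k) f" "\<lambda>x. c ^ k * (dd v ^^ k) f x" p] Suc by simp
  also have "\<dots> = c * dd v (\<lambda>x. c ^ k * (dd v ^^ k) f x) p"
    using assms Suc by (intro dd_scaleR smooth_cmult funpow_dd_smooth) auto
  also have "\<dots> = c * (c ^ k * dd v ((dd v ^^ k) f) p)"
    using assms Suc by (subst dd_cmult) (auto intro!: smooth_has_derivative funpow_dd_smooth)
  finally show ?case by simp
qed simp

lemma funpow_dd_spatial:
  fixes f :: "(real^'n::finite) \<times> real \<Rightarrow> real"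
  assumes "smooth_on half_space f" "p \<in> half_space"
  shows "(dd (z, 0) ^^ Suc k) f p = (\<Sum>i\<in>UNIV. z $ i * (dd (z, 0) ^^ k) (Dx i f) p)"
proof -
  have "(dd (z, 0) ^^ Suc k) f p = (dd (z, 0) ^^ k) (dd (z, 0) f) p"
    by (simp add: funpow_swap1)
  also have "\<dots> = (dd (z, 0) ^^ k) (\<lambda>x. \<Sum>i\<in>UNIV. z $ i * Dx i f x) p"
    using assms by (intro funpow_dd_cong dd_spatial) auto
  also have "\<dots> = (\<Sum>i\<in>UNIV. z $ i * (dd (z, 0) ^^ k) (Dx i f) p)"
    using assms by (intro funpow_dd_sum smooth_dd) auto
  finally show ?thesis .
qed

text \<open>Uniformity in the direction \<open>z\<close> comes from peeling off one derivative as a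
  sum over coordinates with factors \<open>z $ i\<close>; the induction ends with compactness of the
  unit ball.\<close>

lemma funpow_dd_bound:
  fixes f :: "(real^'n::finite) \<times> real \<Rightarrow> real"
  assumes "smooth_on half_space f"
  shows "\<exists>C. \<forall>z x. norm x \<le> 1 \<longrightarrow> \<bar>(dd (z, 0) ^^ k) f (x, 0)\<bar> \<le> C * norm z ^ k"
  using assms
proof (induction k arbitrary: f)
  case 0
  have "continuous_on (cball 0 1) (\<lambda>x. f (x, 0))"
    by (rule continuous_on_compose2[OF smooth_continuous[OF 0]])
      (auto intro!: continuous_intros simp: half_space_iff)
  then have "compact ((\<lambda>x. f (x, 0)) ` cball 0 1)"
    by (rule compact_continuous_image) simp
  then obtain C where "\<forall>y\<in>(\<lambda>x. f (x, 0)) ` cball 0 1. norm y \<le> C"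
    using compact_imp_bounded bounded_iff by blast
  then show ?case by (intro exI[of _ C]) auto
next
  case (Suc k)
  have "\<forall>i. \<exists>C. \<forall>z x. norm x \<le> 1 \<longrightarrow> \<bar>(dd (z, 0) ^^ k) (Dx i f) (x, 0)\<bar> \<le> C * norm z ^ k"
    using Suc.IH[OF smooth_dd[OF Suc.prems]] by blast
  then obtain C where C: "\<And>i z x. norm x \<le> 1 \<Longrightarrow> \<bar>(dd (z, 0) ^^ k) (Dx i f) (x, 0)\<bar> \<le> C i * norm z ^ k"
    by metis
  show ?case
  proof (intro exI[of _ "\<Sum>i\<in>UNIV. C i"] allI impI)
    fix z x :: "real^'n" assume x: "norm x \<le> 1"
    have "\<bar>(dd (z, 0) ^^ Suc k) f (x, 0)\<bar> \<le> (\<Sum>i\<in>UNIV. \<bar>z $ i * (dd (z, 0) ^^ k) (Dx i f) (x, 0)\<bar>)"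
      by (subst funpow_dd_spatial[OF Suc.prems]) (auto simp: half_space_iff)
    also have "\<dots> \<le> (\<Sum>i\<in>UNIV. norm z * (C i * norm z ^ k))"
      unfolding abs_mult using C x component_le_norm_cart[of z] by (intro sum_mono mult_mono) auto
    also have "\<dots> = (\<Sum>i\<in>UNIV. C i) * norm z ^ Suc k"
      by (simp add: sum_distrib_left sum_distrib_right mult_ac)
    finally show "\<bar>(dd (z, 0) ^^ Suc k) f (x, 0)\<bar> \<le> (\<Sum>i\<in>UNIV. C i) * norm z ^ Suc k" .
  qed
qed

text \<open>Induction on the family shifted by one derivative; the mean value theorem transfers the
  remainder bound from the derivative to the function. The factor 1/n! is given up, since only
  orders of magnitude matter.\<close>

lemma one_sided_taylor:
  fixes d :: "nat \<Rightarrow> real \<Rightarrow> real"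
  assumes "\<And>k s. k < n \<Longrightarrow> 0 \<le> s \<Longrightarrow> (d k has_real_derivative d (Suc k) s) (at s within {0..})"
    and "\<And>s. 0 \<le> s \<Longrightarrow> s \<le> 1 \<Longrightarrow> \<bar>d n s\<bar> \<le> C"
    and "0 \<le> r" "r \<le> 1"
  shows "\<bar>d 0 r - (\<Sum>k<n. d k 0 / fact k * r ^ k)\<bar> \<le> C * r ^ n"
  using assms
proof (induction n arbitrary: d r)
  case (Suc n)
  define e where "e s = d 0 s - (\<Sum>k<Suc n. d k 0 / fact k * s ^ k)" for s
  define e' where "e' s = d 1 s - (\<Sum>k<n. d (Suc k) 0 / fact k * s ^ k)" for s
  have e': "\<bar>e' s\<bar> \<le> C * s ^ n" if "0 \<le> s" "s \<le> 1" for s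
    using Suc.IH[of "d \<circ> Suc" s] Suc.prems(1,2) that by (simp add: e'_def)
  have der: "(e has_real_derivative e' s) (at s within {0..})" if s: "0 \<le> s" for s
  proof -
    have 1: "((\<lambda>s. d (Suc k) 0 / fact (Suc k) * s ^ Suc k) has_real_derivative d (Suc k) 0 / fact k * s ^ k) (at s within {0..})" for k
    proof -
      have "((\<lambda>s. d (Suc k) 0 / fact (Suc k) * s ^ Suc k) has_real_derivative d (Suc k) 0 / fact (Suc k) * (real (Suc k) * s ^ k)) (at s within {0..})"
        by (intro DERIV_cmult derivative_eq_intros | simp)+
      moreover have "d (Suc k) 0 / fact (Suc k) * (real (Suc k) * s ^ k) = d (Suc k) 0 / fact k * s ^ k"
        by (simp del: of_nat_Suc)
      ultimately show ?thesis by metis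
    qed
    have "e = (\<lambda>s. d 0 s - (d 0 0 + (\<Sum>k<n. d (Suc k) 0 / fact (Suc k) * s ^ Suc k)))"
      unfolding e_def fun_eq_iff by (subst sum.lessThan_Suc_shift) simp
    moreover have "((\<lambda>s. d 0 s - (d 0 0 + (\<Sum>k<n. d (Suc k) 0 / fact (Suc k) * s ^ Suc k))) has_real_derivative
        (d (Suc 0) s - (0 + (\<Sum>k<n. d (Suc k) 0 / fact k * s ^ k)))) (at s within {0..})"
      using Suc.prems(1)[of 0 s] s by (intro DERIV_diff DERIV_add DERIV_const DERIV_sum 1) auto
    ultimately show ?thesis by (simp add: e'_def)
  qed
  have e0: "e 0 = 0" unfolding e_def by (subst sum.lessThan_Suc_shift) simp
  show ?case
  proof (cases "r = 0")
    case True
    then show ?thesis using e0 by (simp add: e_def)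
  next
    case False
    then have "0 < r" using Suc.prems by simp
    from one_sided_mvt[OF this der] obtain x where x: "0 < x" "x < r" "e r - e 0 = (r - 0) * e' x" by metis
    have "\<bar>e r\<bar> = r * \<bar>e' x\<bar>" using x e0 Suc.prems by (simp add: abs_mult)
    also have "\<dots> \<le> r * (C * x ^ n)" using e'[of x] x Suc.prems by (intro mult_left_mono) auto
    also have "\<dots> \<le> r * (C * r ^ n)"
    proof -
      have "0 \<le> C" using Suc.prems(2)[of 0] by simp
      then show ?thesis using x by (intro mult_left_mono power_mono) auto
    qed
    finally show ?thesis by (simp add: e_def mult_ac)
  qed
qed simp

lemma ray_taylor:
  fixes f :: "(real^'n::finite) \<times> real \<Rightarrow> real"
  assumes f: "smooth_on half_space f" and v: "0 \<le> snd v"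
    and C: "\<And>s. 0 \<le> s \<Longrightarrow> s \<le> 1 \<Longrightarrow> \<bar>(dd v ^^ n) f (s *\<^sub>R v)\<bar> \<le> C" and r: "0 \<le> r" "r \<le> 1"
  shows "\<bar>f (r *\<^sub>R v) - (\<Sum>k<n. (dd v ^^ k) f 0 / fact k * r ^ k)\<bar> \<le> C * r ^ n"
proof -
  have "((\<lambda>s. (dd v ^^ k) f (s *\<^sub>R v)) has_real_derivative (dd v ^^ Suc k) f (s *\<^sub>R v)) (at s within {0..})"
    if "0 \<le> s" for s k
    using ray_derivative[OF funpow_dd_smooth[OF f] _ v that, of 0] by (simp add: half_space_iff)
  from one_sided_taylor[of n "\<lambda>k s. (dd v ^^ k) f (s *\<^sub>R v)" C r, OF this C r]
  show ?thesis by simp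
qed

lemma ray_taylor_ex:
  fixes f :: "(real^'n::finite) \<times> real \<Rightarrow> real"
  assumes f: "smooth_on half_space f" and v: "0 \<le> snd v"
  obtains C where "\<And>r. 0 \<le> r \<Longrightarrow> r \<le> 1 \<Longrightarrow> \<bar>f (r *\<^sub>R v) - (\<Sum>k<n. (dd v ^^ k) f 0 / fact k * r ^ k)\<bar> \<le> C * r ^ n"
proof -
  have "continuous_on {0..1} (\<lambda>s. (dd v ^^ n) f (s *\<^sub>R v))"
    by (rule continuous_on_compose2[OF smooth_continuous[OF funpow_dd_smooth[OF f]]])
      (use v in \<open>auto intro!: continuous_intros simp: half_space_iff\<close>)
  then have "compact ((\<lambda>s. (dd v ^^ n) f (s *\<^sub>R v)) ` {0..1})"
    by (rule compact_continuous_image) simp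
  then obtain C where "\<forall>y\<in>(\<lambda>s. (dd v ^^ n) f (s *\<^sub>R v)) ` {0..1}. norm y \<le> C"
    using compact_imp_bounded bounded_iff by blast
  then show ?thesis using ray_taylor[OF f v, of n C] that by auto
qed


text \<open>The ray in direction \<open>(z, 0)\<close> is followed up to parameter 1. The n-th
  derivative in that direction is homogeneous in \<open>z\<close>, which yields
  \<open>norm z ^ n\<close> with a constant independent of the direction.\<close>

lemma spatial_taylor:
  fixes f :: "(real^'n::finite) \<times> real \<Rightarrow> real"
  assumes f: "smooth_on half_space f"
  obtains C where "\<And>z. norm z \<le> 1 \<Longrightarrow> \<bar>f (z, 0) - (\<Sum>k<n. (dd (z, 0) ^^ k) f 0 / fact k)\<bar> \<le> C * norm z ^ n"
proof -
  obtain C where C: "\<And>z x. norm x \<le> 1 \<Longrightarrow> \<bar>(dd (z, 0) ^^ n) f (x, 0)\<bar> \<le> C * norm z ^ n"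
    using funpow_dd_bound[OF f] by blast
  have "\<bar>f (z, 0) - (\<Sum>k<n. (dd (z, 0) ^^ k) f 0 / fact k)\<bar> \<le> C * norm z ^ n" if "norm z \<le> 1" for z
  proof -
    have "\<bar>(dd (z, 0) ^^ n) f (s *\<^sub>R (z, 0))\<bar> \<le> C * norm z ^ n" if "0 \<le> s" "s \<le> 1" for s
      using C[of "s *\<^sub>R z" z] that \<open>norm z \<le> 1\<close> mult_mono[of s 1 "norm z" 1] by simp
    from ray_taylor[OF f _ this, of 1] show ?thesis by simp
  qed
  then show ?thesis using that by blast
qed

definition quad :: "('n \<Rightarrow> 'n \<Rightarrow> real) \<Rightarrow> real^'n::finite \<Rightarrow> real"
  where "quad A x = (\<Sum>i\<in>UNIV. \<Sum>j\<in>UNIV. A i j * x $ i * x $ j)"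

definition quart :: "('n::finite \<Rightarrow> 'n \<Rightarrow> 'n \<Rightarrow> 'n \<Rightarrow> real) \<Rightarrow> real^'n \<Rightarrow> real"
  where "quart K x = (\<Sum>i\<in>UNIV. \<Sum>j\<in>UNIV. \<Sum>k\<in>UNIV. \<Sum>l\<in>UNIV. K i j k l * x $ i * x $ j * x $ k * x $ l)"

definition D2 :: "((real^'n::finite) \<times> real \<Rightarrow> real) \<Rightarrow> 'n \<Rightarrow> 'n \<Rightarrow> real"
  where "D2 f i j = Dx j (Dx i f) 0"

definition D4 :: "((real^'n::finite) \<times> real \<Rightarrow> real) \<Rightarrow> 'n \<Rightarrow> 'n \<Rightarrow> 'n \<Rightarrow> 'n \<Rightarrow> real"
  where "D4 f i j k l = Dx l (Dx k (Dx j (Dx i f))) 0"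

lemma dd2_zero:
  fixes f :: "(real^'n::finite) \<times> real \<Rightarrow> real"
  assumes "smooth_on half_space f"
  shows "(dd (z, 0) ^^ 2) f 0 = quad (D2 f) z"
proof -
  have 0: "(0 :: (real^'n) \<times> real) \<in> half_space" by (simp add: half_space_iff)
  show ?thesis
    unfolding numeral_2_eq_2
    by (simp only: funpow_dd_spatial assms smooth_dd 0 funpow_0 D2_def quad_def sum_distrib_left mult_ac)
qed

lemma dd4_zero:
  fixes f :: "(real^'n::finite) \<times> real \<Rightarrow> real"
  assumes "smooth_on half_space f"
  shows "(dd (z, 0) ^^ 4) f 0 = quart (D4 f) z"
proof -
  have 0: "(0 :: (real^'n) \<times> real) \<in> half_space" by (simp add: half_space_iff)
  have 4: "4 = Suc (Suc (Suc (Suc 0)))" by simp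
  show ?thesis
    unfolding 4
    by (simp only: funpow_dd_spatial assms smooth_dd 0 funpow_0 D4_def quart_def sum_distrib_left mult_ac)
qed

lemma D2_commute:
  fixes f :: "(real^'n::finite) \<times> real \<Rightarrow> real"
  assumes "smooth_on half_space f"
  shows "D2 f i j = D2 f j i"
  unfolding D2_def by (rule dd_commute[OF assms]) (auto simp: half_space_iff)

lemma D4_commute:
  fixes f :: "(real^'n::finite) \<times> real \<Rightarrow> real"
  assumes f: "smooth_on half_space f"
  shows "D4 f i j k l = D4 f j i k l" "D4 f i j k l = D4 f i k j l" "D4 f i j k l = D4 f i j l k"
proof -
  have c: "Dx a (Dx b F) p = Dx b (Dx a F) p" if "smooth_on half_space F" "p \<in> half_space" for a b F p
    by (rule dd_commute[OF that]) auto
  have 0: "(0 :: (real^'n) \<times> real) \<in> half_space" by (simp add: half_space_iff)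
  have s: "smooth_on half_space (Dx a F)" if "smooth_on half_space F" for a F
    using that by (rule smooth_dd)
  show "D4 f i j k l = D4 f j i k l"
    unfolding D4_def by (intro dd_cong c f 0)
  show "D4 f i j k l = D4 f i k j l"
    unfolding D4_def by (intro dd_cong c s f 0)
  show "D4 f i j k l = D4 f i j l k"
    unfolding D4_def by (intro c s f 0)
qed

lemma average_bound:
  fixes a b p q r s M :: real
  assumes "\<bar>a - (p + q + r + s)\<bar> \<le> M" "\<bar>b - (p - q + r - s)\<bar> \<le> M"
  shows "\<bar>(a + b) / 2 - p - r\<bar> \<le> M"
  using assms unfolding abs_le_iff by (auto simp: field_simps)

text \<open>Derivatives of odd order change sign with \<open>z\<close>. The third and fifth order
  terms thus cancel in the even part, and the second order term cancels in the odd part; value and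
  gradient vanish at the origin by hypothesis.\<close>

lemma spatial_expansion:
  fixes f :: "(real^'n::finite) \<times> real \<Rightarrow> real"
  assumes f: "smooth_on half_space f" and f0: "f 0 = 0" and f1: "\<And>i. Dx i f 0 = 0"
  obtains C where "0 \<le> C"
    "\<And>z. norm z \<le> 1 \<Longrightarrow> \<bar>(f (z, 0) + f (- z, 0)) / 2
        - quad (D2 f) z / 2
        - quart (D4 f) z / 24\<bar> \<le> C * norm z ^ 6"
    "\<And>z. norm z \<le> 1 \<Longrightarrow> \<bar>f (z, 0) - f (- z, 0)\<bar> \<le> C * norm z ^ 3"
    "\<And>z. norm z \<le> 1 \<Longrightarrow> \<bar>f (z, 0)\<bar> \<le> C * norm z ^ 2"
proof -
  obtain C2 where C2: "\<And>z. norm z \<le> 1 \<Longrightarrow> \<bar>f (z, 0) - (\<Sum>k<2. (dd (z, 0) ^^ k) f 0 / fact k)\<bar> \<le> C2 * norm z ^ 2"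
    using spatial_taylor[OF f, of 2] by auto
  obtain C3 where C3: "\<And>z. norm z \<le> 1 \<Longrightarrow> \<bar>f (z, 0) - (\<Sum>k<3. (dd (z, 0) ^^ k) f 0 / fact k)\<bar> \<le> C3 * norm z ^ 3"
    using spatial_taylor[OF f, of 3] by auto
  obtain C6 where C6: "\<And>z. norm z \<le> 1 \<Longrightarrow> \<bar>f (z, 0) - (\<Sum>k<6. (dd (z, 0) ^^ k) f 0 / fact k)\<bar> \<le> C6 * norm z ^ 6"
    using spatial_taylor[OF f, of 6] by auto
  \<comment> \<open>Absolute values, because the Taylor constants are not known to be nonnegative;
    the factor 2 because the odd part uses the third order bound at both \<open>z\<close> and
    \<open>- z\<close>.\<close>
  define C where "C = \<bar>C2\<bar> + 2 * \<bar>C3\<bar> + \<bar>C6\<bar>"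
  have 0: "(0 :: (real^'n) \<times> real) \<in> half_space" by (simp add: half_space_iff)
  have par: "(dd (- z, 0) ^^ k) f 0 = (- 1) ^ k * (dd (z, 0) ^^ k) f 0" for z k
    using funpow_dd_scaleR[OF f 0, where c = "-1" and v = "(z, 0)" and k = k] by simp
  have one: "dd (z, 0) f 0 = 0" for z
    using dd_spatial[OF f 0, of z] f1 by simp
  show ?thesis
  proof (rule that[of C])
    show "0 \<le> C" by (simp add: C_def)
    fix z :: "real^'n" assume z: "norm z \<le> 1"
    then have mz: "norm (- z) \<le> 1" by simp
    define X where "X k = (dd (z, 0) ^^ k) f 0" for k
    have le: "\<bar>C2\<bar> * norm z ^ k \<le> C * norm z ^ k" "2 * \<bar>C3\<bar> * norm z ^ k \<le> C * norm z ^ k"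
      "\<bar>C6\<bar> * norm z ^ k \<le> C * norm z ^ k" for k
      unfolding C_def by (intro mult_right_mono; simp)+
    have le': "C2 * norm z ^ k \<le> \<bar>C2\<bar> * norm z ^ k" "C3 * norm z ^ k \<le> \<bar>C3\<bar> * norm z ^ k" "C6 * norm z ^ k \<le> \<bar>C6\<bar> * norm z ^ k" for k
      by (intro mult_right_mono; simp)+
    have X: "X 0 = 0" "X (Suc 0) = 0" using f0 one by (simp_all add: X_def)
    show "\<bar>f (z, 0)\<bar> \<le> C * norm z ^ 2"
      using C2[OF z] X le(1)[of 2] le'(1)[of 2] by (simp add: X_def[symmetric] numeral_2_eq_2)
    have a: "\<bar>f (z, 0) - X 2 / 2\<bar> \<le> C3 * norm z ^ 3" "\<bar>f (- z, 0) - X 2 / 2\<bar> \<le> C3 * norm z ^ 3"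
      using C3[OF z] C3[OF mz] X unfolding par X_def[symmetric] by (simp_all add: eval_nat_numeral)
    show "\<bar>f (z, 0) - f (- z, 0)\<bar> \<le> C * norm z ^ 3"
      using a le(2)[of 3] le'(2)[of 3] by linarith
    have b: "\<bar>f (z, 0) - (X 2 / 2 + X 3 / 6 + X 4 / 24 + X 5 / 120)\<bar> \<le> C6 * norm z ^ 6"
      "\<bar>f (- z, 0) - (X 2 / 2 - X 3 / 6 + X 4 / 24 - X 5 / 120)\<bar> \<le> C6 * norm z ^ 6"
      using C6[OF z] C6[OF mz] X unfolding par X_def[symmetric]
      by (simp_all add: eval_nat_numeral)
    have "\<bar>(f (z, 0) + f (- z, 0)) / 2 - X 2 / 2 - X 4 / 24\<bar> \<le> C * norm z ^ 6"
    proof -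
      have M: "C6 * norm z ^ 6 \<le> C * norm z ^ 6" using le(3)[of 6] le'(3)[of 6] by linarith
      have "\<bar>f (z, 0) - (X 2 / 2 + X 3 / 6 + X 4 / 24 + X 5 / 120)\<bar> \<le> C * norm z ^ 6"
        "\<bar>f (- z, 0) - (X 2 / 2 - X 3 / 6 + X 4 / 24 - X 5 / 120)\<bar> \<le> C * norm z ^ 6"
        using b M by linarith+
      then show ?thesis using average_bound[of "f (z, 0)" "X 2 / 2" "X 3 / 6" "X 4 / 24" "X 5 / 120"] by simp
    qed
    then show "\<bar>(f (z, 0) + f (- z, 0)) / 2
        - quad (D2 f) z / 2
        - quart (D4 f) z / 24\<bar> \<le> C * norm z ^ 6"
      by (simp only: X_def dd2_zero[OF f] dd4_zero[OF f])
  qed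
qed

section \<open>The evolution equation at the origin\<close>

definition mcf_defect :: "((real^'n::finite) \<times> real \<Rightarrow> real) \<Rightarrow> (real^'n) \<times> real \<Rightarrow> real"
  where "mcf_defect f p = Dt f p - (\<Sum>i\<in>UNIV. Dx i (Dx i f) p)"

text \<open>Written as a time derivative minus a Laplacian, the defect is smooth by linear
  operations alone. The quotient that it equals under the flow is never differentiated.\<close>

lemma smooth_mcf_defect:
  fixes f :: "(real^'n::finite) \<times> real \<Rightarrow> real"
  assumes "smooth_on half_space f"
  shows "smooth_on half_space (mcf_defect f)"
proof -
  have "smooth_on half_space (\<lambda>p. Dt f p + (\<Sum>i\<in>UNIV. (-1) * Dx i (Dx i f) p))"
    using assms by (intro smooth_add smooth_sum smooth_dd) auto
  then show ?thesis by (simp add: mcf_defect_def[abs_def] sum_negf)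
qed

text \<open>
  The defect is quadratic in the gradient, which vanishes at the origin; so its first two derivatives
  along a ray can be read off from the limit of its quotient by \<open>r\<^sup>2\<close>, without a product rule.
\<close>

lemma mcf_defect_ray:
  fixes f :: "(real^'n::finite) \<times> real \<Rightarrow> real"
  assumes f: "smooth_on half_space f" and f1: "\<And>i. Dx i f 0 = 0" and mcf: "graph_mcf f"
    and v: "0 \<le> snd v"
  shows "dd v (mcf_defect f) 0 = 0"
    and "dd v (dd v (mcf_defect f)) 0 = - 2 * (\<Sum>i\<in>UNIV. \<Sum>j\<in>UNIV. dd v (Dx i f) 0 * dd v (Dx j f) 0 * D2 f i j)"
proof -
  let ?L = "mcf_defect f"
  define R where "R = (\<Sum>i\<in>UNIV. \<Sum>j\<in>UNIV. dd v (Dx i f) 0 * dd v (Dx j f) 0 * D2 f i j)"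
  have 0: "(0 :: (real^'n) \<times> real) \<in> half_space" by (simp add: half_space_iff)
  have L: "?L p = - (\<Sum>i\<in>UNIV. \<Sum>j\<in>UNIV. Dx i f p * Dx j f p * Dx j (Dx i f) p)
           / (1 + (\<Sum>i\<in>UNIV. (Dx i f p)\<^sup>2))" if "p \<in> half_space" for p
    using mcf that unfolding graph_mcf_def mcf_defect_def by simp
  have L0: "?L 0 = 0" using L[OF 0] f1 by simp
  have filt: "(at 0 within {0..}) = (at_right (0::real))"
    by (metis Ici_subset_Ioi_iff at_within_Ici_at_right)
  have cont: "((\<lambda>r. F (r *\<^sub>R v)) \<longlongrightarrow> F 0) (at_right 0)" if F: "smooth_on half_space F" for F :: "(real^'n) \<times> real \<Rightarrow> real"
  proof -
    have "((\<lambda>r. F (0 + r *\<^sub>R v)) has_real_derivative dd v F (0 + 0 *\<^sub>R v)) (at 0 within {0..})"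
      using ray_derivative[OF F 0 v] by blast
    then have "continuous (at 0 within {0..}) (\<lambda>r. F (0 + r *\<^sub>R v))"
      by (rule DERIV_continuous)
    then show ?thesis by (simp add: continuous_within filt)
  qed
  have cont0: "((\<lambda>r. Dx i f (r *\<^sub>R v)) \<longlongrightarrow> 0) (at_right 0)" for i
    using cont[OF smooth_dd[OF f], of "(axis i 1, 0)"] by (simp add: f1)
  have cont2: "((\<lambda>r. Dx j (Dx i f) (r *\<^sub>R v)) \<longlongrightarrow> Dx j (Dx i f) 0) (at_right 0)" for i j
    by (rule cont[OF smooth_dd[OF smooth_dd[OF f]]])
  have slope: "((\<lambda>r. Dx i f (r *\<^sub>R v) / r) \<longlongrightarrow> dd v (Dx i f) 0) (at_right 0)" for i
  proof -
    have "((\<lambda>r. Dx i f (0 + r *\<^sub>R v)) has_real_derivative dd v (Dx i f) (0 + 0 *\<^sub>R v)) (at 0 within {0..})"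
      using ray_derivative[OF smooth_dd[OF f] 0 v] by blast
    then show ?thesis by (simp add: has_field_derivative_iff filt f1)
  qed
  have lim_sum: "((\<lambda>r. - (\<Sum>i\<in>UNIV. \<Sum>j\<in>UNIV. (Dx i f (r *\<^sub>R v) / r) * (Dx j f (r *\<^sub>R v) / r) * Dx j (Dx i f) (r *\<^sub>R v))
           / (1 + (\<Sum>i\<in>UNIV. (Dx i f (r *\<^sub>R v))\<^sup>2))) \<longlongrightarrow> - R / (1 + (\<Sum>i\<in>(UNIV::'n set). (0::real)\<^sup>2))) (at_right 0)"
    unfolding R_def D2_def
    by (intro tendsto_divide tendsto_minus tendsto_sum tendsto_mult tendsto_add tendsto_power tendsto_const
        slope cont0 cont2) simp
  have unit_denominator: "- R / (1 + (\<Sum>i\<in>(UNIV::'n set). (0::real)\<^sup>2)) = - R" by simp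
  have "\<forall>\<^sub>F r in at_right 0. - (\<Sum>i\<in>UNIV. \<Sum>j\<in>UNIV. (Dx i f (r *\<^sub>R v) / r) * (Dx j f (r *\<^sub>R v) / r) * Dx j (Dx i f) (r *\<^sub>R v))
           / (1 + (\<Sum>i\<in>UNIV. (Dx i f (r *\<^sub>R v))\<^sup>2)) = ?L (r *\<^sub>R v) / r\<^sup>2"
    unfolding eventually_at_right_field
  proof (intro exI[of _ 1] conjI allI impI)
    fix r :: real assume r: "0 < r"
    have "r *\<^sub>R v \<in> half_space" using half_space_ray[OF 0 v, of r] r by simp
    from L[OF this] show "- (\<Sum>i\<in>UNIV. \<Sum>j\<in>UNIV. (Dx i f (r *\<^sub>R v) / r) * (Dx j f (r *\<^sub>R v) / r) * Dx j (Dx i f) (r *\<^sub>R v))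
           / (1 + (\<Sum>i\<in>UNIV. (Dx i f (r *\<^sub>R v))\<^sup>2)) = ?L (r *\<^sub>R v) / r\<^sup>2"
      using r by (simp add: sum_divide_distrib[symmetric] power2_eq_square)
  qed simp
  from Lim_transform_eventually[OF lim_sum this]
  have "((\<lambda>r. ?L (r *\<^sub>R v) / r\<^sup>2) \<longlongrightarrow> - R / (1 + (\<Sum>i\<in>(UNIV::'n set). (0::real)\<^sup>2))) (at_right 0)" .
  then have quad: "((\<lambda>r. ?L (r *\<^sub>R v) / r\<^sup>2) \<longlongrightarrow> - R) (at_right 0)"
    unfolding unit_denominator .
  obtain C where C: "\<And>r. 0 \<le> r \<Longrightarrow> r \<le> 1 \<Longrightarrow> \<bar>?L (r *\<^sub>R v) - (\<Sum>k<3. (dd v ^^ k) ?L 0 / fact k * r ^ k)\<bar> \<le> C * r ^ 3"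
    by (rule ray_taylor_ex[OF smooth_mcf_defect[OF f] v, of 3], rule that, blast)
  define a b where "a = dd v ?L 0" and "b = dd v (dd v ?L) 0"
  have C': "\<bar>?L (r *\<^sub>R v) - (a * r + b / 2 * r\<^sup>2)\<bar> \<le> C * r ^ 3" if "0 \<le> r" "r \<le> 1" for r
    using C[OF that] by (simp add: a_def b_def L0 eval_nat_numeral)
  have r0: "((\<lambda>r. r) \<longlongrightarrow> 0) (at_right (0::real))" by (rule tendsto_ident_at)
  have "((\<lambda>r. (?L (r *\<^sub>R v) - (a * r + b / 2 * r\<^sup>2)) / r\<^sup>2) \<longlongrightarrow> 0) (at_right 0)"
  proof (rule Lim_null_comparison)
    show "\<forall>\<^sub>F r in at_right 0. norm ((?L (r *\<^sub>R v) - (a * r + b / 2 * r\<^sup>2)) / r\<^sup>2) \<le> C * r"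
      unfolding eventually_at_right_field
    proof (intro exI[of _ 1] conjI allI impI)
      fix r :: real assume r: "0 < r" "r < 1"
      show "norm ((?L (r *\<^sub>R v) - (a * r + b / 2 * r\<^sup>2)) / r\<^sup>2) \<le> C * r"
        using C'[of r] r by (simp add: abs_divide divide_le_eq eval_nat_numeral mult_ac)
    qed simp
    show "((\<lambda>r. C * r) \<longlongrightarrow> 0) (at_right 0)" using tendsto_mult[OF tendsto_const r0, of C] by simp
  qed
  from tendsto_diff[OF quad this]
  have lim_diff: "((\<lambda>r. ?L (r *\<^sub>R v) / r\<^sup>2 - (?L (r *\<^sub>R v) - (a * r + b / 2 * r\<^sup>2)) / r\<^sup>2) \<longlongrightarrow> - R) (at_right 0)"
    by (simp only: diff_zero)
  have "\<forall>\<^sub>F r in at_right 0. ?L (r *\<^sub>R v) / r\<^sup>2 - (?L (r *\<^sub>R v) - (a * r + b / 2 * r\<^sup>2)) / r\<^sup>2 = a / r + b / 2"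
    unfolding eventually_at_right_field
    by (intro exI[of _ 1]) (auto simp: field_simps power2_eq_square)
  from Lim_transform_eventually[OF lim_diff this]
  have ab: "((\<lambda>r. a / r + b / 2) \<longlongrightarrow> - R) (at_right 0)" .
  \<comment> \<open>Multiplying a convergent quotient by r gives the limit 0, so the linear
    coefficient \<open>a\<close> must vanish.\<close>
  have "((\<lambda>r. (a / r + b / 2) * r) \<longlongrightarrow> - R * 0) (at_right 0)"
    by (rule tendsto_mult[OF ab r0])
  moreover have "((\<lambda>r. (a / r + b / 2) * r) \<longlongrightarrow> a) (at_right 0)"
  proof (rule Lim_transform_eventually)
    show "((\<lambda>r. a + b / 2 * r) \<longlongrightarrow> a) (at_right 0)"
      using tendsto_add[OF tendsto_const tendsto_mult[OF tendsto_const r0], of a "b/2"] by simp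
    show "\<forall>\<^sub>F r in at_right 0. a + b / 2 * r = (a / r + b / 2) * r"
      unfolding eventually_at_right_field by (intro exI[of _ 1]) (auto simp: field_simps)
  qed
  ultimately have a: "a = 0" using tendsto_unique[OF trivial_limit_at_right_real] by fastforce
  then show "dd v ?L 0 = 0" by (simp add: a_def)
  from ab a have "((\<lambda>r::real. b / 2) \<longlongrightarrow> - R) (at_right 0)" by simp
  from tendsto_unique[OF trivial_limit_at_right_real this tendsto_const]
  show "dd v (dd v ?L) 0 = - 2 * (\<Sum>i\<in>UNIV. \<Sum>j\<in>UNIV. dd v (Dx i f) 0 * dd v (Dx j f) 0 * D2 f i j)"
    by (simp add: b_def R_def)
qed

text \<open>Time derivatives are moved past the Laplacian, so the second one is the Laplacian of the
  first plus the time derivative of the defect. The latter vanishes at the origin, while the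
  Laplacian of the defect contributes -2 tr H^3 by \<open>mcf_defect_ray\<close> along the
  coordinate axes.\<close>

theorem mcf_time_expansion:
  fixes f :: "(real^'n::finite) \<times> real \<Rightarrow> real"
  assumes f: "smooth_on half_space f" and f0: "f 0 = 0" and f1: "\<And>i. Dx i f 0 = 0" and mcf: "graph_mcf f"
  obtains C where "\<And>t. 0 \<le> t \<Longrightarrow> t \<le> 1 \<Longrightarrow> \<bar>f (0, t) - (t * (\<Sum>i\<in>UNIV. D2 f i i)
    + t\<^sup>2 * ((\<Sum>i\<in>UNIV. \<Sum>k\<in>UNIV. D4 f k k i i) / 2 - (\<Sum>i\<in>UNIV. \<Sum>j\<in>UNIV. \<Sum>k\<in>UNIV. D2 f i k * D2 f k j * D2 f i j)))\<bar> \<le> C * t ^ 3"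
proof -
  let ?L = "mcf_defect f"
  have 0: "(0 :: (real^'n) \<times> real) \<in> half_space" by (simp add: half_space_iff)
  define e :: "(real^'n) \<times> real" where "e = (0, 1)"
  have e: "0 \<le> snd e" by (simp add: e_def)
  have Dt: "dd e f p = ?L p + (\<Sum>i\<in>UNIV. 1 * Dx i (Dx i f) p)" for p
    by (simp add: mcf_defect_def e_def)
  have sm: "smooth_on half_space (\<lambda>p. \<Sum>i\<in>UNIV. 1 * Dx i (Dx i f) p)"
    using f by (intro smooth_sum smooth_dd) auto
  have sL: "smooth_on half_space ?L" using smooth_mcf_defect[OF f] .
  have dDt: "dd v (dd e f) p = dd v ?L p + (\<Sum>i\<in>UNIV. dd v (Dx i (Dx i f)) p)" if "p \<in> half_space" for v p
  proof -
    have "dd v (dd e f) p = dd v (\<lambda>p. ?L p + (\<Sum>i\<in>UNIV. 1 * Dx i (Dx i f) p)) p"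
      by (rule dd_cong[OF _ that]) (simp add: Dt)
    also have "\<dots> = dd v ?L p + dd v (\<lambda>p. \<Sum>i\<in>UNIV. 1 * Dx i (Dx i f) p) p"
      by (rule dd_add) (intro smooth_has_derivative sL sm that)+
    also have "dd v (\<lambda>p. \<Sum>i\<in>UNIV. 1 * Dx i (Dx i f) p) p = (\<Sum>i\<in>UNIV. 1 * dd v (Dx i (Dx i f)) p)"
      by (rule dd_sum) (intro smooth_dd f that)+
    finally show ?thesis by simp
  qed
  have sDi: "smooth_on half_space (\<lambda>p. \<Sum>k\<in>UNIV. 1 * Dx i (Dx k (Dx k f)) p)" for i
    using f by (intro smooth_sum smooth_dd) auto
  have ddDt: "Dx i (Dx i (dd e f)) 0 = Dx i (Dx i ?L) 0 + (\<Sum>k\<in>UNIV. D4 f k k i i)" for i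
  proof -
    have "Dx i (Dx i (dd e f)) 0 = Dx i (\<lambda>p. Dx i ?L p + (\<Sum>k\<in>UNIV. 1 * Dx i (Dx k (Dx k f)) p)) 0"
      by (rule dd_cong[OF _ 0]) (simp add: dDt)
    also have "\<dots> = Dx i (Dx i ?L) 0 + Dx i (\<lambda>p. \<Sum>k\<in>UNIV. 1 * Dx i (Dx k (Dx k f)) p) 0"
      by (rule dd_add) (intro smooth_has_derivative smooth_dd sL sDi 0)+
    also have "Dx i (\<lambda>p. \<Sum>k\<in>UNIV. 1 * Dx i (Dx k (Dx k f)) p) 0 = (\<Sum>k\<in>UNIV. 1 * Dx i (Dx i (Dx k (Dx k f))) 0)"
      by (rule dd_sum) (intro smooth_dd f 0)+
    finally show ?thesis by (simp add: D4_def)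
  qed
  have comm: "dd e (Dx i (Dx i f)) 0 = Dx i (Dx i (dd e f)) 0" for i
  proof -
    have "dd e (Dx i (Dx i f)) 0 = Dx i (dd e (Dx i f)) 0"
      by (rule dd_commute[OF smooth_dd[OF f] 0 e]) simp
    also have "\<dots> = Dx i (Dx i (dd e f)) 0"
      by (rule dd_cong[OF _ 0], rule dd_commute[OF f _ e]) auto
    finally show ?thesis .
  qed
  have T: "dd e f 0 = (\<Sum>i\<in>UNIV. D2 f i i)"
  proof -
    have "?L 0 = 0" using mcf 0 f1 unfolding graph_mcf_def mcf_defect_def by simp
    then show ?thesis using Dt[of 0] by (simp add: D2_def)
  qed
  have LL: "Dx i (Dx i ?L) 0 = - 2 * (\<Sum>j\<in>UNIV. \<Sum>k\<in>UNIV. D2 f j i * D2 f k i * D2 f j k)" for i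
    using mcf_defect_ray(2)[OF f f1 mcf, of "(axis i 1, 0)"] by (simp add: D2_def)
  have "dd e (dd e f) 0 = (\<Sum>i\<in>UNIV. Dx i (Dx i ?L) 0 + (\<Sum>k\<in>UNIV. D4 f k k i i))"
    using dDt[OF 0, of e] mcf_defect_ray(1)[OF f f1 mcf e] by (simp add: comm ddDt)
  also have "\<dots> = (\<Sum>i\<in>UNIV. \<Sum>k\<in>UNIV. D4 f k k i i) - 2 * (\<Sum>i\<in>UNIV. \<Sum>j\<in>UNIV. \<Sum>k\<in>UNIV. D2 f j i * D2 f k i * D2 f j k)"
    by (simp add: LL sum.distrib sum_negf sum_subtractf sum_distrib_left)
  also have "(\<Sum>i\<in>UNIV. \<Sum>j\<in>UNIV. \<Sum>k\<in>UNIV. D2 f j i * D2 f k i * D2 f j k) = (\<Sum>i\<in>UNIV. \<Sum>j\<in>UNIV. \<Sum>k\<in>UNIV. D2 f i k * D2 f k j * D2 f i j)"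
    by (intro sum.cong refl) (use D2_commute[OF f] in \<open>simp add: mult_ac\<close>)
  finally have tt: "dd e (dd e f) 0 = (\<Sum>i\<in>UNIV. \<Sum>k\<in>UNIV. D4 f k k i i) - 2 * (\<Sum>i\<in>UNIV. \<Sum>j\<in>UNIV. \<Sum>k\<in>UNIV. D2 f i k * D2 f k j * D2 f i j)" .
  obtain C where C: "\<And>r. 0 \<le> r \<Longrightarrow> r \<le> 1 \<Longrightarrow> \<bar>f (r *\<^sub>R e) - (\<Sum>k<3. (dd e ^^ k) f 0 / fact k * r ^ k)\<bar> \<le> C * r ^ 3"
    by (rule ray_taylor_ex[OF f e, of 3], rule that, blast)
  show ?thesis
  proof (rule that[of C])
    fix t :: real assume "0 \<le> t" "t \<le> 1"
    from C[OF this] have "\<bar>f (t *\<^sub>R e) - (dd e f 0 * t + dd e (dd e f) 0 / 2 * t\<^sup>2)\<bar> \<le> C * t ^ 3"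
      by (simp add: f0 eval_nat_numeral)
    then show "\<bar>f (0, t) - (t * (\<Sum>i\<in>UNIV. D2 f i i)
    + t\<^sup>2 * ((\<Sum>i\<in>UNIV. \<Sum>k\<in>UNIV. D4 f k k i i) / 2 - (\<Sum>i\<in>UNIV. \<Sum>j\<in>UNIV. \<Sum>k\<in>UNIV. D2 f i k * D2 f k j * D2 f i j)))\<bar> \<le> C * t ^ 3"
      unfolding T tt by (simp add: e_def algebra_simps diff_divide_distrib)
  qed
qed

section \<open>The standard Gaussian measure\<close>

text \<open>A product over the basis, so that moments factor into one-dimensional integrals. The
  radial form used for reflections and scalings is \<open>gauss_density_eq\<close>.\<close>

definition gauss_density :: "'a::euclidean_space \<Rightarrow> real"
  where "gauss_density x = (\<Prod>b\<in>Basis. std_normal_density (x \<bullet> b))"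

definition gauss_measure :: "'a::euclidean_space measure"
  where "gauss_measure = density lborel (\<lambda>x. ennreal (gauss_density x))"

abbreviation \<E> :: "('a::euclidean_space \<Rightarrow> real) \<Rightarrow> real"
  where "\<E> F \<equiv> integral\<^sup>L gauss_measure F"

lemma gauss_density_eq:
  "gauss_density (x::'a::euclidean_space) = exp (- (norm x)\<^sup>2 / 2) / (2 * pi) powr (real DIM('a) / 2)"
proof -
  have "sqrt (2 * pi) ^ DIM('a) = (2 * pi) powr (real DIM('a) / 2)"
    by (simp add: powr_half_sqrt[symmetric] powr_realpow[symmetric] powr_powr)
  moreover have "(norm x)\<^sup>2 = (\<Sum>b\<in>Basis. (x \<bullet> b)\<^sup>2)"
    unfolding power2_norm_eq_inner by (subst euclidean_inner) (simp add: power2_eq_square)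
  ultimately show ?thesis
    unfolding gauss_density_def std_normal_density_def prod.distrib
    by (simp add: exp_sum[symmetric] sum_negf sum_divide_distrib[symmetric] power_one_over divide_simps)
qed

lemma gauss_density_nonneg: "0 \<le> gauss_density x"
  by (simp add: gauss_density_def prod_nonneg)

lemma gauss_density_measurable [measurable]: "gauss_density \<in> borel_measurable borel"
  unfolding gauss_density_def[abs_def] by measurable

lemma sets_gauss_measure [measurable_cong, simp]: "sets gauss_measure = sets borel"
  by (simp add: gauss_measure_def)

lemma space_gauss_measure [simp]: "space gauss_measure = UNIV"
  by (simp add: gauss_measure_def)

text \<open>\<open>lborel\<close> is the image of a product of one-dimensional Lebesgue measures
  under the coordinate map, so Fubini for finite products applies.\<close>

lemma lborel_product_integral:
  fixes f :: "'a::euclidean_space \<Rightarrow> real \<Rightarrow> real"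
  assumes "\<And>b. b \<in> Basis \<Longrightarrow> integrable lborel (f b)"
  shows "integrable lborel (\<lambda>x. \<Prod>b\<in>Basis. f b (x \<bullet> b))" (is ?I)
    and "(\<integral>x. (\<Prod>b\<in>Basis. f b (x \<bullet> b)) \<partial>lborel) = (\<Prod>b\<in>Basis. integral\<^sup>L lborel (f b))" (is ?E)
proof -
  interpret product_sigma_finite "\<lambda>_::'a. lborel :: real measure" by standard
  have [measurable]: "f b \<in> borel_measurable borel" if "b \<in> Basis" for b
    using assms[OF that] by (simp add: borel_measurable_integrable)
  have m: "(\<lambda>x. \<Prod>b\<in>Basis. f b (x \<bullet> b)) \<in> borel_measurable (borel :: 'a measure)"
  proof (rule borel_measurable_prod)
    fix b :: 'a assume "b \<in> Basis"
    then show "(\<lambda>x. f b (x \<bullet> b)) \<in> borel_measurable borel"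
      by (intro measurable_compose[of "\<lambda>x. x \<bullet> b" borel borel "f b"]) auto
  qed
  have t: "(\<lambda>g. \<Sum>b\<in>Basis. g b *\<^sub>R b) \<in> measurable (Pi\<^sub>M Basis (\<lambda>_::'a. lborel)) (borel :: 'a measure)"
    by measurable
  have e: "(\<Prod>b\<in>Basis. f b ((\<Sum>b'\<in>Basis. g b' *\<^sub>R b') \<bullet> b)) = (\<Prod>b\<in>Basis. f b (g b))" for g :: "'a \<Rightarrow> real"
    by (intro prod.cong refl) (simp add: inner_sum_left inner_Basis if_distrib cong: if_cong)
  show ?I
    by (subst lborel_eq, subst integrable_distr_eq[OF t m]) (simp add: e product_integrable_prod assms)
  show ?E
    by (subst lborel_eq, subst integral_distr[OF t m]) (simp add: e product_integral_prod assms)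
qed

lemma gauss_integrable_iff:
  fixes F :: "'a::euclidean_space \<Rightarrow> real"
  assumes "F \<in> borel_measurable borel"
  shows "integrable gauss_measure F \<longleftrightarrow> integrable lborel (\<lambda>x. gauss_density x * F x)"
  unfolding gauss_measure_def using assms
  by (subst integrable_density) (auto simp: gauss_density_nonneg)

lemma gauss_expectation_eq:
  fixes F :: "'a::euclidean_space \<Rightarrow> real"
  assumes "F \<in> borel_measurable borel"
  shows "\<E> F = (\<integral>x. gauss_density x * F x \<partial>lborel)"
  unfolding gauss_measure_def using assms
  by (subst integral_density) (auto simp: gauss_density_nonneg)

lemma gauss_product_expectation:
  fixes f :: "'a::euclidean_space \<Rightarrow> real \<Rightarrow> real"
  assumes f: "\<And>b. b \<in> Basis \<Longrightarrow> integrable lborel (\<lambda>x. std_normal_density x * f b x)"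
    and m: "\<And>b. b \<in> Basis \<Longrightarrow> f b \<in> borel_measurable borel"
  shows "integrable gauss_measure (\<lambda>x. \<Prod>b\<in>Basis. f b (x \<bullet> b))" (is ?I)
    and "\<E> (\<lambda>x. \<Prod>b\<in>Basis. f b (x \<bullet> b)) = (\<Prod>b\<in>Basis. \<integral>x. std_normal_density x * f b x \<partial>lborel)" (is ?E)
proof -
  have M: "(\<lambda>x. \<Prod>b\<in>Basis. f b (x \<bullet> b)) \<in> borel_measurable (borel :: 'a measure)"
  proof (rule borel_measurable_prod)
    fix b :: 'a assume "b \<in> Basis"
    then show "(\<lambda>x. f b (x \<bullet> b)) \<in> borel_measurable borel"
      using m by (intro measurable_compose[of "\<lambda>x. x \<bullet> b" borel borel "f b"]) auto
  qed
  have e: "gauss_density x * (\<Prod>b\<in>Basis. f b (x \<bullet> b)) = (\<Prod>b\<in>Basis. std_normal_density (x \<bullet> b) * f b (x \<bullet> b))" for x :: 'a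
    by (simp add: gauss_density_def prod.distrib)
  show ?I unfolding gauss_integrable_iff[OF M] e by (rule lborel_product_integral(1)[OF f])
  show ?E unfolding gauss_expectation_eq[OF M] e by (rule lborel_product_integral(2)[OF f])
qed

lemma prob_space_gauss_measure: "prob_space (gauss_measure :: 'a::euclidean_space measure)"
proof
  have "integrable lborel (gauss_density :: 'a \<Rightarrow> real)" "(\<integral>x. gauss_density (x::'a) \<partial>lborel) = 1"
    using lborel_product_integral[of "\<lambda>b::'a. std_normal_density"]
    by (simp_all add: gauss_density_def[abs_def])
  then show "emeasure gauss_measure (space gauss_measure :: 'a set) = 1"
    by (simp add: gauss_measure_def emeasure_density nn_integral_eq_integral gauss_density_nonneg)
qed

interpretation gauss: prob_space "gauss_measure :: 'a::euclidean_space measure"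
  by (rule prob_space_gauss_measure)

text \<open>The norm is at most the dimension times the largest coordinate. This reduces
  integrability of powers of the norm to one-dimensional absolute moments.\<close>

lemma norm_power_le_components:
  fixes x :: "'a::euclidean_space"
  shows "norm x ^ k \<le> real DIM('a) ^ k * (\<Sum>b\<in>Basis. \<bar>x \<bullet> b\<bar> ^ k)"
proof -
  define M where "M = Max ((\<lambda>b. \<bar>x \<bullet> b\<bar>) ` Basis)"
  have "M \<in> (\<lambda>b. \<bar>x \<bullet> b\<bar>) ` Basis" unfolding M_def by (rule Max_in) auto
  then obtain c where c: "c \<in> Basis" "M = \<bar>x \<bullet> c\<bar>" by auto
  have "norm x \<le> (\<Sum>b\<in>Basis. \<bar>x \<bullet> b\<bar>)" by (rule norm_le_l1)
  also have "\<dots> \<le> real DIM('a) * M"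
    using sum_bounded_above[of Basis "\<lambda>b. \<bar>x \<bullet> b\<bar>" M] by (simp add: M_def)
  finally have "norm x ^ k \<le> (real DIM('a) * M) ^ k" by (intro power_mono) auto
  also have "\<dots> = real DIM('a) ^ k * \<bar>x \<bullet> c\<bar> ^ k" by (simp add: c power_mult_distrib)
  also have "\<dots> \<le> real DIM('a) ^ k * (\<Sum>b\<in>Basis. \<bar>x \<bullet> b\<bar> ^ k)"
    by (intro mult_left_mono member_le_sum c) auto
  finally show ?thesis .
qed

lemma gauss_integrable_norm_power: "integrable gauss_measure (\<lambda>x::'a::euclidean_space. norm x ^ k)"
proof (rule Bochner_Integration.integrable_bound)
  have "integrable gauss_measure (\<lambda>x::'a. \<bar>x \<bullet> c\<bar> ^ k)" if c: "c \<in> Basis" for c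
  proof -
    have "integrable gauss_measure (\<lambda>x::'a. \<Prod>b\<in>Basis. (if b = c then \<bar>x \<bullet> b\<bar> ^ k else 1))"
    proof (rule gauss_product_expectation(1))
      show "integrable lborel (\<lambda>x. std_normal_density x * (if b = c then \<bar>x\<bar> ^ k else 1))" for b
        by (cases "b = c") (auto simp: integrable_std_normal_moment_abs)
    qed auto
    then show ?thesis using c by (simp add: prod.delta)
  qed
  then show "integrable gauss_measure (\<lambda>x::'a. real DIM('a) ^ k * (\<Sum>b\<in>Basis. \<bar>x \<bullet> b\<bar> ^ k))"
    by auto
  show "AE x in gauss_measure. norm (norm (x::'a) ^ k) \<le> norm (real DIM('a) ^ k * (\<Sum>b\<in>Basis. \<bar>x \<bullet> b\<bar> ^ k))"
    by (intro AE_I2) (simp add: norm_power_le_components abs_of_nonneg sum_nonneg)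
qed auto

lemma one_plus_power_le: "0 \<le> a \<Longrightarrow> (1 + a) ^ k \<le> 2 ^ k * (1 + a ^ k)" for a :: real
proof -
  assume a: "0 \<le> a"
  have "(1 + a) ^ k \<le> (2 * max 1 a) ^ k" using a by (intro power_mono) auto
  also have "\<dots> = 2 ^ k * max 1 a ^ k" by (simp add: power_mult_distrib)
  also have "max 1 a ^ k \<le> 1 + a ^ k" using a by (auto simp: max_def)
  finally show ?thesis by simp
qed

lemma gauss_integrable_weight: "integrable gauss_measure (\<lambda>x::'a::euclidean_space. (1 + norm x) ^ k)"
  by (rule Bochner_Integration.integrable_bound[of _ "\<lambda>x. 2 ^ k * (1 + norm x ^ k)"])
    (auto simp: gauss_integrable_norm_power one_plus_power_le)

lemma gauss_expectation_uminus:
  fixes F :: "'a::euclidean_space \<Rightarrow> real"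
  assumes [measurable]: "F \<in> borel_measurable borel"
  shows "\<E> (\<lambda>x. F (- x)) = \<E> F"
proof -
  have u: "lborel = density (distr lborel borel (\<lambda>x::'a. - x)) (\<lambda>_. 1)"
    using lborel_affine[of "-1" "0::'a"] by simp
  then have u: "lborel = distr lborel borel (\<lambda>x::'a. - x)" by (simp add: density_1)
  have "\<E> F = (\<integral>x. gauss_density x * F x \<partial>(distr lborel borel (\<lambda>x::'a. - x)))"
    by (subst gauss_expectation_eq, simp, subst u[symmetric], rule refl)
  also have "\<dots> = (\<integral>x. gauss_density (-x) * F (-x) \<partial>lborel)"
    by (subst integral_distr) auto
  also have "\<dots> = \<E> (\<lambda>x. F (- x))"
    by (subst gauss_expectation_eq) (auto simp: gauss_density_eq)
  finally show ?thesis by simp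
qed

lemma gauss_integrable_uminus:
  fixes F :: "'a::euclidean_space \<Rightarrow> real"
  assumes F: "integrable gauss_measure F"
  shows "integrable gauss_measure (\<lambda>x. F (- x))"
proof -
  have m [measurable]: "F \<in> borel_measurable borel" using borel_measurable_integrable[OF F] by simp
  have "lborel = density (distr lborel borel (\<lambda>x::'a. - x)) (\<lambda>_. 1)"
    using lborel_affine[of "-1" "0::'a"] by simp
  then have u: "lborel = distr lborel borel (\<lambda>x::'a. - x)" by (simp add: density_1)
  have "integrable (distr lborel borel (\<lambda>x::'a. - x)) (\<lambda>x. gauss_density x * F x)"
    using F unfolding gauss_integrable_iff[OF m] by (subst u[symmetric])
  then have "integrable lborel (\<lambda>x. gauss_density (-x) * F (-x))"
    by (subst (asm) integrable_distr_eq) auto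
  then show ?thesis by (subst gauss_integrable_iff) (auto simp: gauss_density_eq)
qed

text \<open>The kernel at time s has variance 2s in each coordinate, hence the scale
  \<open>sqrt (2 * s)\<close>. The Jacobian of the affine substitution accounts for the difference
  of the two normalisations.\<close>

lemma convolve_gauss_kernel:
  fixes S :: "'a::euclidean_space set"
  assumes S: "S \<in> sets borel" and s: "0 < s"
  shows "convolve (gauss_kernel s) (indicator S) p = \<E> (\<lambda>\<xi>. indicator S (p - sqrt (2 * s) *\<^sub>R \<xi>))"
proof -
  define c where "c = - sqrt (2 * s)"
  have c: "c \<noteq> 0" "\<bar>c\<bar> = sqrt (2 * s)" using s by (auto simp: c_def)
  note [measurable] = S
  have [measurable]: "gauss_kernel s \<in> borel_measurable (borel :: 'a measure)"
    unfolding gauss_kernel_def[abs_def] by measurable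
  have k: "\<bar>c\<bar> ^ DIM('a) * gauss_kernel s (- (c *\<^sub>R \<xi>)) = gauss_density \<xi>" for \<xi> :: 'a
  proof -
    have "sqrt (2 * s) ^ DIM('a) = (2 * s) powr (real DIM('a) / 2)"
      using s by (simp add: powr_half_sqrt[symmetric] powr_realpow[symmetric] powr_powr)
    moreover have "(4 * pi * s) powr (real DIM('a) / 2) = (2 * s) powr (real DIM('a) / 2) * (2 * pi) powr (real DIM('a) / 2)"
      using s by (subst powr_mult[symmetric]) (auto simp: mult_ac)
    moreover have "(norm (c *\<^sub>R \<xi>))\<^sup>2 = 2 * s * (norm \<xi>)\<^sup>2"
      using s c by (simp add: power_mult_distrib)
    ultimately show ?thesis
      using s c unfolding gauss_kernel_def gauss_density_eq by (simp add: field_simps)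
  qed
  have "convolve (gauss_kernel s) (indicator S) p
    = (\<integral>q. gauss_kernel s (p - q) * indicator S q \<partial>(density (distr lborel borel (\<lambda>x. p + c *\<^sub>R x)) (\<lambda>_. ennreal (\<bar>c\<bar> ^ DIM('a)))))"
    unfolding convolve_def using lborel_affine[OF c(1), of p] by (simp add: ennreal_power)
  also have "\<dots> = (\<integral>\<xi>. \<bar>c\<bar> ^ DIM('a) * (gauss_kernel s (- (c *\<^sub>R \<xi>)) * indicator S (p + c *\<^sub>R \<xi>)) \<partial>lborel)"
    by (subst integral_density, simp, simp, simp, subst integral_distr) auto
  also have "\<dots> = (\<integral>\<xi>. gauss_density \<xi> * indicator S (p + c *\<^sub>R \<xi>) \<partial>lborel)"
    by (simp only: mult.assoc[symmetric] k)
  also have "\<dots> = \<E> (\<lambda>\<xi>. indicator S (p + c *\<^sub>R \<xi>))"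
    by (subst gauss_expectation_eq) auto
  finally show ?thesis by (simp add: c_def)
qed

lemma gauss_measure_prod:
  "(gauss_measure :: ('a::euclidean_space \<times> 'b::euclidean_space) measure) = gauss_measure \<Otimes>\<^sub>M gauss_measure"
proof -
  have d: "gauss_density (x, y) = gauss_density x * gauss_density y" for x :: 'a and y :: 'b
  proof -
    have "exp (- (norm (x, y))\<^sup>2 / 2) = exp (- (norm x)\<^sup>2 / 2) * exp (- (norm y)\<^sup>2 / 2)"
      by (simp add: norm_Pair exp_add[symmetric] add_divide_distrib)
    then show ?thesis
      by (simp add: gauss_density_eq add_divide_distrib powr_add)
  qed
  have "gauss_measure \<Otimes>\<^sub>M gauss_measure = density (lborel \<Otimes>\<^sub>M lborel) (\<lambda>(x::'a,y::'b). ennreal (gauss_density x) * ennreal (gauss_density y))"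
    unfolding gauss_measure_def
    by (rule pair_measure_density)
      (auto simp: gauss_measure_def[symmetric] sigma_finite_lborel gauss.sigma_finite_measure_axioms)
  also have "\<dots> = gauss_measure"
    unfolding gauss_measure_def lborel_prod
    by (intro arg_cong[where f="density lborel"] ext)
      (auto simp: d ennreal_mult gauss_density_nonneg)
  finally show ?thesis by simp
qed

lemma gauss_fubini:
  fixes F :: "'a::euclidean_space \<times> 'b::euclidean_space \<Rightarrow> real"
  assumes "integrable gauss_measure F"
  shows "\<E> F = \<E> (\<lambda>x. \<E> (\<lambda>y. F (x, y)))"
proof -
  interpret pair_sigma_finite "gauss_measure :: 'a measure" "gauss_measure :: 'b measure" ..
  show ?thesis
    using assms integral_fst'[of F] unfolding gauss_measure_prod by simp
qed


section \<open>Gaussian moments and Wick's formula\<close>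

definition normal_moment :: "nat \<Rightarrow> real"
  where "normal_moment k = (\<integral>x. std_normal_density x * x ^ k \<partial>lborel)"

lemma normal_moment_simps [simp]: "normal_moment 0 = 1" "normal_moment (Suc 0) = 0"
  using integral_std_normal_moment_odd[of 0] by (simp_all add: normal_moment_def)

text \<open>The recursion of integration by parts, read off here from the closed forms of even and
  odd moments. At \<open>k = 0\<close> the truncated subtraction is harmless because the factor
  \<open>real k\<close> is 0.\<close>

lemma normal_moment_Suc: "normal_moment (Suc k) = real k * normal_moment (k - 1)"
proof (cases "even k")
  case True
  then obtain m where k: "k = 2 * m" by blast
  have "normal_moment (Suc k) = 0"
    using integral_std_normal_moment_odd[of m] by (simp add: normal_moment_def k)
  moreover have "real k * normal_moment (k - 1) = 0"
  proof (cases m)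
    case (Suc m')
    then have "k - 1 = 2 * m' + 1" by (simp add: k)
    then show ?thesis using integral_std_normal_moment_odd[of m'] by (simp add: normal_moment_def)
  qed (simp add: k)
  ultimately show ?thesis by simp
next
  case False
  then obtain m where k: "k = 2 * m + 1" by (rule oddE)
  have e: "normal_moment (2 * j) = fact (2 * j) / (2 ^ j * fact j)" for j
    by (simp only: normal_moment_def integral_std_normal_moment_even)
  have "normal_moment (Suc k) = fact (2 * Suc m) / (2 ^ Suc m * fact (Suc m))"
    using e[of "Suc m"] by (simp add: k)
  also have "fact (2 * Suc m) = real (2 * Suc m) * (real k * fact (2 * m))"
    by (simp add: k)
  also have "real (2 * Suc m) * (real k * fact (2 * m)) / (2 ^ Suc m * fact (Suc m)) = real k * (fact (2 * m) / (2 ^ m * fact m))"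
  proof -
    have "(2::real) ^ Suc m * fact (Suc m) = real (2 * Suc m) * (2 ^ m * fact m)" by simp
    moreover have "real (2 * Suc m) \<noteq> 0" by simp
    ultimately show ?thesis
      using mult_divide_mult_cancel_left[of "real (2 * Suc m)" "real k * fact (2 * m)" "2 ^ m * fact m"]
      by (metis times_divide_eq_right)
  qed
  finally show ?thesis using e[of m] by (simp add: k)
qed

definition coord_monomial :: "'n list \<Rightarrow> real^'n::finite \<Rightarrow> real"
  where "coord_monomial js x = (\<Prod>j\<leftarrow>js. x $ j)"

lemma coord_monomial_eq: "coord_monomial js x = (\<Prod>i\<in>UNIV. (x $ i) ^ count_list js i)"
proof (induction js)
  case (Cons j js)
  have "(\<Prod>i\<in>UNIV. (x $ i) ^ count_list (j # js) i) = (\<Prod>i\<in>UNIV. (if i = j then x $ i else 1) * (x $ i) ^ count_list js i)"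
    by (intro prod.cong) auto
  also have "\<dots> = x $ j * (\<Prod>i\<in>UNIV. (x $ i) ^ count_list js i)"
    by (simp add: prod.distrib prod.delta)
  finally show ?case using Cons by (simp add: coord_monomial_def)
qed (simp add: coord_monomial_def)

lemma gauss_monomial:
  fixes js :: "'n::finite list"
  shows "integrable gauss_measure (coord_monomial js)"
    and "\<E> (coord_monomial js) = (\<Prod>i\<in>UNIV. normal_moment (count_list js i))"
proof -
  define idx where "idx = (\<lambda>b :: real^'n. THE i. b = axis i 1)"
  have idx: "idx (axis i 1) = i" for i by (simp add: idx_def axis_eq_axis)
  have B: "(Basis :: (real^'n) set) = (\<lambda>i. axis i 1) ` UNIV" by (auto simp: Basis_vec_def)
  have inj: "inj (\<lambda>i::'n. axis i (1::real))" by (simp add: inj_on_def axis_eq_axis)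
  have e: "coord_monomial js = (\<lambda>x. \<Prod>b\<in>Basis. (x \<bullet> b) ^ count_list js (idx b))"
    by (simp add: fun_eq_iff coord_monomial_eq B prod.reindex[OF inj] idx inner_axis)
  note g = gauss_product_expectation[where f = "\<lambda>b x. x ^ count_list js (idx b)"]
  show "integrable gauss_measure (coord_monomial js)"
    unfolding e by (rule g(1)) (auto simp: integrable_std_normal_moment)
  have "\<E> (coord_monomial js) = (\<Prod>b\<in>(Basis::(real^'n) set). normal_moment (count_list js (idx b)))"
    unfolding e normal_moment_def by (rule g(2)) (auto simp: integrable_std_normal_moment)
  then show "\<E> (coord_monomial js) = (\<Prod>i\<in>UNIV. normal_moment (count_list js i))"
    by (simp add: B prod.reindex[OF inj] idx)
qed

lemma count_list_remove_nth:
  assumes "k < length js"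
  shows "count_list js i = count_list (take k js @ drop (Suc k) js) i + (if js ! k = i then 1 else 0)"
proof -
  have "js = take k js @ js ! k # drop (Suc k) js" using assms by (rule id_take_nth_drop)
  then have "count_list js i = count_list (take k js @ js ! k # drop (Suc k) js) i" by metis
  then show ?thesis by simp
qed

text \<open>Only the coordinate \<open>i\<close> is affected. If it occurs c times in
  \<open>js\<close>, the left side contains its moment of order c + 1, and each of the c deletions
  on the right contains its moment of order c - 1; so this is the one-dimensional recursion times a
  common factor.\<close>

theorem gauss_wick:
  fixes i :: "'n::finite"
  shows "\<E> (coord_monomial (i # js)) =
    (\<Sum>k<length js. if js ! k = i then \<E> (coord_monomial (take k js @ drop (Suc k) js)) else 0)"
proof -
  define c where "c = count_list js i"
  define R where "R = (\<Prod>j\<in>UNIV - {i}. normal_moment (count_list js j))"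
  have split: "(\<Prod>j\<in>UNIV. normal_moment (m j)) = normal_moment (m i) * (\<Prod>j\<in>UNIV - {i}. normal_moment (m j))" for m :: "'n \<Rightarrow> nat"
    by (rule prod.remove) auto
  have "\<E> (coord_monomial (i # js)) = normal_moment (Suc c) * R"
    unfolding gauss_monomial(2) split R_def c_def by (intro arg_cong2[where f="(*)"] prod.cong) auto
  moreover have "\<E> (coord_monomial (take k js @ drop (Suc k) js)) = normal_moment (c - 1) * R"
    if "k < length js" "js ! k = i" for k
    unfolding gauss_monomial(2) split R_def c_def
    using count_list_remove_nth[OF that(1)] that(2)
    by (intro arg_cong2[where f="(*)"] prod.cong) auto
  then have "(\<Sum>k<length js. if js ! k = i then \<E> (coord_monomial (take k js @ drop (Suc k) js)) else 0)
    = (\<Sum>k<length js. if js ! k = i then normal_moment (c - 1) * R else 0)"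
    by (intro sum.cong) auto
  moreover have "\<dots> = real (card {k. k < length js \<and> js ! k = i}) * (normal_moment (c - 1) * R)"
    by (simp add: sum.If_cases lessThan_def Collect_conj_eq[symmetric])
  moreover have "card {k. k < length js \<and> js ! k = i} = c"
    unfolding c_def count_list_eq_length_filter length_filter_conv_card
    by (intro arg_cong[where f=card]) auto
  ultimately show ?thesis by (simp add: normal_moment_Suc)
qed

definition kron :: "'n \<Rightarrow> 'n \<Rightarrow> real" where "kron i j = (if i = j then 1 else 0)"

lemma sum_kron [simp]:
  fixes i :: "'n::finite"
  shows "(\<Sum>j\<in>UNIV. kron i j * F j) = F i" "(\<Sum>j\<in>UNIV. kron j i * F j) = F i"
    "(\<Sum>j\<in>UNIV. F j * kron i j) = F i" "(\<Sum>j\<in>UNIV. F j * kron j i) = F i"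
proof -
  have "kron i j * F j = (if i = j then F j else 0)" "kron j i * F j = (if j = i then F j else 0)"
    "F j * kron i j = (if i = j then F j else 0)" "F j * kron j i = (if j = i then F j else 0)" for j
    by (auto simp: kron_def)
  then show "(\<Sum>j\<in>UNIV. kron i j * F j) = F i" "(\<Sum>j\<in>UNIV. kron j i * F j) = F i"
    "(\<Sum>j\<in>UNIV. F j * kron i j) = F i" "(\<Sum>j\<in>UNIV. F j * kron j i) = F i"
    by simp_all
qed

lemma gauss_moment2:
  fixes i j :: "'n::finite"
  shows "\<E> (\<lambda>x::real^'n. x $ i * x $ j) = kron i j"
    and "integrable gauss_measure (\<lambda>x::real^'n. x $ i * x $ j)"
proof -
  have e: "(\<lambda>x::real^'n. x $ i * x $ j) = coord_monomial [i, j]" by (simp add: coord_monomial_def fun_eq_iff)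
  show "\<E> (\<lambda>x::real^'n. x $ i * x $ j) = kron i j"
    unfolding e gauss_wick by (simp add: gauss_monomial(2) kron_def)
  show "integrable gauss_measure (\<lambda>x::real^'n. x $ i * x $ j)" unfolding e by (rule gauss_monomial)
qed

text \<open>The sum over the three pairings of four indices.\<close>

definition wick4 :: "'n \<Rightarrow> 'n \<Rightarrow> 'n \<Rightarrow> 'n \<Rightarrow> real"
  where "wick4 i j k l = kron i j * kron k l + kron i k * kron j l + kron i l * kron j k"

lemma gauss_moment4:
  fixes i j k l :: "'n::finite"
  shows "\<E> (\<lambda>x::real^'n. x $ i * x $ j * x $ k * x $ l) = wick4 i j k l"
    and "integrable gauss_measure (\<lambda>x::real^'n. x $ i * x $ j * x $ k * x $ l)"
proof -
  have e: "(\<lambda>x::real^'n. x $ i * x $ j * x $ k * x $ l) = coord_monomial [i, j, k, l]"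
    by (simp add: coord_monomial_def fun_eq_iff mult_ac)
  have e2: "coord_monomial [a, b] = (\<lambda>x. x $ a * x $ b)" for a b :: 'n
    by (simp add: coord_monomial_def fun_eq_iff)
  show "\<E> (\<lambda>x::real^'n. x $ i * x $ j * x $ k * x $ l) = wick4 i j k l"
    unfolding e gauss_wick
    by (simp add: eval_nat_numeral e2 gauss_moment2 wick4_def) (simp add: kron_def)
  show "integrable gauss_measure (\<lambda>x::real^'n. x $ i * x $ j * x $ k * x $ l)" unfolding e by (rule gauss_monomial)
qed

text \<open>The fifteen pairings of six indices, grouped by the partner of \<open>i\<close>.\<close>

lemma gauss_moment6:
  fixes i j k l p q :: "'n::finite"
  shows "\<E> (\<lambda>x::real^'n. x $ i * x $ j * x $ k * x $ l * x $ p * x $ q)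
      = kron i j * wick4 k l p q + kron i k * wick4 j l p q + kron i l * wick4 j k p q
        + kron i p * wick4 j k l q + kron i q * wick4 j k l p"
    and "integrable gauss_measure (\<lambda>x::real^'n. x $ i * x $ j * x $ k * x $ l * x $ p * x $ q)"
proof -
  have e: "(\<lambda>x::real^'n. x $ i * x $ j * x $ k * x $ l * x $ p * x $ q) = coord_monomial [i, j, k, l, p, q]"
    by (simp add: coord_monomial_def fun_eq_iff mult_ac)
  have e4: "coord_monomial [a, b, c, d] = (\<lambda>x. x $ a * x $ b * x $ c * x $ d)" for a b c d :: 'n
    by (simp add: coord_monomial_def fun_eq_iff mult_ac)
  show "\<E> (\<lambda>x::real^'n. x $ i * x $ j * x $ k * x $ l * x $ p * x $ q)
      = kron i j * wick4 k l p q + kron i k * wick4 j l p q + kron i l * wick4 j k p q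
        + kron i p * wick4 j k l q + kron i q * wick4 j k l p"
    unfolding e gauss_wick
    by (simp add: eval_nat_numeral e4 gauss_moment4 kron_def)
  show "integrable gauss_measure (\<lambda>x::real^'n. x $ i * x $ j * x $ k * x $ l * x $ p * x $ q)" unfolding e by (rule gauss_monomial)
qed

definition tr :: "('n::finite \<Rightarrow> 'n \<Rightarrow> real) \<Rightarrow> real"
  where "tr A = (\<Sum>i\<in>UNIV. A i i)"

definition mmul :: "('n::finite \<Rightarrow> 'n \<Rightarrow> real) \<Rightarrow> ('n \<Rightarrow> 'n \<Rightarrow> real) \<Rightarrow> 'n \<Rightarrow> 'n \<Rightarrow> real"
  where "mmul A B i j = (\<Sum>k\<in>UNIV. A i k * B k j)"

lemma gauss_quad:
  fixes A :: "'n::finite \<Rightarrow> 'n \<Rightarrow> real"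
  shows "integrable gauss_measure (quad A)" and "\<E> (quad A) = tr A"
proof -
  have i: "integrable gauss_measure (\<lambda>x::real^'n. A i j * x $ i * x $ j)" for i j
    using gauss_moment2(2)[of i j] by (simp add: mult.assoc)
  show "integrable gauss_measure (quad A)"
    unfolding quad_def[abs_def] by (intro Bochner_Integration.integrable_sum i)
  have "\<E> (quad A) = (\<Sum>i\<in>UNIV. \<Sum>j\<in>UNIV. \<E> (\<lambda>x::real^'n. A i j * x $ i * x $ j))"
    unfolding quad_def[abs_def] by (simp add: Bochner_Integration.integral_sum Bochner_Integration.integrable_sum i)
  also have "\<dots> = tr A" by (simp add: mult.assoc gauss_moment2 tr_def)
  finally show "\<E> (quad A) = tr A" .
qed

lemma gauss_quart:
  fixes K :: "'n::finite \<Rightarrow> 'n \<Rightarrow> 'n \<Rightarrow> 'n \<Rightarrow> real"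
  shows "integrable gauss_measure (quart K)"
    and "\<E> (quart K) = (\<Sum>i\<in>UNIV. \<Sum>j\<in>UNIV. K i i j j + K i j i j + K i j j i)"
proof -
  have e: "K i j k l * x $ i * x $ j * x $ k * x $ l = K i j k l * (x $ i * x $ j * x $ k * x $ l)" for i j k l and x :: "real^'n"
    by (simp add: mult_ac)
  have i: "integrable gauss_measure (\<lambda>x::real^'n. K i j k l * x $ i * x $ j * x $ k * x $ l)" for i j k l
    using gauss_moment4(2)[of i j k l] unfolding e by simp
  show "integrable gauss_measure (quart K)"
    unfolding quart_def[abs_def] by (intro Bochner_Integration.integrable_sum i)
  have "\<E> (quart K) = (\<Sum>i\<in>UNIV. \<Sum>j\<in>UNIV. \<Sum>k\<in>UNIV. \<Sum>l\<in>UNIV. K i j k l * wick4 i j k l)"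
    unfolding quart_def[abs_def]
    by (simp add: Bochner_Integration.integral_sum Bochner_Integration.integrable_sum i) (simp add: e gauss_moment4)
  also have "\<dots> = (\<Sum>i\<in>UNIV. \<Sum>j\<in>UNIV. \<Sum>k\<in>UNIV. \<Sum>l\<in>UNIV. kron i j * (kron k l * K i j k l))
      + (\<Sum>i\<in>UNIV. \<Sum>j\<in>UNIV. \<Sum>k\<in>UNIV. \<Sum>l\<in>UNIV. kron i k * (kron j l * K i j k l))
      + (\<Sum>i\<in>UNIV. \<Sum>j\<in>UNIV. \<Sum>k\<in>UNIV. \<Sum>l\<in>UNIV. kron i l * (kron j k * K i j k l))"
    by (simp add: wick4_def algebra_simps sum.distrib)
  also have "\<dots> = (\<Sum>i\<in>UNIV. \<Sum>j\<in>UNIV. K i i j j) + (\<Sum>i\<in>UNIV. \<Sum>j\<in>UNIV. K i j i j) + (\<Sum>i\<in>UNIV. \<Sum>j\<in>UNIV. K i j j i)"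
    by (simp add: sum_distrib_left[symmetric])
  finally show "\<E> (quart K) = (\<Sum>i\<in>UNIV. \<Sum>j\<in>UNIV. K i i j j + K i j i j + K i j j i)"
    by (simp add: sum.distrib)
qed

lemma quad_mult: "quad A x * quad B x = quart (\<lambda>i j k l. A i j * B k l) x"
  unfolding quart_def
  by (simp only: quad_def sum_distrib_right) (simp only: sum_distrib_left mult_ac)

lemma gauss_quad_quad:
  fixes A B :: "'n::finite \<Rightarrow> 'n \<Rightarrow> real"
  assumes "\<And>i j. B i j = B j i"
  shows "integrable gauss_measure (\<lambda>x. quad A x * quad B x)"
    and "\<E> (\<lambda>x. quad A x * quad B x) = tr A * tr B + 2 * tr (mmul A B)"
proof -
  show "integrable gauss_measure (\<lambda>x. quad A x * quad B x)"
    unfolding quad_mult by (rule gauss_quart)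
  have "\<E> (\<lambda>x. quad A x * quad B x) = (\<Sum>i\<in>UNIV. \<Sum>j\<in>UNIV. A i i * B j j + A i j * B i j + A i j * B j i)"
    unfolding quad_mult by (rule gauss_quart)
  also have "\<dots> = (\<Sum>i\<in>UNIV. \<Sum>j\<in>UNIV. A i i * B j j + 2 * (A i j * B j i))"
    using assms by (intro sum.cong refl) simp
  also have "\<dots> = tr A * tr B + 2 * tr (mmul A B)"
  proof -
    have "tr A * tr B = (\<Sum>i\<in>UNIV. \<Sum>j\<in>UNIV. A i i * B j j)" by (simp only: tr_def sum_product)
    then show ?thesis by (simp add: sum.distrib tr_def mmul_def sum_distrib_left[symmetric])
  qed
  finally show "\<E> (\<lambda>x. quad A x * quad B x) = tr A * tr B + 2 * tr (mmul A B)" .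
qed

text \<open>Pairing \<open>i\<close> with \<open>j\<close> closes the first factor to a trace and
  leaves the mean of a square. Each of the other four partners of \<open>i\<close> links the first
  factor to another one, which merges the two into the matrix square of H; by symmetry of H these
  four sums coincide.\<close>

lemma gauss_quad_cubed:
  fixes H :: "'n::finite \<Rightarrow> 'n \<Rightarrow> real"
  assumes H: "\<And>i j. H i j = H j i"
  shows "integrable gauss_measure (\<lambda>x. quad H x ^ 3)"
    and "\<E> (\<lambda>x. quad H x ^ 3) = tr H ^ 3 + 6 * tr H * tr (mmul H H) + 8 * tr (mmul (mmul H H) H)"
proof -
  have e: "quad H x ^ 3 = (\<Sum>i\<in>UNIV. \<Sum>j\<in>UNIV. \<Sum>k\<in>UNIV. \<Sum>l\<in>UNIV. \<Sum>p\<in>UNIV. \<Sum>q\<in>UNIV.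
      (H i j * H k l * H p q) * (x $ i * x $ j * x $ k * x $ l * x $ p * x $ q))" for x
    by (simp only: quad_def power3_eq_cube mult.assoc sum_distrib_right) (simp only: sum_distrib_left mult_ac)
  have i: "integrable gauss_measure (\<lambda>x::real^'n. (H i j * H k l * H p q) * (x $ i * x $ j * x $ k * x $ l * x $ p * x $ q))" for i j k l p q
    using gauss_moment6(2)[of i j k l p q] by simp
  show "integrable gauss_measure (\<lambda>x. quad H x ^ 3)"
    unfolding e by (intro Bochner_Integration.integrable_sum i)
  define M where "M = (\<lambda>A B :: 'n \<Rightarrow> 'n \<Rightarrow> real. \<Sum>i\<in>UNIV. \<Sum>j\<in>UNIV. \<Sum>k\<in>UNIV. \<Sum>l\<in>UNIV. A i j * B k l * wick4 i j k l)"
  have M: "M A B = tr A * tr B + 2 * tr (mmul A B)" if "\<And>i j. B i j = B j i" for A B :: "'n \<Rightarrow> 'n \<Rightarrow> real"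
  proof -
    have "M A B = \<E> (\<lambda>x. quad A x * quad B x)"
      unfolding M_def quad_mult quart_def
      by (simp add: mult.assoc Bochner_Integration.integral_sum Bochner_Integration.integrable_sum gauss_moment4[unfolded mult.assoc])
    then show ?thesis using gauss_quad_quad(2)[of B A] that by simp
  qed
  have w: "wick4 j k l q = wick4 j q k l" for j k l q :: 'n
    by (auto simp: wick4_def kron_def)
  have rot: "(\<Sum>k\<in>UNIV. \<Sum>l\<in>UNIV. \<Sum>q\<in>UNIV. F k l q) = (\<Sum>q\<in>UNIV. \<Sum>k\<in>UNIV. \<Sum>l\<in>UNIV. F k l q)" for F :: "'n \<Rightarrow> 'n \<Rightarrow> 'n \<Rightarrow> real"
    by (subst sum.swap[of "\<lambda>k q. \<Sum>l\<in>UNIV. F k l q", symmetric]) (intro sum.cong refl sum.swap)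
  \<comment> \<open>Summing over the shared index \<open>i\<close> turns the first two factors into
    an entry of \<open>mmul H H\<close>, so this is the mean of the product of the quadratic forms
    of \<open>mmul H H\<close> and \<open>H\<close>.\<close>
  define Y where "Y = (\<Sum>i\<in>UNIV. \<Sum>j\<in>UNIV. \<Sum>k\<in>UNIV. \<Sum>p\<in>UNIV. \<Sum>q\<in>UNIV. H i j * H i k * H p q * wick4 j k p q)"
  have Y: "Y = M (mmul H H) H"
  proof -
    have "Y = (\<Sum>j\<in>UNIV. \<Sum>k\<in>UNIV. \<Sum>i\<in>UNIV. \<Sum>p\<in>UNIV. \<Sum>q\<in>UNIV. H i j * H i k * H p q * wick4 j k p q)"
      unfolding Y_def using rot[of "\<lambda>j k i. \<Sum>p\<in>UNIV. \<Sum>q\<in>UNIV. H i j * H i k * H p q * wick4 j k p q"] by simp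
    also have "\<dots> = (\<Sum>j\<in>UNIV. \<Sum>k\<in>UNIV. \<Sum>p\<in>UNIV. \<Sum>q\<in>UNIV. \<Sum>i\<in>UNIV. H i j * H i k * H p q * wick4 j k p q)"
      by (intro sum.cong refl rot[symmetric])
    also have "\<dots> = M (mmul H H) H"
      unfolding M_def mmul_def sum_distrib_right by (intro sum.cong refl) (simp add: H)
    finally show ?thesis .
  qed
  define L where "L = (\<lambda>c. \<Sum>i\<in>UNIV. \<Sum>j\<in>UNIV. \<Sum>k\<in>UNIV. \<Sum>l\<in>UNIV. \<Sum>p\<in>UNIV. \<Sum>q\<in>UNIV. H i j * H k l * H p q * c i j k l p q)"
  have L: "L (\<lambda>i j k l p q. kron i j * wick4 k l p q) = tr H * M H H"
  proof -
    have "L (\<lambda>i j k l p q. kron i j * wick4 k l p q)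
      = (\<Sum>i\<in>UNIV. \<Sum>j\<in>UNIV. kron i j * (H i j * (\<Sum>k\<in>UNIV. \<Sum>l\<in>UNIV. \<Sum>p\<in>UNIV. \<Sum>q\<in>UNIV. H k l * H p q * wick4 k l p q)))"
      unfolding L_def sum_distrib_left by (intro sum.cong refl) (simp add: mult_ac)
    also have "\<dots> = tr H * M H H" by (simp add: tr_def sum_distrib_right M_def)
    finally show ?thesis .
  qed
  have "L (\<lambda>i j k l p q. kron i k * wick4 j l p q)
    = (\<Sum>i\<in>UNIV. \<Sum>j\<in>UNIV. \<Sum>k\<in>UNIV. kron i k * (\<Sum>l\<in>UNIV. \<Sum>p\<in>UNIV. \<Sum>q\<in>UNIV. H i j * H k l * H p q * wick4 j l p q))"
    unfolding L_def sum_distrib_left by (intro sum.cong refl) (simp add: mult_ac)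
  then have L2: "L (\<lambda>i j k l p q. kron i k * wick4 j l p q) = Y" by (simp add: Y_def)
  have "L (\<lambda>i j k l p q. kron i l * wick4 j k p q)
    = (\<Sum>i\<in>UNIV. \<Sum>j\<in>UNIV. \<Sum>k\<in>UNIV. \<Sum>l\<in>UNIV. kron i l * (\<Sum>p\<in>UNIV. \<Sum>q\<in>UNIV. H i j * H k l * H p q * wick4 j k p q))"
    unfolding L_def sum_distrib_left by (intro sum.cong refl) (simp add: mult_ac)
  also have "\<dots> = Y" unfolding sum_kron Y_def by (intro sum.cong refl) (simp add: H)
  finally have L3: "L (\<lambda>i j k l p q. kron i l * wick4 j k p q) = Y" .
  have "L (\<lambda>i j k l p q. kron i p * wick4 j k l q)
    = (\<Sum>i\<in>UNIV. \<Sum>j\<in>UNIV. \<Sum>k\<in>UNIV. \<Sum>l\<in>UNIV. \<Sum>p\<in>UNIV. kron i p * (\<Sum>q\<in>UNIV. H i j * H k l * H p q * wick4 j k l q))"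
    unfolding L_def sum_distrib_left by (intro sum.cong refl) (simp add: mult_ac)
  also have "\<dots> = Y" unfolding sum_kron Y_def
    by (rule sum.cong[OF refl], rule sum.cong[OF refl], rule trans[OF rot], intro sum.cong refl) (simp add: w mult_ac)
  finally have L4: "L (\<lambda>i j k l p q. kron i p * wick4 j k l q) = Y" .
  have "L (\<lambda>i j k l p q. kron i q * wick4 j k l p)
    = (\<Sum>i\<in>UNIV. \<Sum>j\<in>UNIV. \<Sum>k\<in>UNIV. \<Sum>l\<in>UNIV. \<Sum>p\<in>UNIV. \<Sum>q\<in>UNIV. kron i q * (H i j * H k l * H p q * wick4 j k l p))"
    unfolding L_def by (intro sum.cong refl) (simp add: mult_ac)
  also have "\<dots> = Y" unfolding sum_kron Y_def
    by (rule sum.cong[OF refl], rule sum.cong[OF refl], rule trans[OF rot], intro sum.cong refl) (metis H w mult.assoc mult.commute)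
  finally have L5: "L (\<lambda>i j k l p q. kron i q * wick4 j k l p) = Y" .
  have hb: "has_bochner_integral gauss_measure (\<lambda>x::real^'n. (H i j * H k l * H p q) * (x $ i * x $ j * x $ k * x $ l * x $ p * x $ q))
      (H i j * H k l * H p q * (kron i j * wick4 k l p q + kron i k * wick4 j l p q + kron i l * wick4 j k p q
        + kron i p * wick4 j k l q + kron i q * wick4 j k l p))" for i j k l p q
    using gauss_moment6[of i j k l p q] by (intro has_bochner_integral_mult_right) (simp add: has_bochner_integral_iff)
  have "\<E> (\<lambda>x. quad H x ^ 3) = L (\<lambda>i j k l p q. kron i j * wick4 k l p q + kron i k * wick4 j l p q + kron i l * wick4 j k p q
        + kron i p * wick4 j k l q + kron i q * wick4 j k l p)"
    unfolding e L_def
    by (intro has_bochner_integral_integral_eq has_bochner_integral_sum hb)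
  also have "\<dots> = tr H * M H H + 4 * Y"
    unfolding L[symmetric] using L2 L3 L4 L5
    unfolding L_def by (simp add: distrib_left sum.distrib)
  also have "\<dots> = tr H ^ 3 + 6 * tr H * tr (mmul H H) + 8 * tr (mmul (mmul H H) H)"
  proof -
    have "tr (mmul H H) = tr (\<lambda>i j. mmul H H i j)" by simp
    then show ?thesis unfolding Y M[OF H] by (simp add: algebra_simps power3_eq_cube)
  qed
  finally show "\<E> (\<lambda>x. quad H x ^ 3) = tr H ^ 3 + 6 * tr H * tr (mmul H H) + 8 * tr (mmul (mmul H H) H)" .
qed

section \<open>The Gaussian primitive and level heights\<close>

text \<open>The usual factor 1/sqrt(2 pi) is left out so that the slope at 0 is 1.\<close>

definition gprim :: "real \<Rightarrow> real"
  where "gprim a = (LBINT x=0..a. exp (- x\<^sup>2 / 2))"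

lemma gprim_0 [simp]: "gprim 0 = 0"
  by (simp add: gprim_def zero_ereal_def)

lemma gprim_deriv: "(gprim has_real_derivative exp (- a\<^sup>2 / 2)) (at a)"
proof -
  define l where "l = - \<bar>a\<bar> - 1"
  define u where "u = \<bar>a\<bar> + 1"
  have "((\<lambda>v. LBINT x=0..v. exp (- x\<^sup>2 / 2)) has_vector_derivative exp (- a\<^sup>2 / 2)) (at a within {l..u})"
    unfolding zero_ereal_def
    by (rule interval_integral_FTC2) (auto simp: l_def u_def intro!: continuous_intros)
  then have "(gprim has_real_derivative exp (- a\<^sup>2 / 2)) (at a within {l..u})"
    by (simp add: gprim_def[abs_def] has_real_derivative_iff_has_vector_derivative)
  moreover have "at a within {l..u} = at a"
    by (rule at_within_interior) (auto simp: l_def u_def)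
  ultimately show ?thesis by simp
qed

lemma gprim_continuous: "continuous_on A gprim"
  using DERIV_isCont[OF gprim_deriv] by (simp add: continuous_at_imp_continuous_on)

lemma gprim_measurable [measurable]: "gprim \<in> borel_measurable borel"
  by (intro borel_measurable_continuous_onI gprim_continuous)

lemma gprim_mvt:
  assumes "b < a"
  obtains x where "b < x" "x < a" "gprim a - gprim b = (a - b) * exp (- x\<^sup>2 / 2)"
  using MVT2[OF assms, of gprim "\<lambda>x. exp (- x\<^sup>2 / 2)"] gprim_deriv by blast

lemma gprim_strict_mono: "b < a \<Longrightarrow> gprim b < gprim a"
proof -
  assume "b < a"
  then obtain x where "gprim a - gprim b = (a - b) * exp (- x\<^sup>2 / 2)" by (rule gprim_mvt)
  moreover have "0 < (a - b) * exp (- x\<^sup>2 / 2)" using \<open>b < a\<close> by simp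
  ultimately show "gprim b < gprim a" by linarith
qed

lemma gprim_mono: "b \<le> a \<Longrightarrow> gprim b \<le> gprim a"
  using gprim_strict_mono[of b a] by (cases "a = b") auto

lemma gprim_diff_le: "b \<le> a \<Longrightarrow> gprim a - gprim b \<le> a - b"
proof (cases "b = a")
  case False
  assume "b \<le> a"
  with False have "b < a" by simp
  then obtain x where x: "gprim a - gprim b = (a - b) * exp (- x\<^sup>2 / 2)" by (rule gprim_mvt)
  also have "\<dots> \<le> (a - b) * 1" using \<open>b < a\<close> by (intro mult_left_mono) auto
  finally show ?thesis by simp
qed simp

text \<open>The derivative on the interval is bounded below by exp y >= 1 + y. This quantitative
  monotonicity later gives the slope of the step function.\<close>

lemma gprim_diff_ge:
  assumes "b \<le> a" "\<bar>a\<bar> \<le> M" "\<bar>b\<bar> \<le> M"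
  shows "(a - b) * (1 - M\<^sup>2 / 2) \<le> gprim a - gprim b"
proof (cases "b = a")
  case False
  with assms have "b < a" by simp
  then obtain x where x: "b < x" "x < a" "gprim a - gprim b = (a - b) * exp (- x\<^sup>2 / 2)" by (rule gprim_mvt)
  have "\<bar>x\<bar> \<le> M" using x assms by auto
  then have "x\<^sup>2 \<le> M\<^sup>2" by (simp add: abs_le_square_iff[symmetric])
  then have "1 - M\<^sup>2 / 2 \<le> 1 + (- x\<^sup>2 / 2)" by simp
  also have "\<dots> \<le> exp (- x\<^sup>2 / 2)" by (rule exp_ge_add_one_self)
  finally show ?thesis using x(3) \<open>b < a\<close> by (simp add: mult_left_mono)
qed simp

lemma gprim_lipschitz: "\<bar>gprim a - gprim b\<bar> \<le> \<bar>a - b\<bar>"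
  using gprim_diff_le[of b a] gprim_diff_le[of a b] gprim_mono[of a b] gprim_mono[of b a] by linarith

lemma gprim_minus: "gprim (- a) = - gprim a"
proof -
  have "((\<lambda>x. gprim (- x) + gprim x) has_real_derivative 0) (at x)" for x
    by (rule derivative_eq_intros DERIV_chain2[OF gprim_deriv] gprim_deriv refl | simp)+
  from DERIV_isconst_all[of "\<lambda>x. gprim (- x) + gprim x" a 0] this show ?thesis by simp
qed

lemma gprim_pos: "0 < a \<Longrightarrow> 0 < gprim a"
  using gprim_strict_mono[of 0 a] by simp

lemma mvt_bound:
  fixes G G' :: "real \<Rightarrow> real"
  assumes "G 0 = 0" "\<And>x. (G has_real_derivative G' x) (at x)" "\<And>x. \<bar>x\<bar> \<le> \<bar>a\<bar> \<Longrightarrow> \<bar>G' x\<bar> \<le> B"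
  shows "\<bar>G a\<bar> \<le> B * \<bar>a\<bar>"
proof -
  have "norm (G a - G 0) \<le> B * norm (a - 0)"
    by (rule field_differentiable_bound[of "{- \<bar>a\<bar>..\<bar>a\<bar>}" G G'])
      (use assms in \<open>auto intro: has_field_derivative_at_within\<close>)
  then show ?thesis using assms(1) by simp
qed

lemma gprim_linear_approx: "\<bar>gprim a - a\<bar> \<le> \<bar>a\<bar> ^ 3"
proof -
  have "\<bar>gprim a - a\<bar> \<le> \<bar>a\<bar>\<^sup>2 * \<bar>a\<bar>"
  proof (rule mvt_bound[where G="\<lambda>a. gprim a - a" and G'="\<lambda>x. exp (- x\<^sup>2 / 2) - 1"])
    show "((\<lambda>a. gprim a - a) has_real_derivative exp (- x\<^sup>2 / 2) - 1) (at x)" for x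
      by (intro DERIV_diff gprim_deriv DERIV_ident)
    fix x :: real assume "\<bar>x\<bar> \<le> \<bar>a\<bar>"
    then have "x\<^sup>2 \<le> \<bar>a\<bar>\<^sup>2" by (simp add: abs_le_square_iff[symmetric])
    moreover have "1 + (- x\<^sup>2 / 2) \<le> exp (- x\<^sup>2 / 2)" by (rule exp_ge_add_one_self)
    moreover have "exp (- x\<^sup>2 / 2) \<le> 1" by simp
    moreover have "0 \<le> x\<^sup>2" by simp
    ultimately show "\<bar>exp (- x\<^sup>2 / 2) - 1\<bar> \<le> \<bar>a\<bar>\<^sup>2" by linarith
  qed simp
  then show ?thesis by (simp add: eval_nat_numeral mult_ac)
qed

text \<open>Applying exp y >= 1 + y to y and to -y places exp(-y) between 1 - y and 1/(1 + y) <= 1 -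
  y + y^2. With y = x^2/2 this bounds the derivative of the error.\<close>

lemma gprim_cubic_approx: "\<bar>gprim a - (a - a ^ 3 / 6)\<bar> \<le> \<bar>a\<bar> ^ 5"
proof -
  have "\<bar>gprim a - (a - a ^ 3 / 6)\<bar> \<le> \<bar>a\<bar> ^ 4 * \<bar>a\<bar>"
  proof (rule mvt_bound[where G="\<lambda>a. gprim a - (a - a ^ 3 / 6)" and G'="\<lambda>x. exp (- x\<^sup>2 / 2) - (1 - x\<^sup>2 / 2)"])
    show "((\<lambda>a. gprim a - (a - a ^ 3 / 6)) has_real_derivative exp (- x\<^sup>2 / 2) - (1 - x\<^sup>2 / 2)) (at x)" for x
    proof (intro DERIV_diff[OF gprim_deriv])
      show "((\<lambda>a. a - a ^ 3 / 6) has_real_derivative 1 - x\<^sup>2 / 2) (at x)"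
        by (rule derivative_eq_intros refl | simp)+
    qed
    fix x :: real assume x: "\<bar>x\<bar> \<le> \<bar>a\<bar>"
    have "1 + (- x\<^sup>2 / 2) \<le> exp (- x\<^sup>2 / 2)" by (rule exp_ge_add_one_self)
    moreover have "exp (- x\<^sup>2 / 2) \<le> 1 - x\<^sup>2 / 2 + (x\<^sup>2 / 2)\<^sup>2"
    proof -
      define y where "y = x\<^sup>2 / 2"
      have y: "0 \<le> y" by (simp add: y_def)
      have "exp (- y) \<le> 1 / (1 + y)"
        using exp_ge_add_one_self[of y] y by (simp add: exp_minus inverse_eq_divide frac_le)
      also have "\<dots> \<le> 1 - y + y\<^sup>2"
      proof -
        have "1 \<le> (1 - y + y\<^sup>2) * (1 + y)" using y by (simp add: algebra_simps power2_eq_square)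
        then show ?thesis using y by (simp add: divide_le_eq)
      qed
      finally show ?thesis by (simp add: y_def)
    qed
    moreover have "(x\<^sup>2 / 2)\<^sup>2 \<le> \<bar>a\<bar> ^ 4"
    proof -
      have "(x\<^sup>2 / 2)\<^sup>2 = \<bar>x\<bar> ^ 4 / 4" by (simp add: power_divide)
      also have "\<dots> \<le> \<bar>x\<bar> ^ 4" by simp
      also have "\<dots> \<le> \<bar>a\<bar> ^ 4" using x by (intro power_mono) auto
      finally show ?thesis .
    qed
    ultimately show "\<bar>exp (- x\<^sup>2 / 2) - (1 - x\<^sup>2 / 2)\<bar> \<le> \<bar>a\<bar> ^ 4" by linarith
  qed simp
  then show ?thesis by (simp add: eval_nat_numeral mult_ac)
qed

lemma gauss_density_real: "gauss_density (x::real) = std_normal_density x"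
  by (simp add: gauss_density_def)

lemma gauss_prob_UNIV [simp]: "measure gauss_measure (UNIV :: 'a::euclidean_space set) = 1"
  using gauss.prob_space[where 'a='a] by simp

lemma gauss_expectation_const: "\<E> (\<lambda>x::'a::euclidean_space. c) = c"
  using gauss.prob_space[where 'a='a] by simp

lemma gauss_integrable_bounded:
  fixes F :: "'a::euclidean_space \<Rightarrow> real"
  assumes "F \<in> borel_measurable borel" "\<And>x. \<bar>F x\<bar> \<le> B"
  shows "integrable gauss_measure F"
  using assms by (intro gauss.integrable_const_bound[where B=B]) auto

lemma gauss_tail_nonneg:
  assumes "0 \<le> a"
  shows "\<E> (indicator ({-a..0} :: real set)) = gprim a / sqrt (2 * pi)"
proof -
  have "has_bochner_integral lborel (\<lambda>x. std_normal_density x * indicator {-a..0} x) (gprim 0 / sqrt (2 * pi) - gprim (- a) / sqrt (2 * pi))"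
  proof (rule has_bochner_integral_FTC_Icc_real)
    show "DERIV (\<lambda>x. gprim x / sqrt (2 * pi)) x :> std_normal_density x" for x
      using DERIV_cdivide[OF gprim_deriv[of x], of "sqrt (2 * pi)"] by (simp add: std_normal_density_def)
    show "isCont std_normal_density x" for x
      unfolding std_normal_density_def by (intro continuous_intros) auto
  qed (use assms in auto)
  then have "(\<integral>x. std_normal_density x * indicator {-a..0} x \<partial>lborel) = gprim a / sqrt (2 * pi)"
    by (simp add: has_bochner_integral_iff gprim_minus)
  then show ?thesis by (subst gauss_expectation_eq) (auto simp: gauss_density_real)
qed

lemma gauss_singleton: "\<E> (indicator ({c} :: real set)) = 0"
proof -
  have "(\<integral>x. gauss_density x * indicator {c} x \<partial>lborel) = (\<integral>x. 0 \<partial>(lborel :: real measure))"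
    by (rule integral_cong_AE) (auto intro!: eventually_mono[OF AE_lborel_singleton[of c]])
  then show ?thesis by (subst gauss_expectation_eq) auto
qed

text \<open>Reflection and the null mass of points give probability 1/2 to the half-line from 0. The
  strip from -a to 0 adds the primitive, and negative a follows by complement and
  reflection.\<close>

lemma gauss_tail: "\<E> (indicator ({-a..} :: real set)) = 1 / 2 + gprim a / sqrt (2 * pi)"
proof -
  have int: "integrable gauss_measure (indicator A :: real \<Rightarrow> real)" if "A \<in> sets borel" for A :: "real set"
    using that by (intro gauss_integrable_bounded[of _ 1]) (auto simp: indicator_def)
  have add: "\<E> (indicator A) = \<E> (indicator B) + \<E> (indicator C)"
    if "A = B \<union> C" "B \<inter> C = {}" "B \<in> sets borel" "C \<in> sets borel" for A B C :: "real set"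
  proof -
    have "indicator A = (\<lambda>x. indicator B x + indicator C x :: real)"
      using that by (auto simp: fun_eq_iff indicator_def)
    then show ?thesis using int that by simp
  qed
  have one: "\<E> (indicator (UNIV :: real set)) = 1"
    using gauss_expectation_const[where c = 1 and 'a = real] by (simp only: indicator_UNIV)
  have refl: "\<E> (indicator {..b}) = \<E> (indicator {-b..})" for b :: real
  proof -
    have "(\<lambda>x. indicator {..b} (- x)) = (indicator {-b..} :: real \<Rightarrow> real)"
      by (auto simp: fun_eq_iff indicator_def)
    then show ?thesis using gauss_expectation_uminus[of "indicator {..b} :: real \<Rightarrow> real"] by simp
  qed
  have open_closed: "\<E> (indicator {b..}) = \<E> (indicator {b<..})" for b :: real
  proof -
    have "{b..} = {b} \<union> {b<..}" by auto
    from add[OF this] show ?thesis by (simp only: gauss_singleton) simp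
  qed
  have compl: "\<E> (indicator {..b}) + \<E> (indicator {b..}) = 1" for b :: real
  proof -
    have "UNIV = {..b} \<union> {b<..}" by auto
    moreover have "{..b} \<inter> {b<..} = {}" by auto
    ultimately have "\<E> (indicator (UNIV :: real set)) = \<E> (indicator {..b}) + \<E> (indicator {b<..})"
      by (rule add) auto
    then show ?thesis using one open_closed[of b] by linarith
  qed
  have half: "\<E> (indicator ({0..} :: real set)) = 1 / 2"
    using compl[of 0] refl[of 0] by simp
  have pos: "\<E> (indicator {-a..}) = 1 / 2 + gprim a / sqrt (2 * pi)" if "0 \<le> a" for a :: real
  proof -
    have "\<E> (indicator {-a..}) = \<E> (indicator {-a..0}) + \<E> (indicator {0::real<..})"
      by (rule add) (use that in auto)
    then show ?thesis using gauss_tail_nonneg[OF that] half open_closed[of 0] by simp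
  qed
  show ?thesis
  proof (cases "0 \<le> a")
    case False
    then show ?thesis using pos[of "- a"] compl[of a] refl[of a] by (simp add: gprim_minus)
  qed (rule pos)
qed

text \<open>A tail probability is at most 1, so the primitive is at most sqrt(2 pi)/2, and pi < 4.
  This bound replaces every growth condition on the graph.\<close>

lemma gprim_bound: "\<bar>gprim a\<bar> \<le> 2"
proof -
  have u: "gprim a \<le> 2" for a
  proof -
    have "\<E> (indicator ({-a..} :: real set)) \<le> 1"
      using gauss.integral_le_const[of "indicator {-a..} :: real \<Rightarrow> real" 1]
      by (simp add: gauss_integrable_bounded[of _ 1] indicator_def)
    then have "gprim a / sqrt (2 * pi) \<le> 1 / 2" unfolding gauss_tail by linarith
    then have "gprim a \<le> sqrt (2 * pi) / 2" by (simp add: divide_le_eq)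
    also have "sqrt (2 * pi) \<le> sqrt (4\<^sup>2)" using pi_less_4 by (intro real_sqrt_le_mono) simp
    finally show ?thesis by simp
  qed
  show ?thesis using u[of a] u[of "- a"] by (simp add: gprim_minus)
qed

text \<open>The vertical Gaussian coordinate is integrated out first: for fixed horizontal
  displacement the indicator is that of a half-line, whose mass is
  \<open>gauss_tail\<close>.\<close>

lemma convolve_gauss_subgraph:
  fixes g :: "'a::euclidean_space \<Rightarrow> real"
  assumes [measurable]: "g \<in> borel_measurable borel" and s: "0 < s"
  shows "convolve (gauss_kernel s) (indicator {(x, h). h \<le> g x}) (x, h) =
    1 / 2 + \<E> (\<lambda>n. gprim ((g (x - sqrt (2 * s) *\<^sub>R n) - h) / sqrt (2 * s))) / sqrt (2 * pi)"
proof -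
  define c where "c = sqrt (2 * s)"
  have c: "0 < c" using s by (simp add: c_def)
  have S: "{(x, h). h \<le> g x} \<in> sets (borel :: ('a \<times> real) measure)"
  proof -
    have [measurable]: "fst \<in> borel_measurable (borel :: ('a \<times> real) measure)"
      "snd \<in> borel_measurable (borel :: ('a \<times> real) measure)"
      by (intro borel_measurable_continuous_onI continuous_intros)+
    have "{p \<in> space (borel :: ('a \<times> real) measure). snd p \<le> g (fst p)} \<in> sets borel" by measurable
    then show ?thesis by (simp add: case_prod_beta)
  qed
  have int: "integrable gauss_measure (\<lambda>\<xi>. indicator {(x, h). h \<le> g x} ((x, h) - c *\<^sub>R \<xi>) :: real)"
  proof (rule gauss_integrable_bounded[of _ 1])
    show "(\<lambda>\<xi>. indicator {(x, h). h \<le> g x} ((x, h) - c *\<^sub>R \<xi>) :: real) \<in> borel_measurable borel"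
      by (rule measurable_compose[of _ borel borel "indicator {(x, h). h \<le> g x}"])
        (use S in \<open>simp_all add: borel_measurable_indicator\<close>)
  qed (simp add: indicator_def)
  have "convolve (gauss_kernel s) (indicator {(x, h). h \<le> g x}) (x, h)
    = \<E> (\<lambda>n. \<E> (\<lambda>\<zeta>::real. indicator {(x, h). h \<le> g x} ((x, h) - c *\<^sub>R (n, \<zeta>))))"
    unfolding convolve_gauss_kernel[OF S s] c_def[symmetric] by (rule gauss_fubini[OF int])
  also have "\<dots> = \<E> (\<lambda>n. 1 / 2 + gprim ((g (x - c *\<^sub>R n) - h) / c) / sqrt (2 * pi))"
  proof (intro arg_cong[where f=\<E>] ext)
    fix n :: 'a
    have "(\<lambda>\<zeta>::real. indicator {(x, h). h \<le> g x} ((x, h) - c *\<^sub>R (n, \<zeta>))) = (indicator {- ((g (x - c *\<^sub>R n) - h) / c)..} :: real \<Rightarrow> real)"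
      using c by (auto simp: fun_eq_iff indicator_def field_simps)
    then show "\<E> (\<lambda>\<zeta>::real. indicator {(x, h). h \<le> g x} ((x, h) - c *\<^sub>R (n, \<zeta>))) = 1 / 2 + gprim ((g (x - c *\<^sub>R n) - h) / c) / sqrt (2 * pi)"
      by (simp only: gauss_tail)
  qed
  also have "\<dots> = 1 / 2 + \<E> (\<lambda>n. gprim ((g (x - c *\<^sub>R n) - h) / c)) / sqrt (2 * pi)"
  proof -
    have "integrable gauss_measure (\<lambda>n. gprim ((g (x - c *\<^sub>R n) - h) / c))"
      by (rule gauss_integrable_bounded[of _ 2]) (auto simp: gprim_bound)
    then show ?thesis by (simp add: gauss_expectation_const)
  qed
  finally show ?thesis by (simp add: c_def)
qed

lemma gprim_expectation_integrable:
  fixes \<phi> :: "'a::euclidean_space \<Rightarrow> real"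
  assumes [measurable]: "\<phi> \<in> borel_measurable borel"
  shows "integrable gauss_measure (\<lambda>n. gprim (\<phi> n))"
  by (rule gauss_integrable_bounded[of _ 2]) (auto simp: gprim_bound)

lemma gprim_expectation_strict:
  fixes \<phi> :: "'a::euclidean_space \<Rightarrow> real"
  assumes [measurable]: "\<phi> \<in> borel_measurable borel" and c: "0 < c" and h: "h < h'"
  shows "\<E> (\<lambda>n. gprim (c * (\<phi> n - h'))) < \<E> (\<lambda>n. gprim (c * (\<phi> n - h)))"
proof (rule gauss.integral_less_AE_space)
  show "AE n in gauss_measure. gprim (c * (\<phi> n - h')) < gprim (c * (\<phi> n - h))"
    using c h by (intro AE_I2 gprim_strict_mono mult_strict_left_mono) auto
  show "emeasure gauss_measure (space (gauss_measure :: 'a measure)) \<noteq> 0"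
    using gauss.emeasure_space_1[where 'a = 'a] by simp
qed (auto intro!: gprim_expectation_integrable)

lemma gprim_expectation_lipschitz:
  fixes \<phi> :: "'a::euclidean_space \<Rightarrow> real"
  assumes [measurable]: "\<phi> \<in> borel_measurable borel" and c: "0 < c"
  shows "\<bar>\<E> (\<lambda>n. gprim (c * (\<phi> n - h))) - \<E> (\<lambda>n. gprim (c * (\<phi> n - h')))\<bar> \<le> c * \<bar>h - h'\<bar>"
proof -
  have i: "integrable gauss_measure (\<lambda>n. gprim (c * (\<phi> n - h)))" for h
    by (rule gprim_expectation_integrable) measurable
  have "\<bar>\<E> (\<lambda>n. gprim (c * (\<phi> n - h)) - gprim (c * (\<phi> n - h')))\<bar>
    \<le> \<E> (\<lambda>n. \<bar>gprim (c * (\<phi> n - h)) - gprim (c * (\<phi> n - h'))\<bar>)"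
    by (rule integral_abs_bound)
  also have "\<dots> \<le> c * \<bar>h - h'\<bar>"
  proof (rule gauss.integral_le_const)
    show "integrable gauss_measure (\<lambda>n. \<bar>gprim (c * (\<phi> n - h)) - gprim (c * (\<phi> n - h'))\<bar>)"
      using i by (intro integrable_abs Bochner_Integration.integrable_diff)
    have "\<bar>gprim (c * (\<phi> n - h)) - gprim (c * (\<phi> n - h'))\<bar> \<le> c * \<bar>h - h'\<bar>" for n
    proof -
      have "\<bar>c * (\<phi> n - h) - c * (\<phi> n - h')\<bar> = c * \<bar>h - h'\<bar>"
        using c by (simp add: right_diff_distrib[symmetric] abs_mult)
      then show ?thesis using gprim_lipschitz[of "c * (\<phi> n - h)" "c * (\<phi> n - h')"] by simp
    qed
    then show "AE n in gauss_measure. \<bar>gprim (c * (\<phi> n - h)) - gprim (c * (\<phi> n - h'))\<bar> \<le> c * \<bar>h - h'\<bar>" by simp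
  qed
  finally show ?thesis using i by simp
qed

text \<open>The function \<phi> may fail to be integrable, so dominated convergence is used on the
  bounded integrands. Cutting them off below at \<open>- gprim 1\<close> makes them eventually
  constant at every point, which avoids the limit of \<open>gprim\<close> at infinity.\<close>

lemma gprim_expectation_neg:
  fixes \<phi> :: "'a::euclidean_space \<Rightarrow> real"
  assumes [measurable]: "\<phi> \<in> borel_measurable borel" and c: "0 < c"
  obtains h where "\<E> (\<lambda>n. gprim (c * (\<phi> n - h))) < 0"
proof -
  define F where "F k n = max (gprim (c * (\<phi> n - real k))) (- gprim 1)" for k n
  have [measurable]: "F k \<in> borel_measurable borel" for k unfolding F_def[abs_def] by measurable
  have b: "\<bar>F k n\<bar> \<le> 2" for k n
    using gprim_bound[of "c * (\<phi> n - real k)"] gprim_bound[of 1] by (auto simp: F_def max_def)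
  have lim: "(\<lambda>k. F k n) \<longlonglongrightarrow> - gprim 1" for n
  proof (rule tendsto_eventually)
    obtain K where K: "\<phi> n + 1 / c \<le> real K" using real_arch_simple by blast
    have "F k n = - gprim 1" if "K \<le> k" for k
    proof -
      have "c * (\<phi> n - real k) \<le> c * (- (1 / c))" using that K c by (intro mult_left_mono) auto
      then have "c * (\<phi> n - real k) \<le> - 1" using c by simp
      then have "gprim (c * (\<phi> n - real k)) \<le> gprim (- 1)" by (rule gprim_mono)
      then show ?thesis by (simp add: F_def gprim_minus max_def)
    qed
    then show "\<forall>\<^sub>F k in sequentially. F k n = - gprim 1" unfolding eventually_sequentially by blast
  qed
  have "(\<lambda>k. \<E> (F k)) \<longlonglongrightarrow> \<E> (\<lambda>n::'a. - gprim 1)"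
    by (rule integral_dominated_convergence[where w="\<lambda>_. 2"]) (auto simp: lim b)
  then have "(\<lambda>k. \<E> (F k)) \<longlonglongrightarrow> - gprim 1" by (simp only: gauss_expectation_const)
  then have "\<forall>\<^sub>F k in sequentially. \<E> (F k) < 0"
    using gprim_pos[of 1] by (intro order_tendstoD(2)) auto
  then obtain k where k: "\<E> (F k) < 0" using eventually_happens'[OF sequentially_bot] by blast
  have "\<E> (\<lambda>n. gprim (c * (\<phi> n - real k))) \<le> \<E> (F k)"
    by (rule integral_mono) (auto intro!: gprim_expectation_integrable gauss_integrable_bounded[of _ 2] b simp: F_def)
  with k show ?thesis using that[of "real k"] by simp
qed

text \<open>Since \<open>gprim\<close> is odd, the negative value obtained for
  \<open>- \<phi>\<close> is a positive one for \<phi>. Lipschitz continuity in the height gives a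
  zero between, and strict monotonicity makes it unique.\<close>

lemma gprim_expectation_zero:
  fixes \<phi> :: "'a::euclidean_space \<Rightarrow> real"
  assumes m [measurable]: "\<phi> \<in> borel_measurable borel" and c: "0 < c"
  shows "\<exists>!h. \<E> (\<lambda>n. gprim (c * (\<phi> n - h))) = 0"
proof (rule ex_ex1I)
  let ?U = "\<lambda>h. \<E> (\<lambda>n. gprim (c * (\<phi> n - h)))"
  obtain h1 where h1: "?U h1 < 0" by (rule gprim_expectation_neg[OF m c])
  obtain h2 where h2: "\<E> (\<lambda>n. gprim (c * (- \<phi> n - h2))) < 0"
    by (rule gprim_expectation_neg[of "\<lambda>n. - \<phi> n", OF _ c]) measurable
  have "gprim (c * (- \<phi> n - h2)) = - gprim (c * (\<phi> n - (- h2)))" for n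
  proof -
    have "c * (- \<phi> n - h2) = - (c * (\<phi> n - (- h2)))" by (simp add: algebra_simps)
    then show ?thesis by (simp only: gprim_minus)
  qed
  then have h2: "0 < ?U (- h2)" using h2 by simp
  have "- h2 < h1"
  proof (rule ccontr)
    assume "\<not> - h2 < h1"
    then have "?U (- h2) \<le> ?U h1"
      using gprim_expectation_strict[OF m c, of h1 "- h2"] by (cases "h1 = - h2") auto
    then show False using h1 h2 by linarith
  qed
  moreover have "continuous_on {- h2..h1} ?U"
  proof (rule continuous_onI)
    fix x e :: real assume "0 < e"
    then show "\<exists>d>0. \<forall>x'\<in>{- h2..h1}. dist x' x < d \<longrightarrow> dist (?U x') (?U x) \<le> e"
    proof (intro exI[of _ "e / c"] conjI ballI impI)
      fix x' assume "dist x' x < e / c"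
      then have "c * \<bar>x' - x\<bar> \<le> e" using c by (simp add: dist_real_def field_simps)
      then show "dist (?U x') (?U x) \<le> e"
        using gprim_expectation_lipschitz[OF m c, of x' x] by (simp add: dist_real_def)
    qed (use c in auto)
  qed
  ultimately show "\<exists>h. ?U h = 0"
    using IVT2'[of ?U h1 0 "- h2"] h1 h2 by fastforce
  show "h = h'" if "?U h = 0" "?U h' = 0" for h h'
    using that gprim_expectation_strict[OF m c, of h h'] gprim_expectation_strict[OF m c, of h' h]
    by (cases h h' rule: linorder_cases) auto
qed

text \<open>
  The description is proper for Borel \<open>\<phi>\<close> and \<open>c > 0\<close>, by \<open>gprim_expectation_zero\<close>.
\<close>

definition level :: "real \<Rightarrow> ('a::euclidean_space \<Rightarrow> real) \<Rightarrow> real"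
  where "level c \<phi> = (THE h. \<E> (\<lambda>n. gprim (c * (\<phi> n - h))) = 0)"

lemma gprim_expectation_level:
  fixes \<phi> :: "'a::euclidean_space \<Rightarrow> real"
  assumes m: "\<phi> \<in> borel_measurable borel" and c: "0 < c"
  shows "\<E> (\<lambda>n. gprim (c * (\<phi> n - level c \<phi>))) = 0"
  unfolding level_def by (rule theI'[OF gprim_expectation_zero[OF m c]])

lemma level_greater_iff:
  fixes \<phi> :: "'a::euclidean_space \<Rightarrow> real"
  assumes m: "\<phi> \<in> borel_measurable borel" and c: "0 < c"
  shows "h < level c \<phi> \<longleftrightarrow> 0 < \<E> (\<lambda>n. gprim (c * (\<phi> n - h)))"
    and "level c \<phi> < h \<longleftrightarrow> \<E> (\<lambda>n. gprim (c * (\<phi> n - h))) < 0"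
  using gprim_expectation_strict[OF m c, of h "level c \<phi>"] gprim_expectation_strict[OF m c, of "level c \<phi>" h]
    gprim_expectation_level[OF m c]
  by (cases h "level c \<phi>" rule: linorder_cases; simp)+

lemma gprim_expectation_continuous:
  fixes g :: "'a::euclidean_space \<Rightarrow> real"
  assumes g: "continuous_on UNIV g"
  shows "continuous_on UNIV (\<lambda>p. \<E> (\<lambda>n. gprim (d * (g (fst p - c *\<^sub>R n) - snd p))))"
  unfolding continuous_on_sequentially comp_def
proof (intro allI ballI impI)
  have [measurable]: "g \<in> borel_measurable borel" using g by (rule borel_measurable_continuous_onI)
  fix X :: "nat \<Rightarrow> 'a \<times> real" and p
  assume "(\<forall>k. X k \<in> UNIV) \<and> X \<longlonglongrightarrow> p"
  then have X: "X \<longlonglongrightarrow> p" by simp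
  show "(\<lambda>k. \<E> (\<lambda>n. gprim (d * (g (fst (X k) - c *\<^sub>R n) - snd (X k)))))
      \<longlonglongrightarrow> \<E> (\<lambda>n. gprim (d * (g (fst p - c *\<^sub>R n) - snd p)))"
  proof (rule integral_dominated_convergence[where w="\<lambda>_. 2"])
    have "(\<lambda>k. gprim (d * (g (fst (X k) - c *\<^sub>R n) - snd (X k)))) \<longlonglongrightarrow> gprim (d * (g (fst p - c *\<^sub>R n) - snd p))" for n
    proof -
      have "isCont g y" for y using g by (simp add: continuous_on_eq_continuous_at)
      moreover have "isCont gprim y" for y using DERIV_isCont[OF gprim_deriv] .
      moreover have "(\<lambda>k. fst (X k) - c *\<^sub>R n) \<longlonglongrightarrow> fst p - c *\<^sub>R n"
        by (intro tendsto_intros X)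
      ultimately show ?thesis
        by (intro isCont_tendsto_compose[of _ gprim] isCont_tendsto_compose[of _ g] tendsto_intros tendsto_snd X)
    qed
    then show "AE n in gauss_measure. (\<lambda>k. gprim (d * (g (fst (X k) - c *\<^sub>R n) - snd (X k)))) \<longlonglongrightarrow> gprim (d * (g (fst p - c *\<^sub>R n) - snd p))"
      by simp
    show "AE n in gauss_measure. norm (gprim (d * (g (fst (X k) - c *\<^sub>R n) - snd (X k)))) \<le> 2" for k
      by (simp add: gprim_bound)
  qed auto
qed

text \<open>An implicit function argument without derivatives: the expectation has strict signs at
  \<open>e\<close> above and below the level, and by continuity these persist at neighbouring points
  and enclose the level there.\<close>

lemma level_continuous:
  fixes g :: "'a::euclidean_space \<Rightarrow> real"
  assumes g: "continuous_on UNIV g" and d: "0 < d"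
  shows "continuous_on UNIV (\<lambda>x. level d (\<lambda>n. g (x - c *\<^sub>R n)))"
proof -
  define U where "U p = \<E> (\<lambda>n. gprim (d * (g (fst p - c *\<^sub>R n) - snd p)))" for p
  have U: "continuous_on UNIV U" unfolding U_def[abs_def] by (rule gprim_expectation_continuous[OF g])
  have [measurable]: "g \<in> borel_measurable borel" using g by (rule borel_measurable_continuous_onI)
  have m: "(\<lambda>n. g (x - c *\<^sub>R n)) \<in> borel_measurable borel" for x by measurable
  let ?l = "\<lambda>x. level d (\<lambda>n. g (x - c *\<^sub>R n))"
  have "\<forall>\<^sub>F x in at x0. dist (?l x) (?l x0) < e" if e: "0 < e" for x0 e
  proof -
    have Ux: "((\<lambda>x. U (x, h)) \<longlongrightarrow> U (x0, h)) (at x0)" for h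
    proof -
      have "continuous_on UNIV (\<lambda>x. U (x, h))"
        by (rule continuous_on_compose2[OF U]) (auto intro!: continuous_intros)
      then show ?thesis by (simp add: continuous_on_def)
    qed
    have "U (x0, ?l x0 + e) < 0" "0 < U (x0, ?l x0 - e)"
      using level_greater_iff(2)[OF m[of x0] d, of "?l x0 + e"] level_greater_iff(1)[OF m[of x0] d, of "?l x0 - e"] e
      by (simp_all add: U_def)
    from order_tendstoD(2)[OF Ux this(1)] order_tendstoD(1)[OF Ux this(2)]
    show ?thesis
    proof eventually_elim
      case (elim x)
      then have "?l x < ?l x0 + e" "?l x0 - e < ?l x"
        using level_greater_iff[OF m d] by (auto simp: U_def)
      then show ?case by (simp add: dist_real_def abs_less_iff)
    qed
  qed
  then show ?thesis by (simp add: continuous_on_def tendsto_iff)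
qed

section \<open>Uniform asymptotics with polynomial weights\<close>

lemma gauss_fubini_swap:
  fixes F :: "'a::euclidean_space \<times> 'b::euclidean_space \<Rightarrow> real"
  assumes "integrable gauss_measure F"
  shows "\<E> F = \<E> (\<lambda>y. \<E> (\<lambda>x. F (x, y)))"
proof -
  interpret pair_sigma_finite "gauss_measure :: 'a measure" "gauss_measure :: 'b measure" ..
  have F: "integrable (gauss_measure \<Otimes>\<^sub>M gauss_measure) F" using assms by (simp add: gauss_measure_prod)
  show ?thesis using integral_snd[of "\<lambda>x y. F (x, y)"] F by (simp add: gauss_measure_prod)
qed

lemma borel_measurable_partial_expectation:
  fixes F :: "'a::euclidean_space \<times> 'b::euclidean_space \<Rightarrow> real"
  assumes "F \<in> borel_measurable borel"
  shows "(\<lambda>x. \<E> (\<lambda>y. F (x, y))) \<in> borel_measurable borel"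
proof (rule sigma_finite_measure.borel_measurable_lebesgue_integral[OF gauss.sigma_finite_measure_axioms])
  have "sets (borel \<Otimes>\<^sub>M (gauss_measure :: 'b measure)) = sets (borel :: ('a \<times> 'b) measure)"
    unfolding borel_prod[symmetric] by (intro sets_pair_measure_cong) auto
  then show "(\<lambda>(x, y). F (x, y)) \<in> borel_measurable (borel \<Otimes>\<^sub>M gauss_measure)"
    using assms measurable_cong_sets by (simp cong: measurable_cong_sets)
qed

lemma pair_section_measurable:
  fixes F :: "'a::euclidean_space \<times> 'b::euclidean_space \<Rightarrow> real"
  assumes "F \<in> borel_measurable borel"
  shows "(\<lambda>y. F (x, y)) \<in> borel_measurable borel"
  by (rule measurable_compose[OF _ assms]) (intro borel_measurable_continuous_onI continuous_intros)

lemma gauss_integrable_poly: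
  fixes F :: "'a::euclidean_space \<Rightarrow> real"
  assumes "F \<in> borel_measurable borel" "\<And>x. \<bar>F x\<bar> \<le> C * (1 + norm x) ^ K"
  shows "integrable gauss_measure F"
proof (rule Bochner_Integration.integrable_bound)
  show "integrable gauss_measure (\<lambda>x::'a. C * (1 + norm x) ^ K)" by (simp add: gauss_integrable_weight)
  show "AE x in gauss_measure. norm (F x) \<le> norm (C * (1 + norm x) ^ K)"
    using assms(2) by (intro AE_I2) (metis abs_ge_self order_trans real_norm_def)
qed (use assms in auto)

lemma gauss_abs_expectation_le:
  fixes F G :: "'a::euclidean_space \<Rightarrow> real"
  assumes "F \<in> borel_measurable borel" "integrable gauss_measure G" "\<And>x. \<bar>F x\<bar> \<le> G x"
  shows "\<bar>\<E> F\<bar> \<le> \<E> G"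
proof -
  have "integrable gauss_measure F"
    by (rule Bochner_Integration.integrable_bound[OF assms(2)])
      (use assms in \<open>auto intro!: AE_I2 intro: order_trans[OF _ abs_ge_self]\<close>)
  then have "\<E> (\<lambda>x. \<bar>F x\<bar>) \<le> \<E> G"
    using assms by (intro integral_mono) auto
  then show ?thesis using integral_abs_bound[of gauss_measure F] by linarith
qed

text \<open>
  \<open>W = O(\<tau>\<^sup>a)\<close> as \<open>\<tau> \<rightarrow> 0+\<close>, uniformly in \<open>x\<close> up to polynomial growth; the uniformity is what lets the
  estimate pass to Gaussian expectations.
\<close>

definition pbig :: "nat \<Rightarrow> (real \<Rightarrow> 'a::euclidean_space \<Rightarrow> real) \<Rightarrow> bool"
  where "pbig a W \<longleftrightarrow> (\<forall>\<tau>>0. W \<tau> \<in> borel_measurable borel) \<and>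
    (\<exists>C K. 0 \<le> C \<and> (\<forall>\<^sub>F \<tau> in at_right 0. \<forall>x. \<bar>W \<tau> x\<bar> \<le> C * \<tau> ^ a * (1 + norm x) ^ K))"

lemma eventually_at_right_unit: "\<forall>\<^sub>F \<tau> in at_right (0::real). 0 < \<tau> \<and> \<tau> < 1"
  unfolding eventually_at_right_field by (intro exI[of _ 1]) auto

lemma pbig_measurable: "pbig a W \<Longrightarrow> 0 < \<tau> \<Longrightarrow> W \<tau> \<in> borel_measurable borel"
  by (simp add: pbig_def)

lemma pbigE:
  assumes "pbig a W"
  obtains C K where "0 \<le> C" "\<forall>\<^sub>F \<tau> in at_right 0. 0 < \<tau> \<and> \<tau> < 1 \<and> (\<forall>x. \<bar>W \<tau> x\<bar> \<le> C * \<tau> ^ a * (1 + norm x) ^ K)"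
proof -
  obtain C K where C: "0 \<le> C" "\<forall>\<^sub>F \<tau> in at_right 0. \<forall>x. \<bar>W \<tau> x\<bar> \<le> C * \<tau> ^ a * (1 + norm x) ^ K"
    using assms unfolding pbig_def by blast
  have "\<forall>\<^sub>F \<tau> in at_right 0. 0 < \<tau> \<and> \<tau> < 1 \<and> (\<forall>x. \<bar>W \<tau> x\<bar> \<le> C * \<tau> ^ a * (1 + norm x) ^ K)"
    using eventually_at_right_unit C(2) by eventually_elim auto
  with C(1) show ?thesis by (rule that)
qed

lemma pbigI:
  fixes W :: "real \<Rightarrow> 'a::euclidean_space \<Rightarrow> real"
  assumes "\<And>\<tau>. 0 < \<tau> \<Longrightarrow> W \<tau> \<in> borel_measurable borel"
    and "\<forall>\<^sub>F \<tau> in at_right 0. \<forall>x. \<bar>W \<tau> x\<bar> \<le> C * \<tau> ^ a * (1 + norm x) ^ K"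
  shows "pbig a W"
  unfolding pbig_def
proof (intro conjI exI[of _ "\<bar>C\<bar>"] exI[of _ K])
  show "\<forall>\<^sub>F \<tau> in at_right 0. \<forall>x. \<bar>W \<tau> x\<bar> \<le> \<bar>C\<bar> * \<tau> ^ a * (1 + norm x) ^ K"
    using assms(2) eventually_at_right_unit
  proof eventually_elim
    case (elim \<tau>)
    have "C * \<tau> ^ a * (1 + norm x) ^ K \<le> \<bar>C\<bar> * \<tau> ^ a * (1 + norm x) ^ K" for x :: 'a
      using elim(2) by (intro mult_right_mono) auto
    then show ?case using elim(1) order_trans by blast
  qed
qed (use assms in auto)

lemma pbig_bound:
  assumes "pbig a W" "\<And>\<tau>. 0 < \<tau> \<Longrightarrow> V \<tau> \<in> borel_measurable borel"
    and "\<forall>\<^sub>F \<tau> in at_right 0. \<forall>x. \<bar>V \<tau> x\<bar> \<le> \<bar>W \<tau> x\<bar>"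
  shows "pbig a V"
proof -
  obtain C K where "0 \<le> C" and C: "\<forall>\<^sub>F \<tau> in at_right 0. 0 < \<tau> \<and> \<tau> < 1 \<and> (\<forall>x. \<bar>W \<tau> x\<bar> \<le> C * \<tau> ^ a * (1 + norm x) ^ K)"
    by (rule pbigE[OF assms(1)])
  have "\<forall>\<^sub>F \<tau> in at_right 0. \<forall>x. \<bar>V \<tau> x\<bar> \<le> C * \<tau> ^ a * (1 + norm x) ^ K"
    using C assms(3) by eventually_elim (meson order_trans)
  then show ?thesis using assms(2) by (intro pbigI)
qed

lemma pbig_cong_eventually:
  assumes "pbig a W" "\<And>\<tau>. 0 < \<tau> \<Longrightarrow> V \<tau> \<in> borel_measurable borel"
    and "\<forall>\<^sub>F \<tau> in at_right 0. \<forall>x. V \<tau> x = W \<tau> x"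
  shows "pbig a V"
  using assms(3) by (intro pbig_bound[OF assms(1,2)]) (auto elim: eventually_mono)

lemma pbig_cong:
  assumes "pbig a W" "\<And>\<tau> x. 0 < \<tau> \<Longrightarrow> V \<tau> x = W \<tau> x"
  shows "pbig a V"
proof (rule pbig_cong_eventually[OF assms(1)])
  show "V \<tau> \<in> borel_measurable borel" if "0 < \<tau>" for \<tau>
  proof -
    have "V \<tau> = W \<tau>" using assms(2)[OF that] by auto
    then show ?thesis using pbig_measurable[OF assms(1) that] by simp
  qed
  show "\<forall>\<^sub>F \<tau> in at_right 0. \<forall>x. V \<tau> x = W \<tau> x"
    using eventually_at_right_unit by eventually_elim (use assms(2) in auto)
qed

lemma pbig_weaken:
  assumes "pbig a W" "b \<le> a"
  shows "pbig b W"
proof -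
  obtain C K where C: "0 \<le> C" "\<forall>\<^sub>F \<tau> in at_right 0. 0 < \<tau> \<and> \<tau> < 1 \<and> (\<forall>x. \<bar>W \<tau> x\<bar> \<le> C * \<tau> ^ a * (1 + norm x) ^ K)"
    by (rule pbigE[OF assms(1)])
  have "\<forall>\<^sub>F \<tau> in at_right 0. \<forall>x. \<bar>W \<tau> x\<bar> \<le> C * \<tau> ^ b * (1 + norm x) ^ K"
    using C(2)
  proof eventually_elim
    case (elim \<tau>)
    have "C * \<tau> ^ a * (1 + norm x) ^ K \<le> C * \<tau> ^ b * (1 + norm x) ^ K" for x :: 'a
      using elim C(1) assms(2) by (intro mult_right_mono mult_left_mono power_decreasing) auto
    then show ?case using elim by (meson order_trans)
  qed
  then show ?thesis by (intro pbigI pbig_measurable[OF assms(1)])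
qed

lemma pbig_add:
  assumes "pbig a V" "pbig a W"
  shows "pbig a (\<lambda>\<tau> x. V \<tau> x + W \<tau> x)"
proof -
  obtain C K where C: "0 \<le> C" "\<forall>\<^sub>F \<tau> in at_right 0. 0 < \<tau> \<and> \<tau> < 1 \<and> (\<forall>x. \<bar>V \<tau> x\<bar> \<le> C * \<tau> ^ a * (1 + norm x) ^ K)"
    by (rule pbigE[OF assms(1)])
  obtain D L where D: "0 \<le> D" "\<forall>\<^sub>F \<tau> in at_right 0. 0 < \<tau> \<and> \<tau> < 1 \<and> (\<forall>x. \<bar>W \<tau> x\<bar> \<le> D * \<tau> ^ a * (1 + norm x) ^ L)"
    by (rule pbigE[OF assms(2)])
  have "\<forall>\<^sub>F \<tau> in at_right 0. \<forall>x. \<bar>V \<tau> x + W \<tau> x\<bar> \<le> (C + D) * \<tau> ^ a * (1 + norm x) ^ (K + L)"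
    using C(2) D(2)
  proof eventually_elim
    case (elim \<tau>)
    show ?case
    proof
      fix x :: 'a
      have "C * \<tau> ^ a * (1 + norm x) ^ K \<le> C * \<tau> ^ a * (1 + norm x) ^ (K + L)"
        "D * \<tau> ^ a * (1 + norm x) ^ L \<le> D * \<tau> ^ a * (1 + norm x) ^ (K + L)"
        using elim C(1) D(1) by (intro mult_left_mono power_increasing; simp)+
      then show "\<bar>V \<tau> x + W \<tau> x\<bar> \<le> (C + D) * \<tau> ^ a * (1 + norm x) ^ (K + L)"
        using elim by (smt (verit) distrib_right)
    qed
  qed
  then show ?thesis
    using pbig_measurable[OF assms(1)] pbig_measurable[OF assms(2)] by (intro pbigI borel_measurable_add)
qed

lemma pbig_mult:
  assumes "pbig a V" "pbig b W"
  shows "pbig (a + b) (\<lambda>\<tau> x. V \<tau> x * W \<tau> x)"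
proof -
  obtain C K where C: "0 \<le> C" "\<forall>\<^sub>F \<tau> in at_right 0. 0 < \<tau> \<and> \<tau> < 1 \<and> (\<forall>x. \<bar>V \<tau> x\<bar> \<le> C * \<tau> ^ a * (1 + norm x) ^ K)"
    by (rule pbigE[OF assms(1)])
  obtain D L where D: "0 \<le> D" "\<forall>\<^sub>F \<tau> in at_right 0. 0 < \<tau> \<and> \<tau> < 1 \<and> (\<forall>x. \<bar>W \<tau> x\<bar> \<le> D * \<tau> ^ b * (1 + norm x) ^ L)"
    by (rule pbigE[OF assms(2)])
  have "\<forall>\<^sub>F \<tau> in at_right 0. \<forall>x. \<bar>V \<tau> x * W \<tau> x\<bar> \<le> (C * D) * \<tau> ^ (a + b) * (1 + norm x) ^ (K + L)"
    using C(2) D(2)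
  proof eventually_elim
    case (elim \<tau>)
    show ?case
    proof
      fix x :: 'a
      have "\<bar>V \<tau> x * W \<tau> x\<bar> \<le> (C * \<tau> ^ a * (1 + norm x) ^ K) * (D * \<tau> ^ b * (1 + norm x) ^ L)"
        unfolding abs_mult using elim C(1) by (intro mult_mono) auto
      then show "\<bar>V \<tau> x * W \<tau> x\<bar> \<le> (C * D) * \<tau> ^ (a + b) * (1 + norm x) ^ (K + L)"
        by (simp add: power_add mult_ac)
    qed
  qed
  then show ?thesis
    using pbig_measurable[OF assms(1)] pbig_measurable[OF assms(2)] by (intro pbigI borel_measurable_times)
qed

lemma pbig_poly:
  assumes "f \<in> borel_measurable borel" "\<And>x. \<bar>f x\<bar> \<le> C * (1 + norm x) ^ K"
  shows "pbig 0 (\<lambda>\<tau>. f)"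
  by (rule pbigI[where C=C and K=K]) (use assms in auto)

lemma pbig_const [intro]: "pbig 0 (\<lambda>\<tau> x. c)"
  by (rule pbig_poly[where C="\<bar>c\<bar>" and K=0]) auto

lemma pbig_tau: "pbig k (\<lambda>\<tau> x. \<tau> ^ k)"
  by (rule pbigI[where C=1 and K=0]) (auto intro: eventually_mono[OF eventually_at_right_unit])

lemma pbig_cmult: "pbig a W \<Longrightarrow> pbig a (\<lambda>\<tau> x. c * W \<tau> x)"
  using pbig_mult[OF pbig_const, of a W c] by simp

lemma pbig_minus: "pbig a W \<Longrightarrow> pbig a (\<lambda>\<tau> x. - W \<tau> x)"
  using pbig_cmult[of a W "- 1"] by simp

lemma pbig_diff: "pbig a V \<Longrightarrow> pbig a W \<Longrightarrow> pbig a (\<lambda>\<tau> x. V \<tau> x - W \<tau> x)"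
  using pbig_add[OF _ pbig_minus, of a V W] by simp

lemma pbig_power: "pbig a W \<Longrightarrow> pbig (k * a) (\<lambda>\<tau> x. W \<tau> x ^ k)"
  by (induction k) (auto intro: pbig_mult)

lemma pbig_tau_mult: "pbig a W \<Longrightarrow> pbig (a + k) (\<lambda>\<tau> x. \<tau> ^ k * W \<tau> x)"
  using pbig_mult[OF pbig_tau[of k], of a W] by (simp add: add.commute)

text \<open>Applied to reflections, coordinate projections, differences of the two variables and
  dilation by sqrt 2.\<close>

lemma pbig_linear:
  fixes W :: "real \<Rightarrow> 'a::euclidean_space \<Rightarrow> real" and L :: "'b::euclidean_space \<Rightarrow> 'a"
  assumes W: "pbig a W" and L: "bounded_linear L"
  shows "pbig a (\<lambda>\<tau> x. W \<tau> (L x))"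
proof -
  obtain C K where C: "0 \<le> C" "\<forall>\<^sub>F \<tau> in at_right 0. 0 < \<tau> \<and> \<tau> < 1 \<and> (\<forall>x. \<bar>W \<tau> x\<bar> \<le> C * \<tau> ^ a * (1 + norm x) ^ K)"
    by (rule pbigE[OF W])
  obtain B where B: "0 \<le> B" "\<And>x. norm (L x) \<le> norm x * B"
    using bounded_linear.nonneg_bounded[OF L] by blast
  have "\<forall>\<^sub>F \<tau> in at_right 0. \<forall>x. \<bar>W \<tau> (L x)\<bar> \<le> (C * (1 + B) ^ K) * \<tau> ^ a * (1 + norm x) ^ K"
    using C(2)
  proof eventually_elim
    case (elim \<tau>)
    show ?case
    proof
      fix x :: 'b
      have "1 + norm (L x) \<le> (1 + B) * (1 + norm x)"
      proof -
        have "(1 + B) * (1 + norm x) = 1 + B + norm x + norm x * B" by (simp add: algebra_simps)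
        then show ?thesis using B(1) B(2)[of x] norm_ge_zero[of x] by linarith
      qed
      then have "(1 + norm (L x)) ^ K \<le> (1 + B) ^ K * (1 + norm x) ^ K"
        unfolding power_mult_distrib[symmetric] by (intro power_mono) auto
      then have "C * \<tau> ^ a * (1 + norm (L x)) ^ K \<le> C * \<tau> ^ a * ((1 + B) ^ K * (1 + norm x) ^ K)"
        using elim C(1) by (intro mult_left_mono) auto
      then show "\<bar>W \<tau> (L x)\<bar> \<le> (C * (1 + B) ^ K) * \<tau> ^ a * (1 + norm x) ^ K"
        using elim by (smt (verit) mult.assoc mult.commute)
    qed
  qed
  moreover have "(\<lambda>x. W \<tau> (L x)) \<in> borel_measurable borel" if "0 < \<tau>" for \<tau>
    by (rule measurable_compose[OF _ pbig_measurable[OF W that]])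
      (intro borel_measurable_continuous_onI linear_continuous_on L)
  ultimately show ?thesis by (intro pbigI)
qed

lemma pbig_integrable:
  fixes W :: "real \<Rightarrow> 'a::euclidean_space \<Rightarrow> real"
  assumes "pbig a W"
  shows "\<forall>\<^sub>F \<tau> in at_right 0. integrable gauss_measure (W \<tau>)"
proof -
  obtain C K where "0 \<le> C" and C: "\<forall>\<^sub>F \<tau> in at_right 0. 0 < \<tau> \<and> \<tau> < 1 \<and> (\<forall>x. \<bar>W \<tau> x\<bar> \<le> C * \<tau> ^ a * (1 + norm x) ^ K)"
    by (rule pbigE[OF assms])
  from C show ?thesis
  proof eventually_elim
    case (elim \<tau>)
    then show ?case
      using pbig_measurable[OF assms] by (intro gauss_integrable_poly[where C="C * \<tau> ^ a" and K=K]) auto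
  qed
qed

lemma pbig_expectation:
  fixes W :: "real \<Rightarrow> 'a::euclidean_space \<Rightarrow> real"
  assumes "pbig a W"
  shows "(\<lambda>\<tau>. \<E> (W \<tau>)) \<in> O[at_right 0](\<lambda>\<tau>. \<tau> ^ a)"
proof -
  obtain C K where C: "0 \<le> C" "\<forall>\<^sub>F \<tau> in at_right 0. 0 < \<tau> \<and> \<tau> < 1 \<and> (\<forall>x. \<bar>W \<tau> x\<bar> \<le> C * \<tau> ^ a * (1 + norm x) ^ K)"
    by (rule pbigE[OF assms])
  show ?thesis
  proof (rule bigoI[where c="C * \<E> (\<lambda>x::'a. (1 + norm x) ^ K)"])
    show "\<forall>\<^sub>F \<tau> in at_right 0. norm (\<E> (W \<tau>)) \<le> C * \<E> (\<lambda>x::'a. (1 + norm x) ^ K) * norm (\<tau> ^ a)"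
      using C(2)
    proof eventually_elim
      case (elim \<tau>)
      have "\<bar>\<E> (W \<tau>)\<bar> \<le> \<E> (\<lambda>x::'a. C * \<tau> ^ a * (1 + norm x) ^ K)"
        by (rule gauss_abs_expectation_le)
          (use pbig_measurable[OF assms] elim in \<open>auto simp: gauss_integrable_weight\<close>)
      then show ?case using elim by (simp add: mult_ac)
    qed
  qed
qed

lemma weight_pair: "(1 + norm (x, y)) ^ K \<le> (1 + norm x) ^ K * (1 + norm y) ^ K"
proof -
  have "norm (x, y) \<le> norm x + norm y" by (rule norm_Pair_le)
  also have "1 + (norm x + norm y) \<le> (1 + norm x) * (1 + norm y)" by (simp add: algebra_simps)
  finally have "1 + norm (x, y) \<le> (1 + norm x) * (1 + norm y)" by simp
  then show ?thesis unfolding power_mult_distrib[symmetric] by (intro power_mono) auto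
qed

text \<open>The weight of a pair is at most the product of the two weights, so averaging over one
  variable only costs a Gaussian moment. The eventual integrability holds for all \<open>x\<close>
  at once.\<close>

lemma pbig_partial:
  fixes W :: "real \<Rightarrow> 'a::euclidean_space \<times> 'b::euclidean_space \<Rightarrow> real"
  assumes W: "pbig a W"
  shows "pbig a (\<lambda>\<tau> x. \<E> (\<lambda>y. W \<tau> (x, y)))"
    and "\<forall>\<^sub>F \<tau> in at_right 0. \<forall>x. integrable gauss_measure (\<lambda>y. W \<tau> (x, y))"
proof -
  obtain C K where C: "0 \<le> C" "\<forall>\<^sub>F \<tau> in at_right 0. 0 < \<tau> \<and> \<tau> < 1 \<and> (\<forall>x. \<bar>W \<tau> x\<bar> \<le> C * \<tau> ^ a * (1 + norm x) ^ K)"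
    by (rule pbigE[OF W])
  have b: "\<bar>W \<tau> (x, y)\<bar> \<le> (C * \<tau> ^ a * (1 + norm x) ^ K) * (1 + norm y) ^ K"
    if "0 < \<tau>" "\<forall>x. \<bar>W \<tau> x\<bar> \<le> C * \<tau> ^ a * (1 + norm x) ^ K" for \<tau> x y
  proof -
    have "\<bar>W \<tau> (x, y)\<bar> \<le> C * \<tau> ^ a * (1 + norm (x, y)) ^ K" using that by blast
    also have "\<dots> \<le> C * \<tau> ^ a * ((1 + norm x) ^ K * (1 + norm y) ^ K)"
      using that C(1) weight_pair by (intro mult_left_mono) auto
    finally show ?thesis by (simp add: mult_ac)
  qed
  have m: "(\<lambda>y. W \<tau> (x, y)) \<in> borel_measurable borel" if "0 < \<tau>" for \<tau> x
    by (rule measurable_compose[OF _ pbig_measurable[OF W that]])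
      (intro borel_measurable_continuous_onI continuous_intros)
  show "\<forall>\<^sub>F \<tau> in at_right 0. \<forall>x. integrable gauss_measure (\<lambda>y. W \<tau> (x, y))"
    using C(2)
  proof (eventually_elim, intro allI)
    fix \<tau> x assume \<tau>: "0 < \<tau> \<and> \<tau> < 1 \<and> (\<forall>x. \<bar>W \<tau> x\<bar> \<le> C * \<tau> ^ a * (1 + norm x) ^ K)"
    show "integrable gauss_measure (\<lambda>y. W \<tau> (x, y))"
      by (rule gauss_integrable_poly[OF m b]) (use \<tau> in auto)
  qed
  have "\<forall>\<^sub>F \<tau> in at_right 0. \<forall>x. \<bar>\<E> (\<lambda>y. W \<tau> (x, y))\<bar> \<le> (C * \<E> (\<lambda>y::'b. (1 + norm y) ^ K)) * \<tau> ^ a * (1 + norm x) ^ K"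
    using C(2)
  proof eventually_elim
    case (elim \<tau>)
    show ?case
    proof
      fix x
      have "\<bar>\<E> (\<lambda>y. W \<tau> (x, y))\<bar> \<le> \<E> (\<lambda>y::'b. (C * \<tau> ^ a * (1 + norm x) ^ K) * (1 + norm y) ^ K)"
        by (rule gauss_abs_expectation_le) (use elim m b in \<open>auto simp: gauss_integrable_weight\<close>)
      then show "\<bar>\<E> (\<lambda>y. W \<tau> (x, y))\<bar> \<le> (C * \<E> (\<lambda>y::'b. (1 + norm y) ^ K)) * \<tau> ^ a * (1 + norm x) ^ K"
        by (simp add: mult_ac)
    qed
  qed
  then show "pbig a (\<lambda>\<tau> x. \<E> (\<lambda>y. W \<tau> (x, y)))"
    by (intro pbigI borel_measurable_partial_expectation pbig_measurable[OF W])
qed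

lemma pbig_gprim:
  assumes W: "pbig 0 W"
  shows "pbig 4 (\<lambda>\<tau> x. gprim (\<tau> * W \<tau> x) / \<tau> - (W \<tau> x - \<tau>\<^sup>2 * W \<tau> x ^ 3 / 6))"
proof (rule pbig_bound)
  have "pbig (5 * 0 + 4) (\<lambda>\<tau> x. \<tau> ^ 4 * W \<tau> x ^ 5)" by (intro pbig_tau_mult pbig_power W)
  then show "pbig 4 (\<lambda>\<tau> x. \<tau> ^ 4 * W \<tau> x ^ 5)" by simp
  show "(\<lambda>x. gprim (\<tau> * W \<tau> x) / \<tau> - (W \<tau> x - \<tau>\<^sup>2 * W \<tau> x ^ 3 / 6)) \<in> borel_measurable borel" if "0 < \<tau>" for \<tau>
    using pbig_measurable[OF W that] by measurable
  show "\<forall>\<^sub>F \<tau> in at_right 0. \<forall>x. \<bar>gprim (\<tau> * W \<tau> x) / \<tau> - (W \<tau> x - \<tau>\<^sup>2 * W \<tau> x ^ 3 / 6)\<bar> \<le> \<bar>\<tau> ^ 4 * W \<tau> x ^ 5\<bar>"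
    using eventually_at_right_unit
  proof (eventually_elim, intro allI)
    fix \<tau> :: real and x assume \<tau>: "0 < \<tau> \<and> \<tau> < 1"
    define w where "w = W \<tau> x"
    have "gprim (\<tau> * w) / \<tau> - (w - \<tau>\<^sup>2 * w ^ 3 / 6) = (gprim (\<tau> * w) - (\<tau> * w - (\<tau> * w) ^ 3 / 6)) / \<tau>"
      using \<tau> by (simp add: field_simps eval_nat_numeral)
    then have "\<bar>gprim (\<tau> * w) / \<tau> - (w - \<tau>\<^sup>2 * w ^ 3 / 6)\<bar> \<le> \<bar>\<tau> * w\<bar> ^ 5 / \<tau>"
      using gprim_cubic_approx[of "\<tau> * w"] \<tau> by (simp add: divide_right_mono)
    also have "\<dots> = \<bar>\<tau> ^ 4 * w ^ 5\<bar>"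
      using \<tau> by (simp add: abs_mult power_mult_distrib power_abs eval_nat_numeral)
    finally show "\<bar>gprim (\<tau> * W \<tau> x) / \<tau> - (W \<tau> x - \<tau>\<^sup>2 * W \<tau> x ^ 3 / 6)\<bar> \<le> \<bar>\<tau> ^ 4 * W \<tau> x ^ 5\<bar>"
      by (simp add: w_def)
  qed
qed


section \<open>Gaussian means of quadratic and quartic forms in one and two variables\<close>

lemma continuous_on_quad: "continuous_on S (quad A)"
  unfolding quad_def[abs_def] by (intro continuous_intros)

lemma continuous_on_quart: "continuous_on S (quart K)"
  unfolding quart_def[abs_def] by (intro continuous_intros)

lemma quad_measurable [measurable]: "quad A \<in> borel_measurable borel"
  by (intro borel_measurable_continuous_onI continuous_on_quad)

lemma quart_measurable [measurable]: "quart K \<in> borel_measurable borel"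
  by (intro borel_measurable_continuous_onI continuous_on_quart)

lemma quad_bound:
  fixes A :: "'n::finite \<Rightarrow> 'n \<Rightarrow> real"
  shows "\<exists>C. 0 \<le> C \<and> (\<forall>x. \<bar>quad A x\<bar> \<le> C * norm x ^ 2)"
proof (intro exI[of _ "\<Sum>i\<in>UNIV. \<Sum>j\<in>UNIV. \<bar>A i j\<bar>"] conjI allI)
  show "0 \<le> (\<Sum>i\<in>UNIV. \<Sum>j\<in>UNIV. \<bar>A i j\<bar>)" by (intro sum_nonneg) auto
  fix x :: "real^'n"
  have "\<bar>quad A x\<bar> \<le> (\<Sum>i\<in>UNIV. \<Sum>j\<in>UNIV. \<bar>A i j * x $ i * x $ j\<bar>)"
    unfolding quad_def by (intro order_trans[OF sum_abs] sum_mono order_trans[OF sum_abs] order_refl)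
  also have "\<dots> \<le> (\<Sum>i\<in>UNIV. \<Sum>j\<in>UNIV. \<bar>A i j\<bar> * norm x * norm x)"
    unfolding abs_mult by (intro sum_mono mult_mono component_le_norm_cart) auto
  finally show "\<bar>quad A x\<bar> \<le> (\<Sum>i\<in>UNIV. \<Sum>j\<in>UNIV. \<bar>A i j\<bar>) * norm x ^ 2"
    by (simp add: sum_distrib_right power2_eq_square mult.assoc)
qed

lemma quart_bound:
  fixes K :: "'n::finite \<Rightarrow> 'n \<Rightarrow> 'n \<Rightarrow> 'n \<Rightarrow> real"
  shows "\<exists>C. 0 \<le> C \<and> (\<forall>x. \<bar>quart K x\<bar> \<le> C * norm x ^ 4)"
proof (intro exI[of _ "\<Sum>i\<in>UNIV. \<Sum>j\<in>UNIV. \<Sum>k\<in>UNIV. \<Sum>l\<in>UNIV. \<bar>K i j k l\<bar>"] conjI allI)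
  show "0 \<le> (\<Sum>i\<in>UNIV. \<Sum>j\<in>UNIV. \<Sum>k\<in>UNIV. \<Sum>l\<in>UNIV. \<bar>K i j k l\<bar>)" by (intro sum_nonneg) auto
  fix x :: "real^'n"
  have "\<bar>quart K x\<bar> \<le> (\<Sum>i\<in>UNIV. \<Sum>j\<in>UNIV. \<Sum>k\<in>UNIV. \<Sum>l\<in>UNIV. \<bar>K i j k l * x $ i * x $ j * x $ k * x $ l\<bar>)"
    unfolding quart_def by (intro order_trans[OF sum_abs] sum_mono order_trans[OF sum_abs] order_refl)
  also have "\<dots> \<le> (\<Sum>i\<in>UNIV. \<Sum>j\<in>UNIV. \<Sum>k\<in>UNIV. \<Sum>l\<in>UNIV. \<bar>K i j k l\<bar> * norm x * norm x * norm x * norm x)"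
    unfolding abs_mult by (intro sum_mono mult_mono component_le_norm_cart mult_nonneg_nonneg) auto
  finally show "\<bar>quart K x\<bar> \<le> (\<Sum>i\<in>UNIV. \<Sum>j\<in>UNIV. \<Sum>k\<in>UNIV. \<Sum>l\<in>UNIV. \<bar>K i j k l\<bar>) * norm x ^ 4"
    by (simp add: sum_distrib_right eval_nat_numeral mult.assoc)
qed

lemma norm_power_le_weight: "norm x ^ k \<le> (1 + norm x) ^ k"
  by (intro power_mono) auto

lemma pbig_quad: "pbig 0 (\<lambda>\<tau>. quad A)"
proof -
  obtain C where C: "0 \<le> C" "\<And>x. \<bar>quad A x\<bar> \<le> C * norm x ^ 2" using quad_bound[of A] by blast
  have "\<bar>quad A x\<bar> \<le> C * (1 + norm x) ^ 2" for x
    using C order_trans mult_left_mono[OF norm_power_le_weight] by metis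
  then show ?thesis by (intro pbig_poly) auto
qed

lemma pbig_quart: "pbig 0 (\<lambda>\<tau>. quart K)"
proof -
  obtain C where C: "0 \<le> C" "\<And>x. \<bar>quart K x\<bar> \<le> C * norm x ^ 4" using quart_bound[of K] by blast
  have "\<bar>quart K x\<bar> \<le> C * (1 + norm x) ^ 4" for x
    using C order_trans mult_left_mono[OF norm_power_le_weight] by metis
  then show ?thesis by (intro pbig_poly) auto
qed

lemma pbig_0_integrable:
  assumes "pbig 0 (\<lambda>\<tau>. F)"
  shows "integrable gauss_measure F"
  using pbig_integrable[OF assms] by (simp add: eventually_const_iff)

lemma quad_minus [simp]: "quad A (- x) = quad A x"
  by (simp add: quad_def)

lemma quad_scaleR: "quad A (c *\<^sub>R x) = c ^ 2 * quad A x"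
  by (simp add: quad_def sum_distrib_left power2_eq_square mult_ac)

lemma quart_scaleR: "quart K (c *\<^sub>R x) = c ^ 4 * quart K x"
  by (simp add: quart_def sum_distrib_left eval_nat_numeral mult_ac)

definition bilin :: "('n::finite \<Rightarrow> 'n \<Rightarrow> real) \<Rightarrow> real^'n \<Rightarrow> real^'n \<Rightarrow> real"
  where "bilin A x y = (\<Sum>i\<in>UNIV. \<Sum>j\<in>UNIV. A i j * x $ i * y $ j)"

lemma quad_add_diff:
  assumes "\<And>i j. A i j = A j i"
  shows "quad A (x - y) = quad A x - 2 * bilin A x y + quad A y"
    and "quad A (x + y) = quad A x + 2 * bilin A x y + quad A y"
proof -
  have s: "(\<Sum>i\<in>UNIV. \<Sum>j\<in>UNIV. A i j * y $ i * x $ j) = bilin A x y"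
    unfolding bilin_def by (subst sum.swap) (use assms in \<open>simp add: mult_ac\<close>)
  have "quad A (x - y) = quad A x - bilin A x y - (\<Sum>i\<in>UNIV. \<Sum>j\<in>UNIV. A i j * y $ i * x $ j) + quad A y"
    unfolding quad_def bilin_def by (simp add: algebra_simps sum.distrib sum_subtractf)
  then show "quad A (x - y) = quad A x - 2 * bilin A x y + quad A y" using s by simp
  have "quad A (x + y) = quad A x + bilin A x y + (\<Sum>i\<in>UNIV. \<Sum>j\<in>UNIV. A i j * y $ i * x $ j) + quad A y"
    unfolding quad_def bilin_def by (simp add: algebra_simps sum.distrib sum_subtractf)
  then show "quad A (x + y) = quad A x + 2 * bilin A x y + quad A y" using s by simp
qed

lemma bilin_squared: "bilin A x y ^ 2 = quad (\<lambda>i j. (\<Sum>k\<in>UNIV. A i k * y $ k) * (\<Sum>k\<in>UNIV. A j k * y $ k)) x"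
proof -
  define h where "h i = (\<Sum>k\<in>UNIV. A i k * y $ k)" for i
  have "bilin A x y = (\<Sum>i\<in>UNIV. x $ i * h i)"
    by (simp add: bilin_def h_def sum_distrib_left mult_ac)
  then have "bilin A x y ^ 2 = (\<Sum>i\<in>UNIV. \<Sum>j\<in>UNIV. (x $ i * h i) * (x $ j * h j))"
    by (simp only: power2_eq_square sum_product)
  then show ?thesis unfolding quad_def h_def[symmetric] by (simp add: mult_ac)
qed

text \<open>For fixed y the bilinear form is a linear function of the Gaussian vector x with
  coefficient vector A y, and its variance is the squared length of A y.\<close>

lemma gauss_bilin_squared:
  assumes "\<And>i j. A i j = A j i"
  shows "\<E> (\<lambda>x. bilin A x y ^ 2) = quad (mmul A A) y"
proof -
  have "\<E> (\<lambda>x. bilin A x y ^ 2) = (\<Sum>i\<in>UNIV. (\<Sum>k\<in>UNIV. A i k * y $ k) * (\<Sum>l\<in>UNIV. A i l * y $ l))"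
    unfolding bilin_squared gauss_quad(2) tr_def ..
  also have "\<dots> = (\<Sum>i\<in>UNIV. \<Sum>k\<in>UNIV. \<Sum>l\<in>UNIV. A i k * A i l * y $ k * y $ l)"
    by (simp add: sum_product mult_ac)
  also have "\<dots> = (\<Sum>k\<in>UNIV. \<Sum>l\<in>UNIV. \<Sum>i\<in>UNIV. A i k * A i l * y $ k * y $ l)"
    by (rule trans[OF sum.swap], rule sum.cong[OF refl], rule sum.swap)
  also have "\<dots> = quad (mmul A A) y"
    unfolding quad_def mmul_def sum_distrib_right by (intro sum.cong refl) (simp add: assms)
  finally show ?thesis .
qed

lemma gauss_add_integrable_const:
  "integrable gauss_measure F \<Longrightarrow> \<E> (\<lambda>x. c + F x) = c + \<E> F"
  using gauss_expectation_const by (subst Bochner_Integration.integral_add) auto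

text \<open>The Gaussian measure is symmetric, so only the even part of an integrand counts. This is
  how all odd orders are discarded.\<close>

lemma gauss_reflect:
  fixes F :: "'a::euclidean_space \<Rightarrow> real"
  assumes "integrable gauss_measure F"
  shows "\<E> F = \<E> (\<lambda>x. (F x + F (- x)) / 2)"
proof -
  have m: "F \<in> borel_measurable borel" using borel_measurable_integrable[OF assms] by simp
  show ?thesis
    using assms gauss_integrable_uminus[OF assms] gauss_expectation_uminus[OF m] by simp
qed

lemma bounded_linear_difference: "bounded_linear (\<lambda>p :: 'a::euclidean_space \<times> 'a. fst p - snd p)"
  by (intro bounded_linear_sub bounded_linear_fst bounded_linear_snd)

lemma quad_shift_integrable: "integrable gauss_measure (\<lambda>y. quad A (x - y))"
proof -
  obtain C where C: "0 \<le> C" "\<And>x. \<bar>quad A x\<bar> \<le> C * norm x ^ 2" using quad_bound[of A] by blast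
  have "\<bar>quad A (x - y)\<bar> \<le> (C * (1 + norm x) ^ 2) * (1 + norm y) ^ 2" for y
  proof -
    have "norm (x - y) \<le> norm x + norm y" by (rule norm_triangle_ineq4)
    also have "\<dots> \<le> (1 + norm x) * (1 + norm y)" by (simp add: algebra_simps add_increasing)
    finally have "norm (x - y) ^ 2 \<le> (1 + norm x) ^ 2 * (1 + norm y) ^ 2"
      unfolding power_mult_distrib[symmetric] by (intro power_mono) auto
    from mult_left_mono[OF this C(1)] show ?thesis using C(2)[of "x - y"] by (simp add: mult_ac)
  qed
  then show ?thesis
    by (rule gauss_integrable_poly[rotated]) (intro borel_measurable_continuous_onI continuous_on_compose2[OF continuous_on_quad] continuous_intros, auto)
qed

lemma gauss_quad_shift:
  assumes A: "\<And>i j. A i j = A j i"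
  shows "\<E> (\<lambda>y. quad A (x - y)) = quad A x + tr A"
proof -
  have "\<E> (\<lambda>y. quad A (x - y)) = \<E> (\<lambda>y. (quad A (x - y) + quad A (x - - y)) / 2)"
    by (rule gauss_reflect[OF quad_shift_integrable])
  also have "\<dots> = \<E> (\<lambda>y. quad A x + quad A y)"
    by (simp add: quad_add_diff[OF A] add_divide_distrib)
  also have "\<dots> = quad A x + tr A"
    by (simp add: gauss_add_integrable_const gauss_quad)
  finally show ?thesis .
qed

lemma pbig_pair_quad: "pbig 0 (\<lambda>\<tau> p. quad A (fst p - snd p))"
  by (rule pbig_linear[OF pbig_quad bounded_linear_difference])

lemma gauss_quad_difference:
  assumes A: "\<And>i j. A i j = A j i"
  shows "\<E> (\<lambda>p. quad A (fst p - snd p)) = 2 * tr A"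
proof -
  have "\<E> (\<lambda>p. quad A (fst p - snd p)) = \<E> (\<lambda>x. tr A + quad A x)"
    by (subst gauss_fubini) (simp_all add: pbig_0_integrable pbig_pair_quad gauss_quad_shift[OF A] add.commute)
  then show ?thesis by (simp add: gauss_add_integrable_const gauss_quad)
qed

text \<open>The third cumulant of a Gaussian quadratic form: centring cancels every term in which a
  factor closes to a separate trace.\<close>

lemma gauss_quad_shifted_cube:
  assumes H: "\<And>i j. H i j = H j i"
  shows "\<E> (\<lambda>x. (quad H x - tr H) ^ 3) = 8 * tr (mmul (mmul H H) H)"
    and "integrable gauss_measure (\<lambda>x. (quad H x - tr H) ^ 3)"
proof -
  let ?T = "tr H"
  have e: "(\<lambda>x. (quad H x - ?T) ^ 3) = (\<lambda>x. quad H x ^ 3 + ((- 3 * ?T) * (quad H x * quad H x) + (3 * ?T\<^sup>2 * quad H x + (- (?T ^ 3)))))"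
    by (simp add: fun_eq_iff power3_eq_cube power2_eq_square algebra_simps)
  have "has_bochner_integral gauss_measure (\<lambda>x. (quad H x - ?T) ^ 3)
    ((?T ^ 3 + 6 * ?T * tr (mmul H H) + 8 * tr (mmul (mmul H H) H))
      + ((- 3 * ?T) * (?T * ?T + 2 * tr (mmul H H)) + (3 * ?T\<^sup>2 * ?T + (- (?T ^ 3)))))"
    unfolding e
    by (intro has_bochner_integral_add has_bochner_integral_mult_right)
      (auto simp: has_bochner_integral_iff gauss_quad gauss_quad_quad[OF H] gauss_quad_cubed[OF H])
  then show "\<E> (\<lambda>x. (quad H x - ?T) ^ 3) = 8 * tr (mmul (mmul H H) H)"
    "integrable gauss_measure (\<lambda>x. (quad H x - tr H) ^ 3)"
    by (simp_all add: has_bochner_integral_iff power3_eq_cube power2_eq_square algebra_simps)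
qed

text \<open>The even part, to leading order, of the initial graph at m - n minus the half-step
  height at m, at the pair (m, n). That height is the Gaussian average of half the Hessian
  form.\<close>

definition cross_form :: "('n::finite \<Rightarrow> 'n \<Rightarrow> real) \<Rightarrow> (real^'n) \<times> (real^'n) \<Rightarrow> real"
  where "cross_form H p = quad H (fst p - snd p) / 2 - (quad H (fst p) + tr H) / 2"

lemma pbig_cross_form: "pbig 0 (\<lambda>\<tau>. cross_form H)"
proof -
  have "pbig 0 (\<lambda>\<tau> p. (1 / 2) * quad H (fst p - snd p) - (1 / 2) * (quad H (fst p) + tr H))"
    by (intro pbig_diff pbig_cmult pbig_add pbig_const pbig_pair_quad pbig_linear[OF pbig_quad] bounded_linear_fst)
  then show ?thesis by (simp add: cross_form_def[abs_def])
qed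

text \<open>The form equals \<open>- bilin H x y\<close> plus half the centred quadratic form a of
  y. Averaging over x first removes odd powers of the bilinear term and leaves a^3 + 3 a times its
  variance; the two parts contribute 1 and 3 times tr H^3.\<close>

lemma gauss_cross_form_cubed:
  assumes H: "\<And>i j. H i j = H j i"
  shows "\<E> (\<lambda>p. cross_form H p ^ 3) = 4 * tr (mmul (mmul H H) H)"
proof -
  let ?a = "\<lambda>y. (quad H y - tr H) / 2"
  have P: "pbig (3 * 0) (\<lambda>\<tau> p. cross_form H p ^ 3)" by (intro pbig_power pbig_cross_form)
  have int: "integrable gauss_measure (\<lambda>p. cross_form H p ^ 3)" using P by (intro pbig_0_integrable) simp
  have e: "cross_form H (x, y) = - bilin H x y + ?a y" "cross_form H (- x, y) = bilin H x y + ?a y" for x y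
  proof -
    have "- x - y = - (x + y)" by simp
    then have "quad H (- x - y) = quad H (x + y)" using quad_minus by metis
    then show "cross_form H (x, y) = - bilin H x y + ?a y" "cross_form H (- x, y) = bilin H x y + ?a y"
      by (simp_all add: cross_form_def quad_add_diff[OF H] field_simps)
  qed
  have inner: "\<E> (\<lambda>x. cross_form H (x, y) ^ 3) = ?a y ^ 3 + 3 * ?a y * quad (mmul H H) y" for y
  proof -
    have ix: "integrable gauss_measure (\<lambda>x. bilin H x y ^ 2)"
      unfolding bilin_squared by (rule gauss_quad)
    have i3: "integrable gauss_measure (\<lambda>x. cross_form H (x, y) ^ 3)"
    proof -
      obtain C K where CK: "0 \<le> C" "\<forall>\<^sub>F \<tau> in at_right 0. 0 < \<tau> \<and> \<tau> < (1::real) \<and> (\<forall>p. \<bar>cross_form H p ^ 3\<bar> \<le> C * \<tau> ^ (3 * 0) * (1 + norm p) ^ K)"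
        by (rule pbigE[OF P])
      then have b: "\<bar>cross_form H p ^ 3\<bar> \<le> C * (1 + norm p) ^ K" for p
      proof -
        \<comment> \<open>The function does not depend on \<tau> and the exponent is 0, so one
          admissible \<tau> already gives the polynomial bound.\<close>
        obtain \<tau> :: real where "\<forall>p. \<bar>cross_form H p ^ 3\<bar> \<le> C * \<tau> ^ (3 * 0) * (1 + norm p) ^ K"
          using eventually_happens'[OF trivial_limit_at_right_real CK(2)] by blast
        then have "\<bar>cross_form H p ^ 3\<bar> \<le> C * \<tau> ^ (3 * 0) * (1 + norm p) ^ K" by blast
        then show ?thesis by simp
      qed
      have "\<bar>cross_form H (x, y) ^ 3\<bar> \<le> (C * (1 + norm y) ^ K) * (1 + norm x) ^ K" for x
        using b[of "(x, y)"] mult_left_mono[OF weight_pair[of x y K] CK(1)] by (simp add: mult_ac)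
      moreover have "(\<lambda>x. cross_form H (x, y) ^ 3) \<in> borel_measurable borel"
        unfolding e bilin_def by (intro borel_measurable_continuous_onI continuous_intros)
      ultimately show ?thesis by (intro gauss_integrable_poly)
    qed
    have "\<E> (\<lambda>x. cross_form H (x, y) ^ 3) = \<E> (\<lambda>x. (cross_form H (x, y) ^ 3 + cross_form H (- x, y) ^ 3) / 2)"
      by (rule gauss_reflect[OF i3])
    also have "\<dots> = \<E> (\<lambda>x. ?a y ^ 3 + 3 * ?a y * bilin H x y ^ 2)"
    proof (intro arg_cong[where f=\<E>] ext)
      fix x
      have cube: "((- b + a) ^ 3 + (b + a) ^ 3) / 2 = a ^ 3 + 3 * a * b ^ 2" for a b :: real
        by (simp add: power3_eq_cube power2_eq_square algebra_simps)
      show "(cross_form H (x, y) ^ 3 + cross_form H (- x, y) ^ 3) / 2 = ?a y ^ 3 + 3 * ?a y * bilin H x y ^ 2"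
        unfolding e(1)[of x] e(2)[of x] by (rule cube)
    qed
    also have "\<dots> = ?a y ^ 3 + \<E> (\<lambda>x. 3 * ?a y * bilin H x y ^ 2)"
      using ix by (intro gauss_add_integrable_const integrable_mult_right)
    also have "\<dots> = ?a y ^ 3 + 3 * ?a y * quad (mmul H H) y"
      by (simp add: gauss_bilin_squared[OF H])
    finally show ?thesis .
  qed
  have sym2: "mmul H H i j = mmul H H j i" for i j
    unfolding mmul_def by (intro sum.cong refl) (simp add: H mult.commute)
  have "\<E> (\<lambda>p. cross_form H p ^ 3) = \<E> (\<lambda>y. ?a y ^ 3 + 3 * ?a y * quad (mmul H H) y)"
    by (subst gauss_fubini_swap[OF int]) (simp only: inner)
  also have "(\<lambda>y. ?a y ^ 3 + 3 * ?a y * quad (mmul H H) y)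
    = (\<lambda>y. 1 / 8 * (quad H y - tr H) ^ 3 + (3 / 2 * (quad (mmul H H) y * quad H y) + (- 3 / 2 * tr H) * quad (mmul H H) y))"
    by (simp add: fun_eq_iff power_divide field_simps)
  also have "\<E> \<dots> = 1 / 8 * (8 * tr (mmul (mmul H H) H))
      + (3 / 2 * (tr (mmul H H) * tr H + 2 * tr (mmul (mmul H H) H)) + (- 3 / 2 * tr H) * tr (mmul H H))"
    by (intro has_bochner_integral_integral_eq has_bochner_integral_add has_bochner_integral_mult_right)
      (auto simp: has_bochner_integral_iff gauss_quad gauss_quad_quad[OF H] gauss_quad_shifted_cube[OF H])
  also have "\<dots> = 4 * tr (mmul (mmul H H) H)" by (simp add: field_simps)
  finally show ?thesis .
qed

lemma coord_integrable: "integrable gauss_measure (\<lambda>p :: (real^'n::finite) \<times> (real^'n). (fst p - snd p) $ i * (fst p - snd p) $ j * (fst p - snd p) $ k * (fst p - snd p) $ l)"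
proof (rule gauss_integrable_poly)
  show "(\<lambda>p :: (real^'n) \<times> (real^'n). (fst p - snd p) $ i * (fst p - snd p) $ j * (fst p - snd p) $ k * (fst p - snd p) $ l) \<in> borel_measurable borel"
    by (intro borel_measurable_continuous_onI continuous_intros)
  fix p :: "(real^'n) \<times> (real^'n)"
  have c: "\<bar>(fst p - snd p) $ a\<bar> \<le> 2 * (1 + norm p)" for a
  proof -
    have "\<bar>(fst p - snd p) $ a\<bar> \<le> norm (fst p - snd p)" by (rule component_le_norm_cart)
    also have "\<dots> \<le> norm (fst p) + norm (snd p)" by (rule norm_triangle_ineq4)
    also have "\<dots> \<le> 2 * (1 + norm p)" using norm_fst_le[of "fst p" "snd p"] norm_snd_le[of "snd p" "fst p"] by simp
    finally show ?thesis .
  qed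
  have "\<bar>(fst p - snd p) $ i * (fst p - snd p) $ j * (fst p - snd p) $ k * (fst p - snd p) $ l\<bar>
    \<le> (2 * (1 + norm p)) * (2 * (1 + norm p)) * (2 * (1 + norm p)) * (2 * (1 + norm p))"
    unfolding abs_mult by (intro mult_mono c) auto
  also have "\<dots> = (2 * (1 + norm p)) ^ 4" by (simp only: power4_eq_xxxx)
  also have "\<dots> = 16 * (1 + norm p) ^ 4" by (simp only: power_mult_distrib) simp
  finally show "\<bar>(fst p - snd p) $ i * (fst p - snd p) $ j * (fst p - snd p) $ k * (fst p - snd p) $ l\<bar> \<le> 16 * (1 + norm p) ^ 4" .
qed

text \<open>The difference of two independent standard Gaussians is distributed like sqrt 2 times
  one of them, whence the factor 4. The proof checks this on moments by averaging the expanded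
  product over one variable and then the other.\<close>

lemma gauss_difference_moment4:
  "\<E> (\<lambda>p :: (real^'n::finite) \<times> (real^'n). (fst p - snd p) $ i * (fst p - snd p) $ j * (fst p - snd p) $ k * (fst p - snd p) $ l) = 4 * wick4 i j k l"
proof -
  note hb = gauss_moment2[where 'n='n] gauss_moment4[where 'n='n]
  have h2: "has_bochner_integral gauss_measure (\<lambda>x::real^'n. x $ a * x $ b) (kron a b)" for a b
    by (simp add: has_bochner_integral_iff hb)
  have h4: "has_bochner_integral gauss_measure (\<lambda>x::real^'n. x $ a * x $ b * x $ c * x $ d) (wick4 a b c d)" for a b c d
    by (simp add: has_bochner_integral_iff hb)
  have h0: "has_bochner_integral gauss_measure (\<lambda>x::real^'n. c) c" for c :: real
    by (simp add: has_bochner_integral_iff gauss_expectation_const)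
  let ?F = "\<lambda>x y :: real^'n. (x - y) $ i * (x - y) $ j * (x - y) $ k * (x - y) $ l"
  have inner: "\<E> (\<lambda>y. ?F x y) = x $ i * x $ j * x $ k * x $ l
      + (x $ i * x $ j * kron k l + (x $ i * x $ k * kron j l + (x $ i * x $ l * kron j k
      + (x $ j * x $ k * kron i l + (x $ j * x $ l * kron i k + (x $ k * x $ l * kron i j + wick4 i j k l))))))" for x
  proof -
    have i: "integrable gauss_measure (\<lambda>y. ?F x y)"
    proof (rule gauss_integrable_poly)
      show "(\<lambda>y. ?F x y) \<in> borel_measurable borel"
        by (intro borel_measurable_continuous_onI continuous_intros)
      fix y :: "real^'n"
      have c: "\<bar>(x - y) $ a\<bar> \<le> (1 + norm x) * (1 + norm y)" for a
      proof -
        have "\<bar>(x - y) $ a\<bar> \<le> norm (x - y)" by (rule component_le_norm_cart)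
        also have "\<dots> \<le> norm x + norm y" by (rule norm_triangle_ineq4)
        also have "\<dots> \<le> (1 + norm x) * (1 + norm y)" by (simp add: algebra_simps add_increasing)
        finally show ?thesis .
      qed
      have "\<bar>?F x y\<bar> \<le> ((1 + norm x) * (1 + norm y)) * ((1 + norm x) * (1 + norm y)) * ((1 + norm x) * (1 + norm y)) * ((1 + norm x) * (1 + norm y))"
        unfolding abs_mult by (intro mult_mono c) auto
      then show "\<bar>?F x y\<bar> \<le> (1 + norm x) ^ 4 * (1 + norm y) ^ 4"
        by (simp add: eval_nat_numeral mult_ac)
    qed
    have "\<E> (\<lambda>y. ?F x y) = \<E> (\<lambda>y. (?F x y + ?F x (- y)) / 2)"
      by (rule gauss_reflect[OF i])
    also have "(\<lambda>y. (?F x y + ?F x (- y)) / 2) = (\<lambda>y. x $ i * x $ j * x $ k * x $ l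
      + (x $ i * x $ j * (y $ k * y $ l) + (x $ i * x $ k * (y $ j * y $ l) + (x $ i * x $ l * (y $ j * y $ k)
      + (x $ j * x $ k * (y $ i * y $ l) + (x $ j * x $ l * (y $ i * y $ k) + (x $ k * x $ l * (y $ i * y $ j) + y $ i * y $ j * y $ k * y $ l)))))))"
      by (simp add: fun_eq_iff field_simps)
    also have "\<E> \<dots> = x $ i * x $ j * x $ k * x $ l
      + (x $ i * x $ j * kron k l + (x $ i * x $ k * kron j l + (x $ i * x $ l * kron j k
      + (x $ j * x $ k * kron i l + (x $ j * x $ l * kron i k + (x $ k * x $ l * kron i j + wick4 i j k l))))))"
      by (intro has_bochner_integral_integral_eq has_bochner_integral_add has_bochner_integral_mult_right h0 h2 h4)
    finally show ?thesis .
  qed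
  have "\<E> (\<lambda>p. ?F (fst p) (snd p)) = \<E> (\<lambda>x. x $ i * x $ j * x $ k * x $ l
      + (x $ i * x $ j * kron k l + (x $ i * x $ k * kron j l + (x $ i * x $ l * kron j k
      + (x $ j * x $ k * kron i l + (x $ j * x $ l * kron i k + (x $ k * x $ l * kron i j + wick4 i j k l)))))))"
    by (subst gauss_fubini[OF coord_integrable]) (simp only: fst_conv snd_conv inner)
  also have "\<dots> = wick4 i j k l
      + (kron i j * kron k l + (kron i k * kron j l + (kron i l * kron j k
      + (kron j k * kron i l + (kron j l * kron i k + (kron k l * kron i j + wick4 i j k l))))))"
    by (intro has_bochner_integral_integral_eq has_bochner_integral_add has_bochner_integral_mult_left h0 h2 h4)
  finally show ?thesis by (simp add: wick4_def)
qed

lemma gauss_quart_difference: "\<E> (\<lambda>p. quart K (fst p - snd p)) = 4 * \<E> (quart K)"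
proof -
  have a: "quart K x = (\<Sum>i\<in>UNIV. \<Sum>j\<in>UNIV. \<Sum>k\<in>UNIV. \<Sum>l\<in>UNIV. K i j k l * (x $ i * x $ j * x $ k * x $ l))" for x
    by (simp add: quart_def mult.assoc)
  have h: "has_bochner_integral gauss_measure (\<lambda>p :: (real^'a) \<times> (real^'a). K i j k l * ((fst p - snd p) $ i * (fst p - snd p) $ j * (fst p - snd p) $ k * (fst p - snd p) $ l)) (K i j k l * (4 * wick4 i j k l))" for i j k l
    by (intro has_bochner_integral_mult_right) (simp only: has_bochner_integral_iff coord_integrable gauss_difference_moment4)
  have h': "has_bochner_integral gauss_measure (\<lambda>x :: real^'a. K i j k l * (x $ i * x $ j * x $ k * x $ l)) (K i j k l * wick4 i j k l)" for i j k l
    by (intro has_bochner_integral_mult_right) (simp only: has_bochner_integral_iff gauss_moment4)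
  have 1: "\<E> (\<lambda>p. quart K (fst p - snd p)) = (\<Sum>i\<in>UNIV. \<Sum>j\<in>UNIV. \<Sum>k\<in>UNIV. \<Sum>l\<in>UNIV. K i j k l * (4 * wick4 i j k l))"
    unfolding a by (intro has_bochner_integral_integral_eq has_bochner_integral_sum h)
  have 2: "\<E> (quart K) = (\<Sum>i\<in>UNIV. \<Sum>j\<in>UNIV. \<Sum>k\<in>UNIV. \<Sum>l\<in>UNIV. K i j k l * wick4 i j k l)"
    unfolding a[abs_def] by (intro has_bochner_integral_integral_eq has_bochner_integral_sum h')
  show ?thesis unfolding 1 2 by (simp add: sum_distrib_left mult_ac)
qed

section \<open>The rescaled problem\<close>

lemma gprim_diff_bound: "\<bar>gprim a - gprim b\<bar> \<le> 4"
  using gprim_bound[of a] gprim_bound[of b] by linarith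

text \<open>Markov's inequality: \<open>B\<close> dominates the indicator of the set where the two
  functions differ, and there the integrands differ by at most 4.\<close>

lemma gprim_truncation:
  fixes \<phi> \<phi>' B :: "'a::euclidean_space \<Rightarrow> real"
  assumes m [measurable]: "\<phi> \<in> borel_measurable borel" "\<phi>' \<in> borel_measurable borel"
    and B: "integrable gauss_measure B" "\<And>n. 0 \<le> B n" "\<And>n. \<phi> n \<noteq> \<phi>' n \<Longrightarrow> 1 \<le> B n"
  shows "\<bar>\<E> (\<lambda>n. gprim (c * (\<phi> n - k))) - \<E> (\<lambda>n. gprim (c * (\<phi>' n - k)))\<bar> \<le> 4 * \<E> B"
proof -
  have "\<bar>\<E> (\<lambda>n. gprim (c * (\<phi> n - k)) - gprim (c * (\<phi>' n - k)))\<bar> \<le> \<E> (\<lambda>n. 4 * B n)"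
  proof (rule gauss_abs_expectation_le)
    fix n
    show "\<bar>gprim (c * (\<phi> n - k)) - gprim (c * (\<phi>' n - k))\<bar> \<le> 4 * B n"
      using B(2)[of n] B(3)[of n] gprim_diff_bound[of "c * (\<phi> n - k)" "c * (\<phi>' n - k)"]
      by (cases "\<phi> n = \<phi>' n") auto
  qed (use B in auto)
  moreover have "integrable gauss_measure (\<lambda>n. gprim (c * (\<phi> n - k)))" "integrable gauss_measure (\<lambda>n. gprim (c * (\<phi>' n - k)))"
    by (rule gprim_expectation_integrable, measurable)+
  ultimately show ?thesis by simp
qed

text \<open>
  With \<open>W = e + q/2\<close>, \<open>e\<close> even and \<open>q\<close> odd, the even part of \<open>W\<^sup>3\<close> is \<open>e\<^sup>3 + 3 e q\<^sup>2/4\<close>, so an odd part of order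
  \<open>\<tau>\<close> only contributes at order \<open>\<tau>\<^sup>2\<close>.
\<close>

lemma pbig_cube_expectation:
  fixes W :: "real \<Rightarrow> 'a::euclidean_space \<Rightarrow> real"
  assumes W: "pbig 0 W" and F: "pbig 0 (\<lambda>\<tau>. F)"
    and even: "pbig 2 (\<lambda>\<tau> x. (W \<tau> x + W \<tau> (- x)) / 2 - F x)"
    and odd: "pbig 1 (\<lambda>\<tau> x. W \<tau> x - W \<tau> (- x))"
  shows "(\<lambda>\<tau>. \<E> (\<lambda>x. W \<tau> x ^ 3) - \<E> (\<lambda>x. F x ^ 3)) \<in> O[at_right 0](\<lambda>\<tau>. \<tau> ^ 2)"
proof -
  define e where "e \<tau> x = (W \<tau> x + W \<tau> (- x)) / 2" for \<tau> x
  define q where "q \<tau> x = W \<tau> x - W \<tau> (- x)" for \<tau> x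
  have e: "pbig 0 e"
  proof -
    have "pbig 0 (\<lambda>\<tau> x. (1 / 2) * (W \<tau> x + W \<tau> (- x)))"
      by (intro pbig_cmult pbig_add W pbig_linear[OF W] bounded_linear_minus bounded_linear_ident)
    then show ?thesis by (simp add: e_def[abs_def])
  qed
  have d: "pbig 2 (\<lambda>\<tau> x. e \<tau> x - F x)" using even by (simp add: e_def)
  have q: "pbig 1 q" using odd by (simp add: q_def[abs_def])
  have q2: "pbig 2 (\<lambda>\<tau> x. q \<tau> x ^ 2)" using pbig_power[OF q, of 2] by simp
  have s: "pbig 0 (\<lambda>\<tau> x. e \<tau> x ^ 2 + e \<tau> x * F x + F x ^ 2)"
  proof -
    have "pbig (2 * 0) (\<lambda>\<tau> x. e \<tau> x ^ 2)" "pbig (2 * 0) (\<lambda>\<tau> x. F x ^ 2)" "pbig (0 + 0) (\<lambda>\<tau> x. e \<tau> x * F x)"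
      by (intro pbig_power pbig_mult e F)+
    then show ?thesis by (intro pbig_add) simp_all
  qed
  have "pbig 2 (\<lambda>\<tau> x. (e \<tau> x - F x) * (e \<tau> x ^ 2 + e \<tau> x * F x + F x ^ 2))"
    using pbig_mult[OF d s] by (simp only: add_0_right)
  moreover have "pbig 2 (\<lambda>\<tau> x. e \<tau> x * q \<tau> x ^ 2)" using pbig_mult[OF e q2] by (simp only: add_0)
  ultimately have "pbig 2 (\<lambda>\<tau> x. (e \<tau> x - F x) * (e \<tau> x ^ 2 + e \<tau> x * F x + F x ^ 2) + (3 / 4) * (e \<tau> x * q \<tau> x ^ 2))"
    by (intro pbig_add pbig_cmult)
  then have P: "pbig 2 (\<lambda>\<tau> x. (W \<tau> x ^ 3 + W \<tau> (- x) ^ 3) / 2 - F x ^ 3)"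
  proof (rule pbig_cong)
    fix \<tau> :: real and x :: 'a
    have cube: "(a ^ 3 + b ^ 3) / 2 - f ^ 3 = ((a + b) / 2 - f) * (((a + b) / 2) ^ 2 + (a + b) / 2 * f + f ^ 2) + (3 / 4) * ((a + b) / 2 * (a - b) ^ 2)"
      for a b f :: real
      by (simp add: power3_eq_cube power2_eq_square field_simps)
    show "(W \<tau> x ^ 3 + W \<tau> (- x) ^ 3) / 2 - F x ^ 3 = (e \<tau> x - F x) * (e \<tau> x ^ 2 + e \<tau> x * F x + F x ^ 2) + (3 / 4) * (e \<tau> x * q \<tau> x ^ 2)"
      unfolding e_def q_def by (rule cube)
  qed
  have W3: "pbig 0 (\<lambda>\<tau> x. W \<tau> x ^ 3)" using pbig_power[OF W, of 3] by simp
  have F3: "integrable gauss_measure (\<lambda>x. F x ^ 3)" using pbig_power[OF F, of 3] by (intro pbig_0_integrable) simp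
  have "\<forall>\<^sub>F \<tau> in at_right 0. \<E> (\<lambda>x. (W \<tau> x ^ 3 + W \<tau> (- x) ^ 3) / 2 - F x ^ 3)
      = \<E> (\<lambda>x. W \<tau> x ^ 3) - \<E> (\<lambda>x. F x ^ 3)"
    using pbig_integrable[OF W3]
  proof eventually_elim
    case (elim \<tau>)
    show ?case
      using elim gauss_integrable_uminus[OF elim] F3
      by (subst gauss_reflect[OF elim]) simp
  qed
  with pbig_expectation[OF P] show ?thesis
    using landau_o.big.in_cong by fast
qed

text \<open>Collects the information on the initial graph: continuity everywhere and, near the
  origin, separate bounds on its even and odd parts. The evolution equation enters through
  \<open>mcf_time_expansion\<close>, and the two expansions meet in the final theorem.\<close>

locale near_graph =
  fixes g :: "real^'n::finite \<Rightarrow> real" and H :: "'n \<Rightarrow> 'n \<Rightarrow> real"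
    and K :: "'n \<Rightarrow> 'n \<Rightarrow> 'n \<Rightarrow> 'n \<Rightarrow> real" and C :: real
  assumes g_cont: "continuous_on UNIV g"
    and H_sym: "H i j = H j i"
    and C_nonneg: "0 \<le> C"
    and g_even: "norm z \<le> 1 \<Longrightarrow> \<bar>(g z + g (- z)) / 2 - quad H z / 2 - quart K z / 24\<bar> \<le> C * norm z ^ 6"
    and g_odd: "norm z \<le> 1 \<Longrightarrow> \<bar>g z - g (- z)\<bar> \<le> C * norm z ^ 3"
    and g_bound: "norm z \<le> 1 \<Longrightarrow> \<bar>g z\<bar> \<le> C * norm z ^ 2"
begin

text \<open>
  In the variables \<open>x = \<tau> m\<close>, \<open>h = \<tau>\<^sup>2 k\<close>, \<open>gq\<close> is the initial graph and \<open>kb\<close> the graph after the half step of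
  length \<open>t = \<tau>\<^sup>2\<close>. Their truncations \<open>gt\<close> and \<open>kt\<close> have polynomial growth, and since \<open>gprim\<close> is bounded,
  truncating changes its expectations by \<open>O(\<tau>\<^sup>N)\<close> for every \<open>N\<close>. The region \<open>\<tau> |m|\<^sup>6 \<le> 1\<close> is chosen so
  that the cubic term \<open>\<tau>\<^sup>2 (1 + |m|)\<^sup>6\<close> is \<open>O(\<tau>)\<close> on it.
\<close>

definition gq :: "real \<Rightarrow> real^'n \<Rightarrow> real" where "gq \<tau> m = g (\<tau> *\<^sub>R m) / \<tau>\<^sup>2"
definition gt :: "real \<Rightarrow> real^'n \<Rightarrow> real" where "gt \<tau> m = (if \<tau> * norm m \<le> 1 then gq \<tau> m else 0)"
definition kb :: "real \<Rightarrow> real^'n \<Rightarrow> real" where "kb \<tau> m = level \<tau> (\<lambda>n. gq \<tau> (m - n))"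
definition kt :: "real \<Rightarrow> real^'n \<Rightarrow> real" where "kt \<tau> m = (if \<tau> * norm m ^ 6 \<le> 1 then kb \<tau> m else 0)"

lemma gq_continuous: "continuous_on UNIV (gq \<tau>)"
  unfolding gq_def[abs_def] divide_inverse
  by (intro continuous_intros continuous_on_compose2[OF g_cont]) auto

lemma gq_measurable [measurable]: "gq \<tau> \<in> borel_measurable borel"
  by (intro borel_measurable_continuous_onI gq_continuous)

lemma gt_measurable [measurable]: "gt \<tau> \<in> borel_measurable borel"
  unfolding gt_def[abs_def] by measurable

lemma kb_continuous: "0 < \<tau> \<Longrightarrow> continuous_on UNIV (kb \<tau>)"
  unfolding kb_def[abs_def] using level_continuous[OF gq_continuous, of \<tau> \<tau> 1] by simp

lemma kb_measurable: "0 < \<tau> \<Longrightarrow> kb \<tau> \<in> borel_measurable borel"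
  by (intro borel_measurable_continuous_onI kb_continuous)

lemma kt_measurable: "0 < \<tau> \<Longrightarrow> kt \<tau> \<in> borel_measurable borel"
  unfolding kt_def[abs_def] using kb_measurable by measurable

lemma gt_le: "0 < \<tau> \<Longrightarrow> \<bar>gt \<tau> m\<bar> \<le> C * norm m ^ 2"
proof (cases "\<tau> * norm m \<le> 1")
  assume \<tau>: "0 < \<tau>"
  case True
  then have "\<bar>g (\<tau> *\<^sub>R m)\<bar> \<le> C * norm (\<tau> *\<^sub>R m) ^ 2" using \<tau> by (intro g_bound) simp
  then have "\<bar>g (\<tau> *\<^sub>R m)\<bar> / \<tau>\<^sup>2 \<le> C * norm (\<tau> *\<^sub>R m) ^ 2 / \<tau>\<^sup>2" by (intro divide_right_mono) auto
  also have "\<dots> = C * norm m ^ 2" using \<tau> by (simp add: power_mult_distrib)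
  finally show ?thesis using True by (simp add: gt_def gq_def)
qed (simp add: gt_def C_nonneg)

lemma pbig_gt: "pbig 0 gt"
proof (rule pbigI)
  show "\<forall>\<^sub>F \<tau> in at_right 0. \<forall>x. \<bar>gt \<tau> x\<bar> \<le> C * \<tau> ^ 0 * (1 + norm x) ^ 2"
    using eventually_at_right_unit
    by eventually_elim (use gt_le C_nonneg mult_left_mono[OF norm_power_le_weight] order_trans in \<open>fastforce\<close>)
qed (rule gt_measurable)

text \<open>Where \<tau> |m| <= 1 this is the local expansion rescaled. Elsewhere \<open>gt\<close>
  is 0 and the polynomial terms are themselves small: the missing powers of \<tau> are supplied by
  powers of \<tau> |m| >= 1.\<close>

lemma pbig_gt_even: "pbig 4 (\<lambda>\<tau> m. (gt \<tau> m + gt \<tau> (- m)) / 2 - quad H m / 2 - \<tau> ^ 2 * quart K m / 24)"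
proof -
  obtain A where A: "0 \<le> A" "\<And>x. \<bar>quad H x\<bar> \<le> A * norm x ^ 2" using quad_bound[of H] by blast
  obtain B where B: "0 \<le> B" "\<And>x. \<bar>quart K x\<bar> \<le> B * norm x ^ 4" using quart_bound[of K] by blast
  show ?thesis
  proof (rule pbigI)
    show "\<forall>\<^sub>F \<tau> in at_right 0. \<forall>m. \<bar>(gt \<tau> m + gt \<tau> (- m)) / 2 - quad H m / 2 - \<tau> ^ 2 * quart K m / 24\<bar> \<le> (A + B + C) * \<tau> ^ 4 * (1 + norm m) ^ 6"
      using eventually_at_right_unit
    proof (eventually_elim, intro allI)
      fix \<tau> :: real and m :: "real^'n" assume \<tau>: "0 < \<tau> \<and> \<tau> < 1"
      have "\<bar>(gt \<tau> m + gt \<tau> (- m)) / 2 - quad H m / 2 - \<tau> ^ 2 * quart K m / 24\<bar> \<le> (A + B + C) * (\<tau> ^ 4 * norm m ^ 6)"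
      proof (cases "\<tau> * norm m \<le> 1")
        case True
        have "(gt \<tau> m + gt \<tau> (- m)) / 2 - quad H m / 2 - \<tau> ^ 2 * quart K m / 24
          = ((g (\<tau> *\<^sub>R m) + g (- (\<tau> *\<^sub>R m))) / 2 - quad H (\<tau> *\<^sub>R m) / 2 - quart K (\<tau> *\<^sub>R m) / 24) / \<tau>\<^sup>2"
          using True \<tau> unfolding gt_def gq_def quad_scaleR quart_scaleR by (simp add: field_simps eval_nat_numeral)
        also have "\<bar>\<dots>\<bar> \<le> C * norm (\<tau> *\<^sub>R m) ^ 6 / \<tau>\<^sup>2"
          unfolding abs_divide using g_even[of "\<tau> *\<^sub>R m"] True \<tau> by (simp add: divide_right_mono)
        also have "\<dots> = C * (\<tau> ^ 4 * norm m ^ 6)" using \<tau> by (simp add: power_mult_distrib eval_nat_numeral)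
        also have "\<dots> \<le> (A + B + C) * (\<tau> ^ 4 * norm m ^ 6)" using A(1) B(1) \<tau> by (intro mult_right_mono) auto
        finally show ?thesis .
      next
        case False
        then have one: "1 \<le> (\<tau> * norm m) ^ 4" "1 \<le> (\<tau> * norm m) ^ 2" by (auto intro!: one_le_power)
        have "norm m ^ 2 * 1 \<le> norm m ^ 2 * (\<tau> * norm m) ^ 4" using one by (intro mult_left_mono) auto
        then have 1: "norm m ^ 2 \<le> \<tau> ^ 4 * norm m ^ 6" by (simp add: power_mult_distrib eval_nat_numeral mult_ac)
        have "\<tau> ^ 2 * norm m ^ 4 * 1 \<le> \<tau> ^ 2 * norm m ^ 4 * (\<tau> * norm m) ^ 2" using one by (intro mult_left_mono) auto
        then have 2: "\<tau> ^ 2 * norm m ^ 4 \<le> \<tau> ^ 4 * norm m ^ 6" by (simp add: power_mult_distrib eval_nat_numeral mult_ac)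
        have "\<bar>quad H m\<bar> \<le> A * (\<tau> ^ 4 * norm m ^ 6)" using A(2)[of m] mult_left_mono[OF 1 A(1)] by linarith
        moreover have "\<bar>\<tau> ^ 2 * quart K m\<bar> \<le> B * (\<tau> ^ 4 * norm m ^ 6)"
        proof -
          have "\<bar>\<tau> ^ 2 * quart K m\<bar> \<le> \<tau> ^ 2 * (B * norm m ^ 4)"
            unfolding abs_mult using B(2)[of m] by (auto intro: mult_left_mono)
          also have "\<dots> \<le> B * (\<tau> ^ 4 * norm m ^ 6)" using mult_left_mono[OF 2 B(1)] by (simp add: mult_ac)
          finally show ?thesis .
        qed
        moreover have "(gt \<tau> m + gt \<tau> (- m)) / 2 - quad H m / 2 - \<tau> ^ 2 * quart K m / 24 = - (quad H m / 2) - \<tau> ^ 2 * quart K m / 24"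
          using False by (simp add: gt_def)
        moreover have "0 \<le> C * (\<tau> ^ 4 * norm m ^ 6)" using C_nonneg \<tau> by simp
        ultimately show ?thesis unfolding distrib_right by (simp only:)
      qed
      also have "(A + B + C) * (\<tau> ^ 4 * norm m ^ 6) \<le> (A + B + C) * (\<tau> ^ 4 * (1 + norm m) ^ 6)"
        using A(1) B(1) C_nonneg \<tau> by (intro mult_left_mono norm_power_le_weight) auto
      finally show "\<bar>(gt \<tau> m + gt \<tau> (- m)) / 2 - quad H m / 2 - \<tau> ^ 2 * quart K m / 24\<bar> \<le> (A + B + C) * \<tau> ^ 4 * (1 + norm m) ^ 6"
        by (simp add: mult.assoc)
    qed
  qed measurable
qed

lemma pbig_gt_odd: "pbig 1 (\<lambda>\<tau> m. gt \<tau> m - gt \<tau> (- m))"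
proof (rule pbigI)
  show "\<forall>\<^sub>F \<tau> in at_right 0. \<forall>m. \<bar>gt \<tau> m - gt \<tau> (- m)\<bar> \<le> C * \<tau> ^ 1 * (1 + norm m) ^ 3"
    using eventually_at_right_unit
  proof (eventually_elim, intro allI)
    fix \<tau> :: real and m :: "real^'n" assume \<tau>: "0 < \<tau> \<and> \<tau> < 1"
    have "\<bar>gt \<tau> m - gt \<tau> (- m)\<bar> \<le> C * \<tau> * norm m ^ 3"
    proof (cases "\<tau> * norm m \<le> 1")
      case True
      then have "\<bar>g (\<tau> *\<^sub>R m) - g (- (\<tau> *\<^sub>R m))\<bar> \<le> C * norm (\<tau> *\<^sub>R m) ^ 3" using \<tau> by (intro g_odd) simp
      then have "\<bar>g (\<tau> *\<^sub>R m) - g (- (\<tau> *\<^sub>R m))\<bar> / \<tau>\<^sup>2 \<le> C * norm (\<tau> *\<^sub>R m) ^ 3 / \<tau>\<^sup>2" by (intro divide_right_mono) auto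
      moreover have "gt \<tau> m - gt \<tau> (- m) = (g (\<tau> *\<^sub>R m) - g (- (\<tau> *\<^sub>R m))) / \<tau>\<^sup>2"
        using True by (simp add: gt_def gq_def diff_divide_distrib)
      ultimately show ?thesis using \<tau> by (simp add: power_mult_distrib eval_nat_numeral mult_ac)
    qed (use \<tau> C_nonneg in \<open>simp add: gt_def\<close>)
    also have "\<dots> \<le> C * \<tau> * (1 + norm m) ^ 3"
      using \<tau> C_nonneg by (intro mult_left_mono norm_power_le_weight) auto
    finally show "\<bar>gt \<tau> m - gt \<tau> (- m)\<bar> \<le> C * \<tau> ^ 1 * (1 + norm m) ^ 3" by simp
  qed
qed measurable

definition mom :: "nat \<Rightarrow> real" where "mom k = \<E> (\<lambda>x::real^'n. (1 + norm x) ^ k)"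

lemma mom_nonneg: "0 \<le> mom k"
  unfolding mom_def by (intro Bochner_Integration.integral_nonneg) auto

lemma weight_difference: "norm (x - y) ^ k \<le> (1 + norm x) ^ k * (1 + norm y) ^ k" for x y :: "real^'n"
proof -
  have "norm (x - y) \<le> norm x + norm y" by (rule norm_triangle_ineq4)
  also have "\<dots> \<le> (1 + norm x) * (1 + norm y)" by (simp add: algebra_simps add_increasing)
  finally show ?thesis unfolding power_mult_distrib[symmetric] by (intro power_mono) auto
qed

lemma shift_measurable: "F \<in> borel_measurable borel \<Longrightarrow> (\<lambda>n. F (m - n)) \<in> borel_measurable borel"
  for F :: "real^'n \<Rightarrow> real" by (rule measurable_compose[of "\<lambda>n. m - n" borel borel F]) auto

lemma gq_shift_measurable: "(\<lambda>n. gq \<tau> (m - n)) \<in> borel_measurable borel"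
  and gt_shift_measurable: "(\<lambda>n. gt \<tau> (m - n)) \<in> borel_measurable borel"
  by (rule shift_measurable, simp)+

text \<open>Leaving the truncation region forces (\<tau> |m - n|)^N >= 1. The exponent
  \<open>N\<close> is kept free: \<open>level_estimate\<close> takes 6, the remainder bound
  \<open>pbig_level\<close> takes 5.\<close>

lemma truncation_shift:
  assumes \<tau>: "0 < \<tau>"
  shows "\<bar>\<E> (\<lambda>n. gprim (\<tau> * (gq \<tau> (m - n) - k))) - \<E> (\<lambda>n. gprim (\<tau> * (gt \<tau> (m - n) - k)))\<bar>
    \<le> 4 * (\<tau> ^ N * (1 + norm m) ^ N * mom N)"
proof -
  have "\<bar>\<E> (\<lambda>n. gprim (\<tau> * (gq \<tau> (m - n) - k))) - \<E> (\<lambda>n. gprim (\<tau> * (gt \<tau> (m - n) - k)))\<bar>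
    \<le> 4 * \<E> (\<lambda>n::real^'n. \<tau> ^ N * (1 + norm m) ^ N * (1 + norm n) ^ N)"
  proof (rule gprim_truncation)
    fix n assume "gq \<tau> (m - n) \<noteq> gt \<tau> (m - n)"
    then have "1 \<le> (\<tau> * norm (m - n)) ^ N" by (intro one_le_power) (auto simp: gt_def split: if_splits)
    also have "\<dots> \<le> \<tau> ^ N * ((1 + norm m) ^ N * (1 + norm n) ^ N)"
      unfolding power_mult_distrib using \<tau> by (intro mult_left_mono weight_difference) auto
    finally show "1 \<le> \<tau> ^ N * (1 + norm m) ^ N * (1 + norm n) ^ N" by (simp add: mult.assoc)
  qed (use \<tau> in \<open>auto simp: gauss_integrable_weight gq_shift_measurable gt_shift_measurable\<close>)
  then show ?thesis by (simp add: mom_def)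
qed

lemma gt_shift_le: "0 < \<tau> \<Longrightarrow> \<bar>gt \<tau> (m - n)\<bar> \<le> C * (1 + norm m) ^ 2 * (1 + norm n) ^ 2"
  using order_trans[OF gt_le mult_left_mono[OF weight_difference C_nonneg]] by (simp add: mult.assoc)

lemma gt_shift_integrable: "0 < \<tau> \<Longrightarrow> integrable gauss_measure (\<lambda>n. gt \<tau> (m - n))"
  by (rule gauss_integrable_poly[OF gt_shift_measurable gt_shift_le])

text \<open>Linearises \<open>gprim\<close>. The height \<open>k\<close> is an arbitrary trial value
  of quadratic growth, since \<open>kb_apriori\<close> inserts barrier heights. The cubic error is
  \<tau>^3 D^6 before division by \<tau>, and on the stated region one factor \<tau> absorbs
  D^6.\<close>

lemma level_estimate:
  assumes \<tau>: "0 < \<tau>" "\<tau> < 1" and good: "\<tau> * norm m ^ 6 \<le> 1" and A: "0 \<le> A" "\<bar>k\<bar> \<le> A * (1 + norm m) ^ 2"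
  shows "\<bar>\<E> (\<lambda>n. gprim (\<tau> * (gq \<tau> (m - n) - k))) / \<tau> - (\<E> (\<lambda>n. gt \<tau> (m - n)) - k)\<bar>
    \<le> ((C + A) ^ 3 + 4) * mom 6 * 128 * \<tau>"
proof -
  define D where "D = 1 + norm m"
  have D: "1 \<le> D" by (simp add: D_def)
  have i: "integrable gauss_measure (\<lambda>n. gt \<tau> (m - n))" by (rule gt_shift_integrable[OF \<tau>(1)])
  have ig: "integrable gauss_measure (\<lambda>n. gprim (\<tau> * (gt \<tau> (m - n) - k)))"
    using gt_shift_measurable[of \<tau> m] by (intro gprim_expectation_integrable) measurable
  have "\<bar>\<E> (\<lambda>n. gprim (\<tau> * (gt \<tau> (m - n) - k)) - \<tau> * (gt \<tau> (m - n) - k))\<bar>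
    \<le> \<E> (\<lambda>n::real^'n. \<tau> ^ 3 * (C + A) ^ 3 * D ^ 6 * (1 + norm n) ^ 6)"
  proof (rule gauss_abs_expectation_le)
    fix n :: "real^'n"
    have "\<bar>gt \<tau> (m - n) - k\<bar> \<le> C * D ^ 2 * (1 + norm n) ^ 2 + A * D ^ 2"
      using gt_shift_le[OF \<tau>(1), of m n] A(2) by (simp add: D_def)
    also have "\<dots> \<le> C * D ^ 2 * (1 + norm n) ^ 2 + A * D ^ 2 * (1 + norm n) ^ 2"
    proof -
      have "1 \<le> (1 + norm n) ^ 2" by (rule one_le_power) simp
      then have "A * D ^ 2 * 1 \<le> A * D ^ 2 * (1 + norm n) ^ 2" using A(1) by (intro mult_left_mono) auto
      then show ?thesis by simp
    qed
    finally have w: "\<bar>gt \<tau> (m - n) - k\<bar> \<le> (C + A) * D ^ 2 * (1 + norm n) ^ 2" by (simp add: algebra_simps)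
    have "\<bar>gprim (\<tau> * (gt \<tau> (m - n) - k)) - \<tau> * (gt \<tau> (m - n) - k)\<bar> \<le> \<bar>\<tau> * (gt \<tau> (m - n) - k)\<bar> ^ 3"
      by (rule gprim_linear_approx)
    also have "\<dots> = \<tau> ^ 3 * \<bar>gt \<tau> (m - n) - k\<bar> ^ 3" using \<tau> by (simp add: abs_mult power_mult_distrib)
    also have "\<dots> \<le> \<tau> ^ 3 * ((C + A) * D ^ 2 * (1 + norm n) ^ 2) ^ 3"
      using \<tau> w by (intro mult_left_mono power_mono) auto
    also have "\<dots> = \<tau> ^ 3 * (C + A) ^ 3 * D ^ 6 * (1 + norm n) ^ 6"
      by (simp add: power_mult_distrib power_mult[symmetric] mult_ac)
    finally show "\<bar>gprim (\<tau> * (gt \<tau> (m - n) - k)) - \<tau> * (gt \<tau> (m - n) - k)\<bar> \<le> \<tau> ^ 3 * (C + A) ^ 3 * D ^ 6 * (1 + norm n) ^ 6" .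
  next
    show "(\<lambda>n. gprim (\<tau> * (gt \<tau> (m - n) - k)) - \<tau> * (gt \<tau> (m - n) - k)) \<in> borel_measurable borel"
      using gt_shift_measurable[of \<tau> m] by measurable
  qed (simp add: gauss_integrable_weight)
  also have "\<E> (\<lambda>n. gprim (\<tau> * (gt \<tau> (m - n) - k)) - \<tau> * (gt \<tau> (m - n) - k))
    = \<E> (\<lambda>n. gprim (\<tau> * (gt \<tau> (m - n) - k))) - \<tau> * (\<E> (\<lambda>n. gt \<tau> (m - n)) - k)"
    using i ig by (simp add: gauss_expectation_const)
  also have "\<E> (\<lambda>n::real^'n. \<tau> ^ 3 * (C + A) ^ 3 * D ^ 6 * (1 + norm n) ^ 6) = \<tau> ^ 3 * (C + A) ^ 3 * D ^ 6 * mom 6"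
    by (simp add: mom_def)
  finally have 1: "\<bar>\<E> (\<lambda>n. gprim (\<tau> * (gt \<tau> (m - n) - k))) - \<tau> * (\<E> (\<lambda>n. gt \<tau> (m - n)) - k)\<bar>
    \<le> \<tau> ^ 3 * (C + A) ^ 3 * D ^ 6 * mom 6" .
  have "\<tau> ^ 6 * D ^ 6 * mom 6 \<le> \<tau> ^ 3 * D ^ 6 * mom 6"
    using \<tau> D mom_nonneg by (intro mult_right_mono power_decreasing) auto
  then have 2: "\<bar>\<E> (\<lambda>n. gprim (\<tau> * (gq \<tau> (m - n) - k))) - \<E> (\<lambda>n. gprim (\<tau> * (gt \<tau> (m - n) - k)))\<bar> \<le> 4 * (\<tau> ^ 3 * D ^ 6 * mom 6)"
    using truncation_shift[OF \<tau>(1), of m k 6] by (simp add: D_def)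
  \<comment> \<open>The constant is 64 + 64, from (1 + a)^6 <= 64 (1 + a^6) with \<tau> <= 1 and
    \<tau> a^6 <= 1.\<close>
  have D6: "\<tau> * D ^ 6 \<le> 128"
  proof -
    have "\<tau> * D ^ 6 \<le> \<tau> * (64 * (1 + norm m ^ 6))"
      using \<tau> one_plus_power_le[of "norm m" 6] by (intro mult_left_mono) (auto simp: D_def)
    also have "\<dots> = 64 * \<tau> + 64 * (\<tau> * norm m ^ 6)" by (simp add: algebra_simps)
    also have "\<dots> \<le> 128" using \<tau> good by simp
    finally show ?thesis .
  qed
  define Y where "Y = \<E> (\<lambda>n. gprim (\<tau> * (gq \<tau> (m - n) - k)))"
  define e where "e = \<E> (\<lambda>n. gt \<tau> (m - n)) - k"
  have "\<bar>Y - \<tau> * e\<bar> \<le> ((C + A) ^ 3 + 4) * mom 6 * (\<tau> ^ 3 * D ^ 6)"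
    using 1 2 unfolding Y_def e_def by (simp add: algebra_simps)
  also have "\<dots> = \<tau> * (((C + A) ^ 3 + 4) * mom 6 * \<tau> * (\<tau> * D ^ 6))"
    by (simp add: power3_eq_cube)
  also have "\<dots> \<le> \<tau> * (((C + A) ^ 3 + 4) * mom 6 * \<tau> * 128)"
    using \<tau> D6 C_nonneg A(1) mom_nonneg by (intro mult_left_mono) auto
  finally have "\<bar>Y - \<tau> * e\<bar> / \<tau> \<le> ((C + A) ^ 3 + 4) * mom 6 * \<tau> * 128"
    using \<tau> by (simp add: divide_le_eq mult.commute[of \<tau>])
  moreover have "Y / \<tau> - e = (Y - \<tau> * e) / \<tau>" using \<tau> by (simp add: field_simps)
  ultimately show ?thesis using \<tau> by (simp add: Y_def e_def mult_ac)
qed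

text \<open>A barrier argument with D = (1 + |m|)^2. Since \<open>A\<close> exceeds the constant in
  the mean of \<open>gt\<close> by 1, the linearised expectation at the heights A D and -A D has
  modulus at least D >= 1 and opposite signs. The error is below 1 for small \<tau>, so the level
  lies between.\<close>

lemma kb_apriori: "\<exists>A\<ge>0. \<forall>\<^sub>F \<tau> in at_right 0. \<forall>m. \<tau> * norm m ^ 6 \<le> 1 \<longrightarrow> \<bar>kb \<tau> m\<bar> \<le> A * (1 + norm m) ^ 2"
proof -
  define A where "A = C * mom 2 + 1"
  have A: "0 \<le> A" using C_nonneg mom_nonneg by (simp add: A_def)
  define c where "c = ((C + A) ^ 3 + 4) * mom 6 * 128 + 1"
  have c: "0 < c" using C_nonneg A mom_nonneg by (simp add: c_def add_nonneg_pos)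
  have ev: "\<forall>\<^sub>F \<tau> in at_right (0::real). \<tau> < 1 / c"
    unfolding eventually_at_right_field using c by (intro exI[of _ "1 / c"]) auto
  have "\<forall>\<^sub>F \<tau> in at_right 0. \<forall>m. \<tau> * norm m ^ 6 \<le> 1 \<longrightarrow> \<bar>kb \<tau> m\<bar> \<le> A * (1 + norm m) ^ 2"
    using eventually_at_right_unit ev
  proof (eventually_elim, intro allI impI)
    fix \<tau> :: real and m :: "real^'n"
    assume \<tau>: "0 < \<tau> \<and> \<tau> < 1" and small: "\<tau> < 1 / c" and good: "\<tau> * norm m ^ 6 \<le> 1"
    define D where "D = (1 + norm m) ^ 2"
    have D: "1 \<le> D" unfolding D_def by (rule one_le_power) simp
    have m: "(\<lambda>n. gq \<tau> (m - n)) \<in> borel_measurable borel" by (rule gq_shift_measurable)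
    have "((C + A) ^ 3 + 4) * mom 6 * 128 * \<tau> \<le> c * \<tau>" using \<tau> by (simp add: c_def distrib_right)
    also have "\<dots> < 1" using small c by (simp add: field_simps)
    finally have e1: "((C + A) ^ 3 + 4) * mom 6 * 128 * \<tau> < 1" .
    have "\<bar>\<E> (\<lambda>n. gt \<tau> (m - n))\<bar> \<le> \<E> (\<lambda>n::real^'n. C * (1 + norm m) ^ 2 * (1 + norm n) ^ 2)"
      by (rule gauss_abs_expectation_le) (use \<tau> gt_shift_le in \<open>auto simp: gauss_integrable_weight gt_shift_measurable\<close>)
    then have "\<bar>\<E> (\<lambda>n. gt \<tau> (m - n))\<bar> \<le> C * mom 2 * D" by (simp add: mom_def D_def mult_ac)
    then have eg: "\<bar>\<E> (\<lambda>n. gt \<tau> (m - n))\<bar> \<le> A * D - D" by (simp add: A_def algebra_simps)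
    have est: "\<bar>\<E> (\<lambda>n. gprim (\<tau> * (gq \<tau> (m - n) - k))) / \<tau> - (\<E> (\<lambda>n. gt \<tau> (m - n)) - k)\<bar> < 1"
      if "\<bar>k\<bar> \<le> A * D" for k
      using level_estimate[of \<tau> m A k] \<tau> good A that e1 by (simp add: D_def)
    have "\<E> (\<lambda>n. gprim (\<tau> * (gq \<tau> (m - n) - A * D))) / \<tau> < 0"
      using est[of "A * D"] eg A D by (auto simp: abs_mult)
    then have "kb \<tau> m < A * D"
      unfolding kb_def level_greater_iff(2)[OF m conjunct1[OF \<tau>]] using \<tau> by (simp add: divide_less_0_iff)
    moreover have "0 < \<E> (\<lambda>n. gprim (\<tau> * (gq \<tau> (m - n) - (- (A * D))))) / \<tau>"
      using est[of "- (A * D)"] eg A D by (auto simp: abs_mult)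
    then have "- (A * D) < kb \<tau> m"
      unfolding kb_def level_greater_iff(1)[OF m conjunct1[OF \<tau>]] using \<tau> by (simp add: zero_less_divide_iff)
    ultimately show "\<bar>kb \<tau> m\<bar> \<le> A * (1 + norm m) ^ 2" by (simp add: D_def)
  qed
  with A show ?thesis by blast
qed

lemma pbig_kt: "pbig 0 kt"
proof -
  obtain A where A: "0 \<le> A" "\<forall>\<^sub>F \<tau> in at_right 0. \<forall>m. \<tau> * norm m ^ 6 \<le> 1 \<longrightarrow> \<bar>kb \<tau> m\<bar> \<le> A * (1 + norm m) ^ 2"
    using kb_apriori by blast
  show ?thesis
  proof (rule pbigI[OF kt_measurable])
    show "\<forall>\<^sub>F \<tau> in at_right 0. \<forall>m. \<bar>kt \<tau> m\<bar> \<le> A * \<tau> ^ 0 * (1 + norm m) ^ 2"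
      using A(2) by eventually_elim (use A(1) in \<open>auto simp: kt_def\<close>)
  qed
qed


section \<open>Expansion of the half-step graph\<close>

definition Wt :: "real \<Rightarrow> (real^'n) \<times> (real^'n) \<Rightarrow> real"
  where "Wt \<tau> p = gt \<tau> (fst p - snd p) - kt \<tau> (fst p)"

lemma pbig_gt_difference: "pbig 0 (\<lambda>\<tau> p. gt \<tau> (fst p - snd p))"
  by (rule pbig_linear[OF pbig_gt bounded_linear_difference])

lemma pbig_Wt: "pbig 0 Wt"
proof -
  have "pbig 0 (\<lambda>\<tau> p. gt \<tau> (fst p - snd p) - kt \<tau> (fst p))"
    by (intro pbig_diff pbig_gt_difference pbig_linear[OF pbig_kt] bounded_linear_fst)
  then show ?thesis by (simp add: Wt_def[abs_def])
qed

lemma pbig_Wt_cube: "pbig 0 (\<lambda>\<tau> p. Wt \<tau> p ^ 3)"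
  using pbig_power[OF pbig_Wt, of 3] by simp

text \<open>Without truncation the expectation is exactly 0 by the choice of the level. On the
  region \<tau> |m|^6 <= 1 only the truncation error of \<open>gt\<close> remains; off it the
  integrand is bounded and (\<tau> |m|^6)^5 >= 1 supplies \<tau>^5, at the price of the weight
  exponent 30. Dividing by \<tau> leaves order 4.\<close>

lemma pbig_level:
  "pbig 4 (\<lambda>\<tau> m. \<E> (\<lambda>n. gprim (\<tau> * Wt \<tau> (m, n)) / \<tau>))"
proof (rule pbigI)
  show "(\<lambda>m. \<E> (\<lambda>n. gprim (\<tau> * Wt \<tau> (m, n)) / \<tau>)) \<in> borel_measurable borel" if "0 < \<tau>" for \<tau>
  proof (rule borel_measurable_partial_expectation[of "\<lambda>p. gprim (\<tau> * Wt \<tau> p) / \<tau>"])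
    show "(\<lambda>p. gprim (\<tau> * Wt \<tau> p) / \<tau>) \<in> borel_measurable borel"
      using pbig_measurable[OF pbig_Wt that] by measurable
  qed
  show "\<forall>\<^sub>F \<tau> in at_right 0. \<forall>m. \<bar>\<E> (\<lambda>n. gprim (\<tau> * Wt \<tau> (m, n)) / \<tau>)\<bar> \<le> (4 * mom 5 + 2) * \<tau> ^ 4 * (1 + norm m) ^ 30"
    using eventually_at_right_unit
  proof (eventually_elim, intro allI)
    fix \<tau> :: real and m :: "real^'n" assume \<tau>: "0 < \<tau> \<and> \<tau> < 1"
    define D where "D = 1 + norm m"
    have D: "1 \<le> D" by (simp add: D_def)
    define Y where "Y = \<E> (\<lambda>n. gprim (\<tau> * Wt \<tau> (m, n)))"
    have "\<bar>Y\<bar> \<le> (4 * mom 5 + 2) * \<tau> ^ 5 * D ^ 30"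
    proof (cases "\<tau> * norm m ^ 6 \<le> 1")
      case True
      have z: "\<E> (\<lambda>n. gprim (\<tau> * (gq \<tau> (m - n) - kb \<tau> m))) = 0"
        unfolding kb_def using \<tau> by (intro gprim_expectation_level gq_shift_measurable) simp
      have "Y = \<E> (\<lambda>n. gprim (\<tau> * (gt \<tau> (m - n) - kb \<tau> m)))"
        using True by (simp add: Y_def Wt_def kt_def)
      then have "\<bar>Y\<bar> \<le> 4 * (\<tau> ^ 5 * D ^ 5 * mom 5)"
        using truncation_shift[of \<tau> m "kb \<tau> m" 5] z \<tau> by (simp add: D_def)
      also have "\<dots> = (4 * mom 5) * \<tau> ^ 5 * D ^ 5" by simp
      also have "\<dots> \<le> (4 * mom 5 + 2) * \<tau> ^ 5 * D ^ 5"
        using \<tau> D by (intro mult_right_mono) auto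
      also have "\<dots> \<le> (4 * mom 5 + 2) * \<tau> ^ 5 * D ^ 30"
        using \<tau> D mom_nonneg[of 5] by (intro mult_left_mono power_increasing) auto
      finally show ?thesis .
    next
      case False
      have "\<bar>Y\<bar> \<le> \<E> (\<lambda>n::real^'n. 2)"
        unfolding Y_def using \<tau> pbig_measurable[OF pbig_Wt, of \<tau>]
        by (intro gauss_abs_expectation_le) (auto simp: gprim_bound intro!: pair_section_measurable[of "\<lambda>p. gprim (\<tau> * Wt \<tau> p)"])
      also have "\<dots> = 2 * 1" by (simp add: gauss_expectation_const)
      also have "\<dots> \<le> 2 * (\<tau> * norm m ^ 6) ^ 5"
        using False by (intro mult_left_mono one_le_power) auto
      also have "\<dots> = 2 * \<tau> ^ 5 * norm m ^ 30" by (simp add: power_mult_distrib power_mult[symmetric])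
      also have "\<dots> \<le> (4 * mom 5 + 2) * \<tau> ^ 5 * D ^ 30"
        using \<tau> D mom_nonneg[of 5] by (intro mult_mono) (auto simp: D_def intro: norm_power_le_weight)
      finally show ?thesis .
    qed
    then have "\<bar>Y\<bar> / \<tau> \<le> (4 * mom 5 + 2) * \<tau> ^ 5 * D ^ 30 / \<tau>" using \<tau> by (intro divide_right_mono) auto
    also have "\<dots> = (4 * mom 5 + 2) * \<tau> ^ 4 * D ^ 30" using \<tau> by (simp add: eval_nat_numeral)
    finally show "\<bar>\<E> (\<lambda>n. gprim (\<tau> * Wt \<tau> (m, n)) / \<tau>)\<bar> \<le> (4 * mom 5 + 2) * \<tau> ^ 4 * (1 + norm m) ^ 30"
      using \<tau> by (simp add: Y_def D_def)
  qed
qed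

lemma gt_partial_integrable: "\<forall>\<^sub>F \<tau> in at_right 0. \<forall>m. integrable gauss_measure (\<lambda>n. gt \<tau> (m - n))"
  using pbig_partial(2)[OF pbig_gt_difference] by simp

lemma gt_partial_measurable: "(\<lambda>m. \<E> (\<lambda>n. gt \<tau> (m - n))) \<in> borel_measurable borel"
proof -
  have "(\<lambda>p :: (real^'n) \<times> (real^'n). gt \<tau> (fst p - snd p)) \<in> borel_measurable borel"
    by (rule measurable_compose[of "\<lambda>p. fst p - snd p" borel borel "gt \<tau>"])
      (auto intro!: borel_measurable_continuous_onI continuous_intros)
  from borel_measurable_partial_expectation[OF this] show ?thesis by simp
qed

lemma Wt_cube_partial_measurable:
  "0 < \<tau> \<Longrightarrow> (\<lambda>m. \<E> (\<lambda>n. Wt \<tau> (m, n) ^ 3)) \<in> borel_measurable borel"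
  by (rule borel_measurable_partial_expectation[OF pbig_measurable[OF pbig_Wt_cube]])

text \<open>The level equation, expanded by \<open>pbig_gprim\<close> and solved for the height.
  \<open>kt\<close> still occurs on the right inside \<open>Wt\<close>, but only with a factor
  \<tau>^2, so knowing it there to lower order suffices.\<close>

lemma kt_equation:
  "pbig 4 (\<lambda>\<tau> m. kt \<tau> m - (\<E> (\<lambda>n. gt \<tau> (m - n)) - \<tau> ^ 2 / 6 * \<E> (\<lambda>n. Wt \<tau> (m, n) ^ 3)))"
proof (rule pbig_cong_eventually[OF pbig_diff[OF pbig_partial(1)[OF pbig_gprim[OF pbig_Wt]] pbig_level]])
  show "(\<lambda>m. kt \<tau> m - (\<E> (\<lambda>n. gt \<tau> (m - n)) - \<tau> ^ 2 / 6 * \<E> (\<lambda>n. Wt \<tau> (m, n) ^ 3))) \<in> borel_measurable borel"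
    if "0 < \<tau>" for \<tau>
    using kt_measurable[OF that] gt_partial_measurable Wt_cube_partial_measurable[OF that] by measurable
  show "\<forall>\<^sub>F \<tau> in at_right 0. \<forall>m. kt \<tau> m - (\<E> (\<lambda>n. gt \<tau> (m - n)) - \<tau> ^ 2 / 6 * \<E> (\<lambda>n. Wt \<tau> (m, n) ^ 3))
    = \<E> (\<lambda>n. gprim (\<tau> * Wt \<tau> (m, n)) / \<tau> - (Wt \<tau> (m, n) - \<tau>\<^sup>2 * Wt \<tau> (m, n) ^ 3 / 6))
      - \<E> (\<lambda>n. gprim (\<tau> * Wt \<tau> (m, n)) / \<tau>)"
    using gt_partial_integrable pbig_partial(2)[OF pbig_Wt_cube] eventually_at_right_unit
  proof (eventually_elim, intro allI)
    fix \<tau> :: real and m :: "real^'n"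
    assume i1: "\<forall>m. integrable gauss_measure (\<lambda>n. gt \<tau> (m - n))"
      and i3: "\<forall>m. integrable gauss_measure (\<lambda>n. Wt \<tau> (m, n) ^ 3)" and \<tau>: "0 < \<tau> \<and> \<tau> < 1"
    have ig: "integrable gauss_measure (\<lambda>n. gprim (\<tau> * Wt \<tau> (m, n)))"
      using pair_section_measurable[OF pbig_measurable[OF pbig_Wt, of \<tau>], of m] \<tau>
      by (intro gprim_expectation_integrable) simp
    have iW: "integrable gauss_measure (\<lambda>n. Wt \<tau> (m, n))"
      using i1 by (simp add: Wt_def)
    have W: "\<E> (\<lambda>n. Wt \<tau> (m, n)) = \<E> (\<lambda>n. gt \<tau> (m - n)) - kt \<tau> m"
      using i1 by (simp add: Wt_def gauss_expectation_const)
    show "kt \<tau> m - (\<E> (\<lambda>n. gt \<tau> (m - n)) - \<tau> ^ 2 / 6 * \<E> (\<lambda>n. Wt \<tau> (m, n) ^ 3))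
    = \<E> (\<lambda>n. gprim (\<tau> * Wt \<tau> (m, n)) / \<tau> - (Wt \<tau> (m, n) - \<tau>\<^sup>2 * Wt \<tau> (m, n) ^ 3 / 6))
      - \<E> (\<lambda>n. gprim (\<tau> * Wt \<tau> (m, n)) / \<tau>)"
      using ig iW i3 W by simp
  qed
qed

definition rem2 :: "real \<Rightarrow> real^'n \<Rightarrow> real"
  where "rem2 \<tau> m = kt \<tau> m - \<E> (\<lambda>n. gt \<tau> (m - n))"

lemma pbig_rem2: "pbig 2 rem2"
proof -
  have a: "pbig 2 (\<lambda>\<tau> m. kt \<tau> m - (\<E> (\<lambda>n. gt \<tau> (m - n)) - \<tau> ^ 2 / 6 * \<E> (\<lambda>n. Wt \<tau> (m, n) ^ 3)))"
    by (rule pbig_weaken[OF kt_equation]) simp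
  have "pbig (0 + 2) (\<lambda>\<tau> m. \<tau> ^ 2 * \<E> (\<lambda>n. Wt \<tau> (m, n) ^ 3))"
    by (intro pbig_tau_mult pbig_partial(1) pbig_Wt_cube)
  then have "pbig 2 (\<lambda>\<tau> m. (1 / 6) * (\<tau> ^ 2 * \<E> (\<lambda>n. Wt \<tau> (m, n) ^ 3)))"
    by (intro pbig_cmult) (simp only: add_0)
  from pbig_diff[OF a this] show ?thesis
    by (rule pbig_cong) (simp add: rem2_def)
qed

lemma gt_reflect: "\<E> (\<lambda>n. gt \<tau> (- m - n)) = \<E> (\<lambda>n. gt \<tau> (- (m - n)))"
proof -
  have "(\<lambda>n. gt \<tau> (- (m - n))) = (\<lambda>n. gt \<tau> (- m - (- n)))" by simp
  then show ?thesis
    using gauss_expectation_uminus[OF gt_shift_measurable[of \<tau> "- m"]] by simp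
qed

lemma gt_reflect_integrable:
  assumes "integrable gauss_measure (\<lambda>n. gt \<tau> (- m - n))"
  shows "integrable gauss_measure (\<lambda>n. gt \<tau> (- (m - n)))"
  using gauss_integrable_uminus[OF assms] by simp

lemma pbig_gt_even2: "pbig 2 (\<lambda>\<tau> m. (gt \<tau> m + gt \<tau> (- m)) / 2 - quad H m / 2)"
proof -
  have "pbig (0 + 2) (\<lambda>\<tau> m. \<tau> ^ 2 * quart K m)" by (intro pbig_tau_mult pbig_quart)
  then have "pbig 2 (\<lambda>\<tau> m. (1 / 24) * (\<tau> ^ 2 * quart K m))" by (intro pbig_cmult) (simp only: add_0)
  moreover have "pbig 2 (\<lambda>\<tau> m. (gt \<tau> m + gt \<tau> (- m)) / 2 - quad H m / 2 - \<tau> ^ 2 * quart K m / 24)"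
    by (rule pbig_weaken[OF pbig_gt_even]) simp
  ultimately have "pbig 2 (\<lambda>\<tau> m. ((gt \<tau> m + gt \<tau> (- m)) / 2 - quad H m / 2 - \<tau> ^ 2 * quart K m / 24) + (1 / 24) * (\<tau> ^ 2 * quart K m))"
    by (intro pbig_add)
  then show ?thesis
    by (rule pbig_cong) simp
qed

lemma pbig_even_difference:
  "pbig 2 (\<lambda>\<tau> p. (gt \<tau> (fst p - snd p) + gt \<tau> (- (fst p - snd p))) / 2 - quad H (fst p - snd p) / 2)"
  by (rule pbig_linear[OF pbig_gt_even2 bounded_linear_difference])

lemma pbig_odd_difference:
  "pbig 1 (\<lambda>\<tau> p. gt \<tau> (fst p - snd p) - gt \<tau> (- (fst p - snd p)))"
  by (rule pbig_linear[OF pbig_gt_odd bounded_linear_difference])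

lemma pbig_reflect: "pbig a W \<Longrightarrow> pbig a (\<lambda>\<tau> x. W \<tau> (- x))"
  using pbig_linear[of a W uminus] bounded_linear_minus[OF bounded_linear_ident] by simp

lemma kt_reflect_measurable: "0 < \<tau> \<Longrightarrow> (\<lambda>m. kt \<tau> (- m)) \<in> borel_measurable borel"
  using pbig_measurable[OF pbig_reflect[OF pbig_kt]] .

text \<open>Up to order \<tau>^2 the half-step height is the Gaussian average of \<open>gt\<close>,
  so its even part is the average of \<open>quad H (m - n) / 2\<close>. Together with
  \<open>kt_odd\<close> this stands in for derivatives of the half-step graph.\<close>

lemma kt_even: "pbig 2 (\<lambda>\<tau> m. (kt \<tau> m + kt \<tau> (- m)) / 2 - (quad H m + tr H) / 2)"
proof (rule pbig_cong_eventually)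
  show "pbig 2 (\<lambda>\<tau> m. (1 / 2) * (rem2 \<tau> m + rem2 \<tau> (- m))
      + \<E> (\<lambda>n. (gt \<tau> (m - n) + gt \<tau> (- (m - n))) / 2 - quad H (m - n) / 2))"
    using pbig_partial(1)[OF pbig_even_difference]
    by (intro pbig_add pbig_cmult pbig_rem2 pbig_reflect[OF pbig_rem2]) simp
  show "(\<lambda>m. (kt \<tau> m + kt \<tau> (- m)) / 2 - (quad H m + tr H) / 2) \<in> borel_measurable borel" if "0 < \<tau>" for \<tau>
    using kt_measurable[OF that] kt_reflect_measurable[OF that] by measurable
  show "\<forall>\<^sub>F \<tau> in at_right 0. \<forall>m. (kt \<tau> m + kt \<tau> (- m)) / 2 - (quad H m + tr H) / 2
    = (1 / 2) * (rem2 \<tau> m + rem2 \<tau> (- m))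
      + \<E> (\<lambda>n. (gt \<tau> (m - n) + gt \<tau> (- (m - n))) / 2 - quad H (m - n) / 2)"
    using gt_partial_integrable
  proof (eventually_elim, intro allI)
    fix \<tau> :: real and m :: "real^'n"
    assume i: "\<forall>m. integrable gauss_measure (\<lambda>n. gt \<tau> (m - n))"
    then have i2: "integrable gauss_measure (\<lambda>n. gt \<tau> (- (m - n)))" by (intro gt_reflect_integrable) blast
    have "\<E> (\<lambda>n. (gt \<tau> (m - n) + gt \<tau> (- (m - n))) / 2 - quad H (m - n) / 2)
      = (\<E> (\<lambda>n. gt \<tau> (m - n)) + \<E> (\<lambda>n. gt \<tau> (- (m - n)))) / 2 - \<E> (\<lambda>n. quad H (m - n)) / 2"
      using i i2 quad_shift_integrable[of H m] by (simp del: minus_diff_eq)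
    then show "(kt \<tau> m + kt \<tau> (- m)) / 2 - (quad H m + tr H) / 2
      = (1 / 2) * (rem2 \<tau> m + rem2 \<tau> (- m))
      + \<E> (\<lambda>n. (gt \<tau> (m - n) + gt \<tau> (- (m - n))) / 2 - quad H (m - n) / 2)"
      by (simp add: rem2_def gt_reflect gauss_quad_shift[OF H_sym] field_simps del: minus_diff_eq)
  qed
qed

lemma kt_odd: "pbig 1 (\<lambda>\<tau> m. kt \<tau> m - kt \<tau> (- m))"
proof (rule pbig_cong_eventually)
  show "pbig 1 (\<lambda>\<tau> m. (rem2 \<tau> m - rem2 \<tau> (- m)) + \<E> (\<lambda>n. gt \<tau> (m - n) - gt \<tau> (- (m - n))))"
    using pbig_partial(1)[OF pbig_odd_difference] pbig_weaken[OF pbig_rem2, of 1]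
    by (intro pbig_add pbig_diff pbig_reflect) simp_all
  show "(\<lambda>m. kt \<tau> m - kt \<tau> (- m)) \<in> borel_measurable borel" if "0 < \<tau>" for \<tau>
    using kt_measurable[OF that] kt_reflect_measurable[OF that] by measurable
  show "\<forall>\<^sub>F \<tau> in at_right 0. \<forall>m. kt \<tau> m - kt \<tau> (- m)
    = (rem2 \<tau> m - rem2 \<tau> (- m)) + \<E> (\<lambda>n. gt \<tau> (m - n) - gt \<tau> (- (m - n)))"
    using gt_partial_integrable
  proof (eventually_elim, intro allI)
    fix \<tau> :: real and m :: "real^'n"
    assume i: "\<forall>m. integrable gauss_measure (\<lambda>n. gt \<tau> (m - n))"
    then have i2: "integrable gauss_measure (\<lambda>n. gt \<tau> (- (m - n)))" by (intro gt_reflect_integrable) blast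
    show "kt \<tau> m - kt \<tau> (- m) = (rem2 \<tau> m - rem2 \<tau> (- m)) + \<E> (\<lambda>n. gt \<tau> (m - n) - gt \<tau> (- (m - n)))"
      using i i2 by (simp add: rem2_def gt_reflect del: minus_diff_eq)
  qed
qed

lemma Wt_reflect: "Wt \<tau> (- p) = gt \<tau> (- (fst p - snd p)) - kt \<tau> (- fst p)"
  by (simp add: Wt_def)

lemma Wt_even: "pbig 2 (\<lambda>\<tau> p. (Wt \<tau> p + Wt \<tau> (- p)) / 2 - cross_form H p)"
proof (rule pbig_cong[OF pbig_diff[OF pbig_even_difference pbig_linear[OF kt_even bounded_linear_fst]]])
  fix \<tau> :: real and p
  show "(Wt \<tau> p + Wt \<tau> (- p)) / 2 - cross_form H p = (gt \<tau> (fst p - snd p) + gt \<tau> (- (fst p - snd p))) / 2 - quad H (fst p - snd p) / 2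
    - ((kt \<tau> (fst p) + kt \<tau> (- fst p)) / 2 - (quad H (fst p) + tr H) / 2)"
    unfolding Wt_reflect unfolding Wt_def cross_form_def by (simp add: field_simps del: minus_diff_eq)
qed

lemma Wt_odd: "pbig 1 (\<lambda>\<tau> p. Wt \<tau> p - Wt \<tau> (- p))"
proof (rule pbig_cong[OF pbig_diff[OF pbig_odd_difference pbig_linear[OF kt_odd bounded_linear_fst]]])
  fix \<tau> :: real and p
  show "Wt \<tau> p - Wt \<tau> (- p) = gt \<tau> (fst p - snd p) - gt \<tau> (- (fst p - snd p)) - (kt \<tau> (fst p) - kt \<tau> (- fst p))"
    unfolding Wt_reflect unfolding Wt_def by simp
qed

definition t3 :: real where "t3 = tr (mmul (mmul H H) H)"
text \<open>The Taylor factor 1/24 times the factor 4 from doubled variance. For the tensor of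
  fourth derivatives of g this is half the bi-Laplacian at the origin.\<close>

definition bK :: real where "bK = \<E> (quart K) / 6"

lemma Wt_cube_expectation: "(\<lambda>\<tau>. \<E> (\<lambda>p. Wt \<tau> p ^ 3) - 4 * t3) \<in> O[at_right 0](\<lambda>\<tau>. \<tau> ^ 2)"
  using pbig_cube_expectation[OF pbig_Wt pbig_cross_form Wt_even Wt_odd]
  by (simp add: gauss_cross_form_cubed[OF H_sym] t3_def)

text \<open>Treats at once the two ways in which a Gaussian of variance 2 arises: two half steps, as
  a difference of independent vectors, and one full step, as dilation by sqrt 2.\<close>

lemma gt_linear_expectation:
  fixes L :: "'b::euclidean_space \<Rightarrow> real^'n"
  assumes L: "bounded_linear L"
    and q: "\<E> (\<lambda>x. quad H (L x)) = 2 * tr H"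
    and k: "\<E> (\<lambda>x. quart K (L x)) = 4 * \<E> (quart K)"
  shows "(\<lambda>\<tau>. \<E> (\<lambda>x. gt \<tau> (L x)) - (tr H + \<tau> ^ 2 * bK)) \<in> O[at_right 0](\<lambda>\<tau>. \<tau> ^ 4)"
proof -
  have P: "pbig 4 (\<lambda>\<tau> x. (gt \<tau> (L x) + gt \<tau> (- L x)) / 2 - quad H (L x) / 2 - \<tau> ^ 2 * quart K (L x) / 24)"
    by (rule pbig_linear[OF pbig_gt_even L])
  have iq: "integrable gauss_measure (\<lambda>x. quad H (L x))" "integrable gauss_measure (\<lambda>x. quart K (L x))"
    by (rule pbig_0_integrable[OF pbig_linear[OF pbig_quad L]], rule pbig_0_integrable[OF pbig_linear[OF pbig_quart L]])
  have "\<forall>\<^sub>F \<tau> in at_right 0. \<E> (\<lambda>x. (gt \<tau> (L x) + gt \<tau> (- L x)) / 2 - quad H (L x) / 2 - \<tau> ^ 2 * quart K (L x) / 24)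
      = \<E> (\<lambda>x. gt \<tau> (L x)) - (tr H + \<tau> ^ 2 * bK)"
    using pbig_integrable[OF pbig_linear[OF pbig_gt L]]
  proof eventually_elim
    case (elim \<tau>)
    have neg: "L (- x) = - L x" for x using linear_neg[OF bounded_linear.linear[OF L]] .
    have i2: "integrable gauss_measure (\<lambda>x. gt \<tau> (- L x))" using gauss_integrable_uminus[OF elim] by (simp add: neg)
    have "\<E> (\<lambda>x. gt \<tau> (L x)) = \<E> (\<lambda>x. (gt \<tau> (L x) + gt \<tau> (- L x)) / 2)"
      using gauss_reflect[OF elim] by (simp add: neg)
    then show ?case using elim i2 iq q k by (simp add: bK_def)
  qed
  with pbig_expectation[OF P] show ?thesis using landau_o.big.in_cong by fast
qed

lemma gt_difference_expectation:
  "(\<lambda>\<tau>. \<E> (\<lambda>p. gt \<tau> (fst p - snd p)) - (tr H + \<tau> ^ 2 * bK)) \<in> O[at_right 0](\<lambda>\<tau>. \<tau> ^ 4)"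
  by (rule gt_linear_expectation[OF bounded_linear_difference gauss_quad_difference[OF H_sym] gauss_quart_difference])

lemma bounded_linear_sqrt2: "bounded_linear (\<lambda>x :: real^'n. sqrt 2 *\<^sub>R x)"
  by (rule bounded_linear_scaleR_right)

lemma gt_sqrt2_expectation:
  "(\<lambda>\<tau>. \<E> (\<lambda>x. gt \<tau> (sqrt 2 *\<^sub>R x)) - (tr H + \<tau> ^ 2 * bK)) \<in> O[at_right 0](\<lambda>\<tau>. \<tau> ^ 4)"
proof (rule gt_linear_expectation[OF bounded_linear_sqrt2])
  show "\<E> (\<lambda>x. quad H (sqrt 2 *\<^sub>R x)) = 2 * tr H"
    by (simp add: quad_scaleR gauss_quad)
  have "sqrt 2 ^ 4 = (4::real)" by (simp add: power4_eq_xxxx)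
  then show "\<E> (\<lambda>x. quart K (sqrt 2 *\<^sub>R x)) = 4 * \<E> (quart K)"
    by (simp add: quart_scaleR)
qed

text \<open>Average of \<open>kt_equation\<close>; the coefficient 2/3 is 1/6 of the mean cube
  \<open>4 * t3\<close> of \<open>cross_form\<close>.\<close>

lemma kt_expectation:
  "(\<lambda>\<tau>. \<E> (kt \<tau>) - (tr H + \<tau> ^ 2 * (bK - 2 / 3 * t3))) \<in> O[at_right 0](\<lambda>\<tau>. \<tau> ^ 4)"
proof -
  have f1: "(\<lambda>\<tau>. \<E> (\<lambda>m. kt \<tau> m - (\<E> (\<lambda>n. gt \<tau> (m - n)) - \<tau> ^ 2 / 6 * \<E> (\<lambda>n. Wt \<tau> (m, n) ^ 3)))) \<in> O[at_right 0](\<lambda>\<tau>. \<tau> ^ 4)"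
    by (rule pbig_expectation[OF kt_equation])
  have "(\<lambda>\<tau>. \<tau> ^ 2 * (\<E> (\<lambda>p. Wt \<tau> p ^ 3) - 4 * t3)) \<in> O[at_right 0](\<lambda>\<tau>. \<tau> ^ 2 * \<tau> ^ 2)"
    by (rule landau_o.big.mult[OF landau_o.big_refl Wt_cube_expectation])
  then have f3: "(\<lambda>\<tau>. 1 / 6 * (\<tau> ^ 2 * (\<E> (\<lambda>p. Wt \<tau> p ^ 3) - 4 * t3))) \<in> O[at_right 0](\<lambda>\<tau>. \<tau> ^ 4)"
    by (simp add: power_add[symmetric])
  have ev: "\<forall>\<^sub>F \<tau> in at_right 0. \<E> (\<lambda>m. kt \<tau> m - (\<E> (\<lambda>n. gt \<tau> (m - n)) - \<tau> ^ 2 / 6 * \<E> (\<lambda>n. Wt \<tau> (m, n) ^ 3)))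
      + (\<E> (\<lambda>p. gt \<tau> (fst p - snd p)) - (tr H + \<tau> ^ 2 * bK))
      - 1 / 6 * (\<tau> ^ 2 * (\<E> (\<lambda>p. Wt \<tau> p ^ 3) - 4 * t3))
    = \<E> (kt \<tau>) - (tr H + \<tau> ^ 2 * (bK - 2 / 3 * t3))"
    using pbig_integrable[OF pbig_kt] pbig_integrable[OF pbig_partial(1)[OF pbig_gt_difference]]
      pbig_integrable[OF pbig_partial(1)[OF pbig_Wt_cube]] pbig_integrable[OF pbig_gt_difference] pbig_integrable[OF pbig_Wt_cube]
  proof eventually_elim
    case (elim \<tau>)
    have "\<E> (\<lambda>p. gt \<tau> (fst p - snd p)) = \<E> (\<lambda>m. \<E> (\<lambda>n. gt \<tau> (m - n)))"
      using gauss_fubini[OF elim(4)] by simp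
    moreover have "\<E> (\<lambda>p. Wt \<tau> p ^ 3) = \<E> (\<lambda>m. \<E> (\<lambda>n. Wt \<tau> (m, n) ^ 3))"
      by (rule gauss_fubini[OF elim(5)])
    ultimately show ?case using elim(1-3) by (simp add: algebra_simps)
  qed
  show ?thesis
    using sum_in_bigo(2)[OF sum_in_bigo(1)[OF f1 gt_difference_expectation] f3]
    by (subst (asm) landau_o.big.in_cong[OF ev])
qed

end

section \<open>The zero of the rescaled step function\<close>

text \<open>Replaces \<phi> by 0 at cost O(\<tau>), uniformly in the height \<open>k\<close>. Where
  \<phi> has a polynomial bound the Lipschitz property is used; elsewhere the weight times \<tau> is
  at least 1 and dominates the bounded integrand.\<close>

lemma gprim_near_constant:
  fixes \<phi> :: "'a::euclidean_space \<Rightarrow> real"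
  assumes m [measurable]: "\<phi> \<in> borel_measurable borel" and c: "0 < c" "c \<le> \<tau>" and A: "0 \<le> A"
    and b: "\<And>n. \<bar>\<phi> n\<bar> \<le> A * (1 + norm n) ^ K \<or> 1 \<le> \<tau> * (A * (1 + norm n) ^ K)"
  shows "\<bar>\<E> (\<lambda>n. gprim (c * (\<phi> n - k))) - gprim (- (c * k))\<bar> \<le> 4 * A * \<E> (\<lambda>n::'a. (1 + norm n) ^ K) * \<tau>"
proof -
  have i: "integrable gauss_measure (\<lambda>n. gprim (c * (\<phi> n - k)))"
    by (rule gprim_expectation_integrable) measurable
  have "\<bar>\<E> (\<lambda>n. gprim (c * (\<phi> n - k)) - gprim (- (c * k)))\<bar> \<le> \<E> (\<lambda>n::'a. 4 * A * \<tau> * (1 + norm n) ^ K)"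
  proof (rule gauss_abs_expectation_le)
    fix n :: 'a
    have pos: "0 \<le> \<tau> * (A * (1 + norm n) ^ K)" using c A by simp
    from b[of n] show "\<bar>gprim (c * (\<phi> n - k)) - gprim (- (c * k))\<bar> \<le> 4 * A * \<tau> * (1 + norm n) ^ K"
    proof
      assume le: "\<bar>\<phi> n\<bar> \<le> A * (1 + norm n) ^ K"
      have "\<bar>gprim (c * (\<phi> n - k)) - gprim (- (c * k))\<bar> \<le> \<bar>c * (\<phi> n - k) - - (c * k)\<bar>" by (rule gprim_lipschitz)
      also have "\<dots> = c * \<bar>\<phi> n\<bar>" using c by (simp add: algebra_simps abs_mult)
      also have "\<dots> \<le> \<tau> * (A * (1 + norm n) ^ K)" using c le by (intro mult_mono) auto
      also have "\<dots> \<le> 4 * (\<tau> * (A * (1 + norm n) ^ K))" using pos by linarith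
      finally show ?thesis by (simp add: mult_ac)
    next
      assume "1 \<le> \<tau> * (A * (1 + norm n) ^ K)"
      then have "4 \<le> 4 * A * \<tau> * (1 + norm n) ^ K" by (simp add: mult_ac)
      then show ?thesis using gprim_diff_bound[of "c * (\<phi> n - k)" "- (c * k)"] by linarith
    qed
  qed (auto simp: gauss_integrable_weight)
  then show ?thesis using i by (simp add: gauss_expectation_const mult_ac)
qed

context near_graph
begin

definition k0 :: "real \<Rightarrow> real" where "k0 \<tau> = tr H + \<tau> ^ 2 * (bK - t3)"

text \<open>The step function over the origin at height \<tau>^2 k, divided by \<tau> so that its
  slope in \<open>k\<close> stays of order one. The full step has displacement sqrt 2 \<tau>, which
  produces both factors sqrt 2 in the second term.\<close>

definition V :: "real \<Rightarrow> real \<Rightarrow> real"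
  where "V \<tau> k = (sqrt 2 * \<E> (\<lambda>m. gprim (\<tau> * (kb \<tau> m - k)))
    - \<E> (\<lambda>n. gprim (\<tau> / sqrt 2 * (gq \<tau> (sqrt 2 *\<^sub>R n) - k)))) / \<tau>"

lemma gq_sqrt2_measurable: "(\<lambda>n. gq \<tau> (sqrt 2 *\<^sub>R n)) \<in> borel_measurable borel"
  and gt_sqrt2_measurable: "(\<lambda>n. gt \<tau> (sqrt 2 *\<^sub>R n)) \<in> borel_measurable borel"
  by measurable

text \<open>The fifth power of \<tau> |m|^6 > 1 dominates the indicator of the truncated region; the
  resulting \<tau>^5 becomes \<tau>^4 in \<open>V\<close>.\<close>

lemma kb_truncation:
  assumes \<tau>: "0 < \<tau>"
  shows "\<bar>\<E> (\<lambda>m. gprim (\<tau> * (kb \<tau> m - k))) - \<E> (\<lambda>m. gprim (\<tau> * (kt \<tau> m - k)))\<bar>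
    \<le> 4 * (\<tau> ^ 5 * mom 30)"
proof -
  have "\<bar>\<E> (\<lambda>m. gprim (\<tau> * (kb \<tau> m - k))) - \<E> (\<lambda>m. gprim (\<tau> * (kt \<tau> m - k)))\<bar>
    \<le> 4 * \<E> (\<lambda>m::real^'n. \<tau> ^ 5 * (1 + norm m) ^ 30)"
  proof (rule gprim_truncation[OF kb_measurable[OF \<tau>] kt_measurable[OF \<tau>]])
    fix m assume "kb \<tau> m \<noteq> kt \<tau> m"
    then have "1 \<le> (\<tau> * norm m ^ 6) ^ 5" by (intro one_le_power) (auto simp: kt_def split: if_splits)
    also have "\<dots> = \<tau> ^ 5 * norm m ^ 30" by (simp add: power_mult_distrib power_mult[symmetric])
    also have "\<dots> \<le> \<tau> ^ 5 * (1 + norm m) ^ 30" using \<tau> by (intro mult_left_mono norm_power_le_weight) auto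
    finally show "1 \<le> \<tau> ^ 5 * (1 + norm m) ^ 30" .
  qed (use \<tau> in \<open>auto simp: gauss_integrable_weight\<close>)
  then show ?thesis by (simp add: mom_def)
qed

lemma sqrt2_norm_le: "0 < \<tau> \<Longrightarrow> \<tau> * norm (sqrt 2 *\<^sub>R n) \<le> \<tau> * (2 * (1 + norm n))"
proof -
  assume \<tau>: "0 < \<tau>"
  have "sqrt 2 \<le> sqrt (2\<^sup>2)" by (rule real_sqrt_le_mono) simp
  then have "sqrt 2 * norm n \<le> 2 * (1 + norm n)" by (intro mult_mono) auto
  then show ?thesis using \<tau> by (intro mult_left_mono) auto
qed

lemma gq_sqrt2_truncation:
  assumes \<tau>: "0 < \<tau>"
  shows "\<bar>\<E> (\<lambda>n. gprim (c * (gq \<tau> (sqrt 2 *\<^sub>R n) - k))) - \<E> (\<lambda>n. gprim (c * (gt \<tau> (sqrt 2 *\<^sub>R n) - k)))\<bar>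
    \<le> 4 * (\<tau> ^ 5 * 32 * mom 5)"
proof -
  have "\<bar>\<E> (\<lambda>n. gprim (c * (gq \<tau> (sqrt 2 *\<^sub>R n) - k))) - \<E> (\<lambda>n. gprim (c * (gt \<tau> (sqrt 2 *\<^sub>R n) - k)))\<bar>
    \<le> 4 * \<E> (\<lambda>m::real^'n. \<tau> ^ 5 * 32 * (1 + norm m) ^ 5)"
  proof (rule gprim_truncation[OF gq_sqrt2_measurable gt_sqrt2_measurable])
    fix n :: "real^'n" assume "gq \<tau> (sqrt 2 *\<^sub>R n) \<noteq> gt \<tau> (sqrt 2 *\<^sub>R n)"
    then have "1 \<le> \<tau> * norm (sqrt 2 *\<^sub>R n)" by (auto simp: gt_def split: if_splits)
    also have "\<dots> \<le> \<tau> * (2 * (1 + norm n))" using \<tau> by (rule sqrt2_norm_le)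
    finally have "1 \<le> (\<tau> * (2 * (1 + norm n))) ^ 5" by (rule one_le_power)
    also have "\<dots> = \<tau> ^ 5 * 32 * (1 + norm n) ^ 5" by (simp only: power_mult_distrib) simp
    finally show "1 \<le> \<tau> ^ 5 * 32 * (1 + norm n) ^ 5" .
  qed (use \<tau> in \<open>auto simp: gauss_integrable_weight\<close>)
  then show ?thesis by (simp add: mom_def)
qed

lemma pbig_k0: "pbig 0 (\<lambda>\<tau> x. k0 \<tau>)"
proof -
  have "pbig 0 (\<lambda>\<tau> x. tr H + (bK - t3) * \<tau> ^ 2)"
    by (intro pbig_add pbig_const pbig_cmult pbig_weaken[OF pbig_tau]) simp
  then show ?thesis by (simp add: k0_def mult.commute)
qed

lemma pbig_k0_correction: "pbig 2 (\<lambda>\<tau> x. \<tau> ^ 2 * (bK - t3))"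
  using pbig_cmult[OF pbig_tau[of 2], of "bK - t3"] by (simp add: mult.commute)

definition X :: "real \<Rightarrow> real^'n \<Rightarrow> real" where "X \<tau> m = kt \<tau> m - k0 \<tau>"
definition Y :: "real \<Rightarrow> real^'n \<Rightarrow> real" where "Y \<tau> n = gt \<tau> (sqrt 2 *\<^sub>R n) - k0 \<tau>"

lemma pbig_X: "pbig 0 X"
  using pbig_diff[OF pbig_kt pbig_k0] by (simp add: X_def[abs_def])

lemma pbig_Y: "pbig 0 Y"
  using pbig_diff[OF pbig_linear[OF pbig_gt bounded_linear_sqrt2] pbig_k0] by (simp add: Y_def[abs_def])

text \<open>To leading order the even part of \<open>X\<close> is (quad H + tr H)/2 - tr H, half the
  centred quadratic form, so the mean cube is 8/8 times \<open>t3\<close>. In \<open>Y_cube\<close>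
  the form is not halved, which gives 8.\<close>

lemma X_cube: "(\<lambda>\<tau>. \<E> (\<lambda>m. X \<tau> m ^ 3) - t3) \<in> O[at_right 0](\<lambda>\<tau>. \<tau> ^ 2)"
proof -
  define F where "F m = (1 / 2) * (quad H m - tr H)" for m
  have "pbig 0 (\<lambda>\<tau>. F)" unfolding F_def[abs_def] by (intro pbig_cmult pbig_diff pbig_quad pbig_const)
  moreover have "pbig 2 (\<lambda>\<tau> m. (X \<tau> m + X \<tau> (- m)) / 2 - F m)"
    by (rule pbig_cong[OF pbig_diff[OF kt_even pbig_k0_correction]]) (simp add: X_def k0_def F_def field_simps)
  moreover have "pbig 1 (\<lambda>\<tau> m. X \<tau> m - X \<tau> (- m))"
    using kt_odd by (simp add: X_def)
  ultimately have "(\<lambda>\<tau>. \<E> (\<lambda>m. X \<tau> m ^ 3) - \<E> (\<lambda>m. F m ^ 3)) \<in> O[at_right 0](\<lambda>\<tau>. \<tau> ^ 2)"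
    by (rule pbig_cube_expectation[OF pbig_X])
  moreover have "\<E> (\<lambda>m. F m ^ 3) = t3"
  proof -
    have "(\<lambda>m. F m ^ 3) = (\<lambda>m. 1 / 8 * (quad H m - tr H) ^ 3)"
      unfolding F_def power_mult_distrib by (simp add: power3_eq_cube)
    then show ?thesis by (simp add: gauss_quad_shifted_cube[OF H_sym] t3_def)
  qed
  ultimately show ?thesis by simp
qed

lemma Y_cube: "(\<lambda>\<tau>. \<E> (\<lambda>n. Y \<tau> n ^ 3) - 8 * t3) \<in> O[at_right 0](\<lambda>\<tau>. \<tau> ^ 2)"
proof -
  define F where "F n = quad H n - tr H" for n
  note E = pbig_linear[OF pbig_gt_even2 bounded_linear_sqrt2]
  have "pbig 0 (\<lambda>\<tau>. F)" unfolding F_def[abs_def] by (intro pbig_diff pbig_quad pbig_const)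
  moreover have "pbig 2 (\<lambda>\<tau> n. (Y \<tau> n + Y \<tau> (- n)) / 2 - F n)"
    by (rule pbig_cong[OF pbig_diff[OF E pbig_k0_correction]]) (simp add: Y_def k0_def F_def quad_scaleR field_simps)
  moreover have "pbig 1 (\<lambda>\<tau> n. Y \<tau> n - Y \<tau> (- n))"
    using pbig_linear[OF pbig_gt_odd bounded_linear_sqrt2] by (simp add: Y_def)
  ultimately have "(\<lambda>\<tau>. \<E> (\<lambda>n. Y \<tau> n ^ 3) - \<E> (\<lambda>n. F n ^ 3)) \<in> O[at_right 0](\<lambda>\<tau>. \<tau> ^ 2)"
    by (rule pbig_cube_expectation[OF pbig_Y])
  then show ?thesis by (simp add: F_def gauss_quad_shifted_cube[OF H_sym] t3_def)
qed

lemma divide_tau_bigo: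
  fixes d :: "real \<Rightarrow> real" and B :: real
  assumes "\<And>\<tau>. 0 < \<tau> \<Longrightarrow> \<bar>d \<tau>\<bar> \<le> B * \<tau> ^ 5"
  shows "(\<lambda>\<tau>. d \<tau> / \<tau>) \<in> O[at_right 0](\<lambda>\<tau>. \<tau> ^ 4)"
proof (rule bigoI[where c=B])
  show "\<forall>\<^sub>F \<tau> in at_right 0. norm (d \<tau> / \<tau>) \<le> B * norm (\<tau> ^ 4)"
    using eventually_at_right_unit
  proof eventually_elim
    case (elim \<tau>)
    then have "\<bar>d \<tau>\<bar> / \<tau> \<le> B * \<tau> ^ 5 / \<tau>" using assms by (intro divide_right_mono) auto
    then show ?case using elim by (simp add: eval_nat_numeral)
  qed
qed

text \<open>With s = sqrt 2, the coefficient of \<tau>^2 \<open>t3\<close> is s (-2/3 - 1/6) from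
  the half-step term and 8 s/24 = s/3 from the full-step term, in total -s/2. The height enters with
  factor -(s - s/2), so the summand \<open>- t3\<close> in \<open>k0\<close> contributes s/2 and
  cancels it.\<close>

lemma V_k0: "(\<lambda>\<tau>. V \<tau> (k0 \<tau>)) \<in> O[at_right 0](\<lambda>\<tau>. \<tau> ^ 4)"
proof -
  define s where "s = sqrt (2::real)"
  have s: "\<tau> / sqrt 2 = \<tau> * (s / 2)" for \<tau> :: real
    using real_sqrt_mult_self[of 2] by (simp add: s_def field_simps)
  have s3: "(s / 2) ^ 3 = s / 4" by (simp add: s_def power3_eq_cube)
  \<comment> \<open>Since 1/sqrt 2 = s/2, the full-step integrand is again of the form
    \<open>gprim (\<tau> * Z \<tau> n)\<close>, and \<open>pbig_gprim\<close> covers both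
    terms.\<close>
  define Z where "Z \<tau> n = (s / 2) * Y \<tau> n" for \<tau> n
  have Z: "pbig 0 Z" unfolding Z_def[abs_def] by (intro pbig_cmult pbig_Y)
  define r1 where "r1 \<tau> = \<E> (\<lambda>m. gprim (\<tau> * X \<tau> m) / \<tau> - (X \<tau> m - \<tau>\<^sup>2 * X \<tau> m ^ 3 / 6))" for \<tau>
  define r2 where "r2 \<tau> = \<E> (\<lambda>n. gprim (\<tau> * Z \<tau> n) / \<tau> - (Z \<tau> n - \<tau>\<^sup>2 * Z \<tau> n ^ 3 / 6))" for \<tau>
  define d1 where "d1 \<tau> = \<E> (\<lambda>m. gprim (\<tau> * (kb \<tau> m - k0 \<tau>))) - \<E> (\<lambda>m. gprim (\<tau> * X \<tau> m))" for \<tau>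
  define d2 where "d2 \<tau> = \<E> (\<lambda>n. gprim (\<tau> / sqrt 2 * (gq \<tau> (sqrt 2 *\<^sub>R n) - k0 \<tau>))) - \<E> (\<lambda>n. gprim (\<tau> / sqrt 2 * Y \<tau> n))" for \<tau>
  define a1 where "a1 \<tau> = \<E> (kt \<tau>) - (tr H + \<tau> ^ 2 * (bK - 2 / 3 * t3))" for \<tau>
  define a2 where "a2 \<tau> = \<E> (\<lambda>x. gt \<tau> (sqrt 2 *\<^sub>R x)) - (tr H + \<tau> ^ 2 * bK)" for \<tau>
  define a3 where "a3 \<tau> = \<tau> ^ 2 * (\<E> (\<lambda>m. X \<tau> m ^ 3) - t3)" for \<tau>
  define a4 where "a4 \<tau> = \<tau> ^ 2 * (\<E> (\<lambda>n. Y \<tau> n ^ 3) - 8 * t3)" for \<tau>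
  have r: "r1 \<in> O[at_right 0](\<lambda>\<tau>. \<tau> ^ 4)" "r2 \<in> O[at_right 0](\<lambda>\<tau>. \<tau> ^ 4)"
    unfolding r1_def[abs_def] r2_def[abs_def] by (intro pbig_expectation pbig_gprim pbig_X Z)+
  have d: "(\<lambda>\<tau>. d1 \<tau> / \<tau>) \<in> O[at_right 0](\<lambda>\<tau>. \<tau> ^ 4)" "(\<lambda>\<tau>. d2 \<tau> / \<tau>) \<in> O[at_right 0](\<lambda>\<tau>. \<tau> ^ 4)"
  proof -
    show "(\<lambda>\<tau>. d1 \<tau> / \<tau>) \<in> O[at_right 0](\<lambda>\<tau>. \<tau> ^ 4)"
      by (rule divide_tau_bigo[where B="4 * mom 30"]) (use kb_truncation in \<open>simp add: d1_def X_def mult_ac\<close>)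
    show "(\<lambda>\<tau>. d2 \<tau> / \<tau>) \<in> O[at_right 0](\<lambda>\<tau>. \<tau> ^ 4)"
    proof (rule divide_tau_bigo[where B="128 * mom 5"])
      fix \<tau> :: real assume "0 < \<tau>"
      from gq_sqrt2_truncation[OF this, of "\<tau> / sqrt 2" "k0 \<tau>"]
      show "\<bar>d2 \<tau>\<bar> \<le> 128 * mom 5 * \<tau> ^ 5" by (simp only: d2_def Y_def) (simp add: mult_ac)
    qed
  qed
  have a12: "a1 \<in> O[at_right 0](\<lambda>\<tau>. \<tau> ^ 4)" "a2 \<in> O[at_right 0](\<lambda>\<tau>. \<tau> ^ 4)"
    unfolding a1_def[abs_def] a2_def[abs_def] by (rule kt_expectation, rule gt_sqrt2_expectation)
  have a34: "a3 \<in> O[at_right 0](\<lambda>\<tau>. \<tau> ^ 4)" "a4 \<in> O[at_right 0](\<lambda>\<tau>. \<tau> ^ 4)"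
    unfolding a3_def[abs_def] a4_def[abs_def]
    using landau_o.big.mult[OF landau_o.big_refl X_cube, of "\<lambda>\<tau>. \<tau> ^ 2"]
      landau_o.big.mult[OF landau_o.big_refl Y_cube, of "\<lambda>\<tau>. \<tau> ^ 2"]
    by (simp_all add: power_add[symmetric])
  have "(\<lambda>\<tau>. s * (r1 \<tau> + a1 \<tau> - 1 / 6 * a3 \<tau> + d1 \<tau> / \<tau>) - (r2 \<tau> + s / 2 * a2 \<tau> - s / 24 * a4 \<tau> + d2 \<tau> / \<tau>)) \<in> O[at_right 0](\<lambda>\<tau>. \<tau> ^ 4)"
    using r d a12 a34 by (intro sum_in_bigo landau_o.big.cmult_in_iff[THEN iffD2, rotated]) (auto simp: s_def)
  moreover have "\<forall>\<^sub>F \<tau> in at_right 0. s * (r1 \<tau> + a1 \<tau> - 1 / 6 * a3 \<tau> + d1 \<tau> / \<tau>) - (r2 \<tau> + s / 2 * a2 \<tau> - s / 24 * a4 \<tau> + d2 \<tau> / \<tau>) = V \<tau> (k0 \<tau>)"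
    using pbig_integrable[OF pbig_kt] pbig_integrable[OF pbig_linear[OF pbig_gt bounded_linear_sqrt2]]
      pbig_integrable[OF pbig_X] pbig_integrable[OF pbig_Y] pbig_integrable[OF pbig_power[OF pbig_X, of 3]]
      pbig_integrable[OF pbig_power[OF pbig_Y, of 3]] eventually_at_right_unit
  proof eventually_elim
    case (elim \<tau>)
    have \<tau>: "0 < \<tau>" using elim by simp
    define GX where "GX = \<E> (\<lambda>m. gprim (\<tau> * X \<tau> m))"
    define GZ where "GZ = \<E> (\<lambda>n. gprim (\<tau> * Z \<tau> n))"
    define X3 where "X3 = \<E> (\<lambda>m. X \<tau> m ^ 3)"
    define Y3 where "Y3 = \<E> (\<lambda>n. Y \<tau> n ^ 3)"
    have iX: "integrable gauss_measure (\<lambda>m. gprim (\<tau> * X \<tau> m))"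
      using pbig_measurable[OF pbig_X \<tau>] by (intro gprim_expectation_integrable) measurable
    have iZ: "integrable gauss_measure (\<lambda>m. gprim (\<tau> * Z \<tau> m))"
      using pbig_measurable[OF Z \<tau>] by (intro gprim_expectation_integrable) measurable
    have Z3: "Z \<tau> n ^ 3 = s / 4 * Y \<tau> n ^ 3" for n
      unfolding Z_def power_mult_distrib s3 ..
    have EX: "\<E> (X \<tau>) = \<E> (kt \<tau>) - k0 \<tau>"
      using elim(1) by (simp add: X_def[abs_def] gauss_expectation_const)
    have EY: "\<E> (Y \<tau>) = \<E> (\<lambda>x. gt \<tau> (sqrt 2 *\<^sub>R x)) - k0 \<tau>"
      using elim(2) by (simp add: Y_def[abs_def] gauss_expectation_const)
    have 1: "r1 \<tau> = GX / \<tau> - (\<E> (kt \<tau>) - k0 \<tau> - \<tau>\<^sup>2 * X3 / 6)"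
      using iX elim(3,5) unfolding EX[symmetric] by (simp add: r1_def GX_def X3_def)
    have 2: "r2 \<tau> = GZ / \<tau> - (s / 2 * (\<E> (\<lambda>x. gt \<tau> (sqrt 2 *\<^sub>R x)) - k0 \<tau>) - \<tau>\<^sup>2 * (s / 4 * Y3) / 6)"
    proof -
      have "integrable gauss_measure (\<lambda>n. Z \<tau> n)" "integrable gauss_measure (\<lambda>n. Z \<tau> n ^ 3)"
        using elim(4,6) unfolding Z3 by (simp_all add: Z_def)
      then have "r2 \<tau> = GZ / \<tau> - (\<E> (\<lambda>n. Z \<tau> n) - \<tau>\<^sup>2 * \<E> (\<lambda>n. Z \<tau> n ^ 3) / 6)"
        using iZ by (simp add: r2_def GZ_def)
      moreover have "\<E> (\<lambda>n. Z \<tau> n) = s / 2 * \<E> (Y \<tau>)" by (simp add: Z_def)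
      moreover have "\<E> (\<lambda>n. Z \<tau> n ^ 3) = s / 4 * Y3" unfolding Z3 Y3_def by simp
      ultimately show ?thesis unfolding EY[symmetric] by (simp only:)
    qed
    have 3: "V \<tau> (k0 \<tau>) = (s * (d1 \<tau> + GX) - (d2 \<tau> + GZ)) / \<tau>"
    proof -
      have "\<tau> * Z \<tau> n = \<tau> / sqrt 2 * Y \<tau> n" for n unfolding s Z_def by simp
      then show ?thesis by (simp add: V_def d1_def d2_def GX_def GZ_def s_def)
    qed
    show ?case
      unfolding 3 unfolding 1 2 a1_def a2_def a3_def a4_def X3_def[symmetric] Y3_def[symmetric] k0_def
      by (simp add: algebra_simps add_divide_distrib diff_divide_distrib)
  qed
  ultimately show ?thesis by (subst (asm) landau_o.big.in_cong)
qed

text \<open>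
  On \<open>|m| \<le> L\<close> the arguments of \<open>gprim\<close> are at most \<open>1/2 + 1/10\<close> in absolute value, where \<open>gprim\<close> has
  derivative at least \<open>1 - (3/5)\<^sup>2/2 = 41/50\<close>; the weight \<open>1 - |m|/L\<close>, of expectation at least \<open>19/20\<close>, replaces
  the indicator of \<open>|m| \<le> L\<close>. The slope is then at least \<open>\<surd>2 (779/1000 - 1/2) > 1/4\<close>.
\<close>

lemma V_decreasing:
  "\<forall>\<^sub>F \<tau> in at_right 0. \<forall>k k'. k \<le> k' \<longrightarrow> \<bar>\<tau> * k\<bar> \<le> 1 / 2 \<longrightarrow> \<bar>\<tau> * k'\<bar> \<le> 1 / 2 \<longrightarrow> (k' - k) / 4 \<le> V \<tau> k - V \<tau> k'"
proof -
  obtain A where A: "0 \<le> A" "\<forall>\<^sub>F \<tau> in at_right 0. \<forall>m. \<tau> * norm m ^ 6 \<le> 1 \<longrightarrow> \<bar>kb \<tau> m\<bar> \<le> A * (1 + norm m) ^ 2"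
    using kb_apriori by blast
  define M1 where "M1 = \<E> (\<lambda>m::real^'n. norm m)"
  have M1: "0 \<le> M1" unfolding M1_def by (intro Bochner_Integration.integral_nonneg) auto
  have iN: "integrable gauss_measure (\<lambda>m::real^'n. norm m)" using gauss_integrable_norm_power[of 1] by simp
  \<comment> \<open>Makes the mean of |m|/L at most 1/20; adding 1 keeps L positive.\<close>
  define L where "L = 20 * (M1 + 1)"
  have L: "0 < L" using M1 by (simp add: L_def)
  have M1L: "M1 / L \<le> 1 / 20" using M1 by (simp add: L_def divide_simps)
  \<comment> \<open>Two smallness conditions in one: \<tau> L^6 <= 1 puts the ball of radius L into
    the region of \<open>kb_apriori\<close>, and \<tau> A (1 + L)^2 <= 1/10 bounds the graph's share
    of the arguments there.\<close>
  define q where "q = L ^ 6 + 10 * (A * (1 + L) ^ 2)"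
  have q: "0 < q" using L A(1) by (simp add: q_def add_pos_nonneg)
  have ev: "\<forall>\<^sub>F \<tau> in at_right (0::real). \<tau> < 1 / q"
    unfolding eventually_at_right_field using q by (intro exI[of _ "1 / q"]) auto
  show ?thesis
    using A(2) ev eventually_at_right_unit
  proof (eventually_elim, intro allI impI)
    fix \<tau> k k' :: real
    assume apriori: "\<forall>m. \<tau> * norm m ^ 6 \<le> 1 \<longrightarrow> \<bar>kb \<tau> m\<bar> \<le> A * (1 + norm m) ^ 2"
      and tq: "\<tau> < 1 / q" and \<tau>: "0 < \<tau> \<and> \<tau> < 1" and k: "k \<le> k'" "\<bar>\<tau> * k\<bar> \<le> 1 / 2" "\<bar>\<tau> * k'\<bar> \<le> 1 / 2"
    have tq: "\<tau> * q \<le> 1" using tq q by (simp add: field_simps)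
    have q1: "\<tau> * L ^ 6 \<le> 1" "\<tau> * (A * (1 + L) ^ 2) \<le> 1 / 10"
    proof -
      have "0 \<le> \<tau> * L ^ 6" "0 \<le> \<tau> * (A * (1 + L) ^ 2)" using \<tau> L A(1) by auto
      moreover have "\<tau> * q = \<tau> * L ^ 6 + 10 * (\<tau> * (A * (1 + L) ^ 2))" by (simp add: q_def algebra_simps)
      ultimately show "\<tau> * L ^ 6 \<le> 1" "\<tau> * (A * (1 + L) ^ 2) \<le> 1 / 10" using tq by linarith+
    qed
    define e where "e = \<tau> * (k' - k)"
    have e: "0 \<le> e" using \<tau> k by (simp add: e_def)
    define G where "G k = \<E> (\<lambda>m. gprim (\<tau> * (kb \<tau> m - k)))" for k
    have iG: "integrable gauss_measure (\<lambda>m. gprim (\<tau> * (kb \<tau> m - k)))" for k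
      by (intro gprim_expectation_integrable borel_measurable_times borel_measurable_diff borel_measurable_const kb_measurable conjunct1[OF \<tau>])
    have "\<E> (\<lambda>m::real^'n. e * (41 / 50) * (1 - norm m / L)) \<le> \<E> (\<lambda>m. gprim (\<tau> * (kb \<tau> m - k)) - gprim (\<tau> * (kb \<tau> m - k')))"
    proof (rule integral_mono)
      fix m :: "real^'n"
      have arg: "\<tau> * (kb \<tau> m - k) - \<tau> * (kb \<tau> m - k') = e" by (simp add: e_def algebra_simps)
      show "e * (41 / 50) * (1 - norm m / L) \<le> gprim (\<tau> * (kb \<tau> m - k)) - gprim (\<tau> * (kb \<tau> m - k'))"
      proof (cases "norm m \<le> L")
        case True
        then have "\<tau> * norm m ^ 6 \<le> \<tau> * L ^ 6" using \<tau> by (intro mult_left_mono power_mono) auto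
        then have "\<bar>kb \<tau> m\<bar> \<le> A * (1 + norm m) ^ 2" using q1 apriori by simp
        also have "\<dots> \<le> A * (1 + L) ^ 2" using True A(1) by (intro mult_left_mono power_mono) auto
        finally have "\<tau> * \<bar>kb \<tau> m\<bar> \<le> \<tau> * (A * (1 + L) ^ 2)" using \<tau> by (intro mult_left_mono) auto
        moreover have "\<bar>\<tau> * kb \<tau> m\<bar> = \<tau> * \<bar>kb \<tau> m\<bar>" using \<tau> by (simp add: abs_mult)
        ultimately have kb: "\<bar>\<tau> * kb \<tau> m\<bar> \<le> 1 / 10" using q1 by linarith
        have "\<bar>\<tau> * (kb \<tau> m - k)\<bar> \<le> 3 / 5" "\<bar>\<tau> * (kb \<tau> m - k')\<bar> \<le> 3 / 5"
          unfolding right_diff_distrib using kb k by linarith+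
        from gprim_diff_ge[OF _ this]
        have "e * (1 - (3 / 5)\<^sup>2 / 2) \<le> gprim (\<tau> * (kb \<tau> m - k)) - gprim (\<tau> * (kb \<tau> m - k'))"
          unfolding arg using \<tau> k by simp
        moreover have "(1 - (3 / 5)\<^sup>2 / 2) = (41 / 50 :: real)" by (simp add: power2_eq_square)
        ultimately have d: "e * (41 / 50) \<le> gprim (\<tau> * (kb \<tau> m - k)) - gprim (\<tau> * (kb \<tau> m - k'))" by (simp only:)
        have "e * (41 / 50) * (1 - norm m / L) \<le> e * (41 / 50) * 1" using e L by (intro mult_left_mono) auto
        also have "\<dots> = e * (41 / 50)" by simp
        finally show ?thesis using d by (rule order_trans)
      next
        case False
        then have "e * (41 / 50) * (1 - norm m / L) \<le> 0" using e L by (intro mult_nonneg_nonpos) auto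
        also have "0 \<le> gprim (\<tau> * (kb \<tau> m - k)) - gprim (\<tau> * (kb \<tau> m - k'))"
          using \<tau> k by (simp add: gprim_mono)
        finally show ?thesis .
      qed
    qed (use iG iN in auto)
    also have "\<dots> = G k - G k'" using iG by (simp add: G_def)
    also have "\<E> (\<lambda>m::real^'n. e * (41 / 50) * (1 - norm m / L)) = e * (41 / 50) * (1 - M1 / L)"
      using iN by (simp add: M1_def gauss_expectation_const)
    finally have G1: "e * (41 / 50) * (1 - M1 / L) \<le> G k - G k'" .
    have "e * (41 / 50) * (19 / 20) \<le> e * (41 / 50) * (1 - M1 / L)" using e M1L by (intro mult_left_mono) auto
    with G1 have G: "e * (779 / 1000) \<le> G k - G k'" by simp
    define B where "B k = \<E> (\<lambda>n. gprim (\<tau> / sqrt 2 * (gq \<tau> (sqrt 2 *\<^sub>R n) - k)))" for k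
    \<comment> \<open>The subtracted term decreases as well and so works against the claim; its
      Lipschitz constant is only half of the factor sqrt 2 in front of the half-step term.\<close>
    have "\<bar>B k - B k'\<bar> \<le> \<tau> / sqrt 2 * \<bar>k - k'\<bar>"
      unfolding B_def by (rule gprim_expectation_lipschitz[OF gq_sqrt2_measurable]) (use \<tau> in simp)
    also have "\<dots> = e / sqrt 2" using k by (simp add: e_def)
    also have "\<dots> = sqrt 2 * (e / 2)" using real_sqrt_mult_self[of 2] by (simp add: field_simps)
    finally have B: "B k - B k' \<le> sqrt 2 * (e / 2)" by linarith
    have "sqrt 2 * (e * (779 / 1000)) \<le> sqrt 2 * (G k - G k')" using G by (intro mult_left_mono) auto
    with B have "sqrt 2 * (e * (279 / 1000)) \<le> (sqrt 2 * G k - B k) - (sqrt 2 * G k' - B k')"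
      by (simp add: algebra_simps)
    moreover have "1 * (e * (279 / 1000)) \<le> sqrt 2 * (e * (279 / 1000))" using e by (intro mult_right_mono) auto
    ultimately have "e / 4 \<le> (sqrt 2 * G k - B k) - (sqrt 2 * G k' - B k')" using e by simp
    then have "e / 4 / \<tau> \<le> ((sqrt 2 * G k - B k) - (sqrt 2 * G k' - B k')) / \<tau>" using \<tau> by (intro divide_right_mono) auto
    then show "(k' - k) / 4 \<le> V \<tau> k - V \<tau> k'"
      using \<tau> by (simp add: V_def G_def B_def e_def diff_divide_distrib)
  qed
qed

text \<open>Comparison with a flat graph, uniform over all heights; it decides the sign where
  \<open>\<tau> * k\<close> is not small and monotonicity has not been shown.\<close>

lemma V_approx: "\<exists>c. \<forall>\<^sub>F \<tau> in at_right 0. \<forall>k. \<bar>\<tau> * V \<tau> k - (sqrt 2 * gprim (- (\<tau> * k)) - gprim (- (\<tau> / sqrt 2 * k)))\<bar> \<le> c * \<tau>"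
proof -
  obtain A where A: "0 \<le> A" "\<forall>\<^sub>F \<tau> in at_right 0. \<forall>m. \<tau> * norm m ^ 6 \<le> 1 \<longrightarrow> \<bar>kb \<tau> m\<bar> \<le> A * (1 + norm m) ^ 2"
    using kb_apriori by blast
  define c1 where "c1 = 4 * (A + 1) * mom 6"
  define c2 where "c2 = 4 * (2 * C + 2) * mom 2"
  have "\<forall>\<^sub>F \<tau> in at_right 0. \<forall>k. \<bar>\<tau> * V \<tau> k - (sqrt 2 * gprim (- (\<tau> * k)) - gprim (- (\<tau> / sqrt 2 * k)))\<bar> \<le> (sqrt 2 * c1 + c2) * \<tau>"
    using A(2) eventually_at_right_unit
  proof (eventually_elim, intro allI)
    fix \<tau> k :: real
    assume apriori: "\<forall>m. \<tau> * norm m ^ 6 \<le> 1 \<longrightarrow> \<bar>kb \<tau> m\<bar> \<le> A * (1 + norm m) ^ 2" and \<tau>: "0 < \<tau> \<and> \<tau> < 1"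
    have 1: "\<bar>\<E> (\<lambda>m. gprim (\<tau> * (kb \<tau> m - k))) - gprim (- (\<tau> * k))\<bar> \<le> c1 * \<tau>"
      unfolding c1_def mom_def
    proof (rule gprim_near_constant)
      fix m :: "real^'n"
      have w: "(1 + norm m) ^ 2 \<le> (1 + norm m) ^ 6" by (intro power_increasing) auto
      show "\<bar>kb \<tau> m\<bar> \<le> (A + 1) * (1 + norm m) ^ 6 \<or> 1 \<le> \<tau> * ((A + 1) * (1 + norm m) ^ 6)"
      proof (cases "\<tau> * norm m ^ 6 \<le> 1")
        case True
        then have "\<bar>kb \<tau> m\<bar> \<le> A * (1 + norm m) ^ 2" using apriori by blast
        also have "\<dots> \<le> (A + 1) * (1 + norm m) ^ 6" using A(1) w by (intro mult_mono) auto
        finally show ?thesis ..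
      next
        case False
        have "1 \<le> \<tau> * norm m ^ 6" using False by simp
        also have "\<dots> \<le> \<tau> * (1 * (1 + norm m) ^ 6)" using \<tau> norm_power_le_weight[of m 6] by (intro mult_left_mono) auto
        also have "\<dots> \<le> \<tau> * ((A + 1) * (1 + norm m) ^ 6)" using \<tau> A(1) by (intro mult_left_mono mult_right_mono) auto
        finally show ?thesis ..
      qed
    qed (use \<tau> A(1) kb_measurable in auto)
    have 2: "\<bar>\<E> (\<lambda>n. gprim (\<tau> / sqrt 2 * (gq \<tau> (sqrt 2 *\<^sub>R n) - k))) - gprim (- (\<tau> / sqrt 2 * k))\<bar> \<le> c2 * \<tau>"
      unfolding c2_def mom_def
    proof (rule gprim_near_constant)
      have "\<tau> / sqrt 2 \<le> \<tau> / 1" using \<tau> by (intro divide_left_mono) auto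
      then show "\<tau> / sqrt 2 \<le> \<tau>" by simp
      fix n :: "real^'n"
      have w: "norm n ^ 2 \<le> (1 + norm n) ^ 2" by (rule norm_power_le_weight)
      show "\<bar>gq \<tau> (sqrt 2 *\<^sub>R n)\<bar> \<le> (2 * C + 2) * (1 + norm n) ^ 2 \<or> 1 \<le> \<tau> * ((2 * C + 2) * (1 + norm n) ^ 2)"
      proof (cases "\<tau> * norm (sqrt 2 *\<^sub>R n) \<le> 1")
        case True
        then have "\<bar>gq \<tau> (sqrt 2 *\<^sub>R n)\<bar> \<le> C * norm (sqrt 2 *\<^sub>R n) ^ 2"
          using gt_le[of \<tau> "sqrt 2 *\<^sub>R n"] \<tau> by (simp add: gt_def)
        also have "\<dots> = (2 * C) * norm n ^ 2" by (simp add: power_mult_distrib)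
        also have "\<dots> \<le> (2 * C + 2) * (1 + norm n) ^ 2" using C_nonneg w by (intro mult_mono) auto
        finally show ?thesis ..
      next
        case False
        have "1 \<le> \<tau> * norm (sqrt 2 *\<^sub>R n)" using False by simp
        also have "\<dots> \<le> \<tau> * (2 * (1 + norm n))" using \<tau> by (intro sqrt2_norm_le) simp
        also have "\<dots> \<le> \<tau> * ((2 * C + 2) * (1 + norm n) ^ 2)"
          using \<tau> C_nonneg by (intro mult_left_mono mult_mono self_le_power) auto
        finally show ?thesis ..
      qed
    qed (use \<tau> C_nonneg gq_sqrt2_measurable in auto)
    have "\<tau> * V \<tau> k = sqrt 2 * \<E> (\<lambda>m. gprim (\<tau> * (kb \<tau> m - k))) - \<E> (\<lambda>n. gprim (\<tau> / sqrt 2 * (gq \<tau> (sqrt 2 *\<^sub>R n) - k)))"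
      using \<tau> by (simp add: V_def)
    then have "\<tau> * V \<tau> k - (sqrt 2 * gprim (- (\<tau> * k)) - gprim (- (\<tau> / sqrt 2 * k)))
      = sqrt 2 * (\<E> (\<lambda>m. gprim (\<tau> * (kb \<tau> m - k))) - gprim (- (\<tau> * k)))
        - (\<E> (\<lambda>n. gprim (\<tau> / sqrt 2 * (gq \<tau> (sqrt 2 *\<^sub>R n) - k))) - gprim (- (\<tau> / sqrt 2 * k)))"
      by (simp add: algebra_simps)
    also have "\<bar>\<dots>\<bar> \<le> sqrt 2 * (c1 * \<tau>) + c2 * \<tau>"
    proof -
      have "\<bar>sqrt 2 * (\<E> (\<lambda>m. gprim (\<tau> * (kb \<tau> m - k))) - gprim (- (\<tau> * k)))\<bar> \<le> sqrt 2 * (c1 * \<tau>)"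
        unfolding abs_mult using 1 by simp
      with 2 show ?thesis by linarith
    qed
    finally show "\<bar>\<tau> * V \<tau> k - (sqrt 2 * gprim (- (\<tau> * k)) - gprim (- (\<tau> / sqrt 2 * k)))\<bar> \<le> (sqrt 2 * c1 + c2) * \<tau>"
      by (simp add: algebra_simps)
  qed
  then show ?thesis by blast
qed

lemma gprim_combination_pos:
  assumes "1 / 2 \<le> a"
  shows "(sqrt 2 - 1) * gprim (1 / 2) \<le> sqrt 2 * gprim a - gprim (a / sqrt 2)"
proof -
  have "a / sqrt 2 \<le> a / 1" using assms by (intro divide_left_mono) auto
  then have "gprim (a / sqrt 2) \<le> gprim a" by (intro gprim_mono) simp
  moreover have "(sqrt 2 - 1) * gprim (1 / 2) \<le> (sqrt 2 - 1) * gprim a"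
    using assms by (intro mult_left_mono gprim_mono) auto
  ultimately show ?thesis by (simp add: algebra_simps)
qed

text \<open>For |\<tau> k| >= 1/2 the flat profile has modulus at least (sqrt 2 - 1)
  \<open>gprim (1 / 2)\<close> by \<open>gprim_combination_pos\<close>, which beats the O(\<tau>)
  error of \<open>V_approx\<close>.\<close>

lemma V_sign:
  "\<forall>\<^sub>F \<tau> in at_right 0. \<forall>k. (1 / 2 \<le> \<tau> * k \<longrightarrow> V \<tau> k < 0) \<and> (\<tau> * k \<le> - 1 / 2 \<longrightarrow> 0 < V \<tau> k)"
proof -
  obtain c where c: "\<forall>\<^sub>F \<tau> in at_right 0. \<forall>k. \<bar>\<tau> * V \<tau> k - (sqrt 2 * gprim (- (\<tau> * k)) - gprim (- (\<tau> / sqrt 2 * k)))\<bar> \<le> c * \<tau>"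
    using V_approx by blast
  define d where "d = (sqrt 2 - 1) * gprim (1 / 2)"
  have d: "0 < d" using gprim_pos[of "1 / 2"] by (simp add: d_def)
  define c' where "c' = \<bar>c\<bar> + 1"
  have c': "0 < c'" by (simp add: c'_def)
  have ev: "\<forall>\<^sub>F \<tau> in at_right (0::real). \<tau> < d / c'"
    unfolding eventually_at_right_field using d c' by (intro exI[of _ "d / c'"]) auto
  show ?thesis
    using c ev eventually_at_right_unit
  proof (eventually_elim, intro allI)
    fix \<tau> k :: real
    assume c: "\<forall>k. \<bar>\<tau> * V \<tau> k - (sqrt 2 * gprim (- (\<tau> * k)) - gprim (- (\<tau> / sqrt 2 * k)))\<bar> \<le> c * \<tau>"
      and td: "\<tau> < d / c'" and \<tau>: "0 < \<tau> \<and> \<tau> < 1"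
    have "c * \<tau> \<le> c' * \<tau>" using \<tau> by (intro mult_right_mono) (auto simp: c'_def)
    also have "\<dots> < d" using td c' by (simp add: field_simps)
    finally have cd: "c * \<tau> < d" .
    have b: "\<bar>\<tau> * V \<tau> k - (sqrt 2 * gprim (- (\<tau> * k)) - gprim (- (\<tau> / sqrt 2 * k)))\<bar> < d"
      using c cd by (meson le_less_trans)
    show "(1 / 2 \<le> \<tau> * k \<longrightarrow> V \<tau> k < 0) \<and> (\<tau> * k \<le> - 1 / 2 \<longrightarrow> 0 < V \<tau> k)"
    proof (intro conjI impI)
      assume "1 / 2 \<le> \<tau> * k"
      from gprim_combination_pos[OF this] have "d \<le> sqrt 2 * gprim (\<tau> * k) - gprim (\<tau> / sqrt 2 * k)" by (simp add: d_def)
      then have "\<tau> * V \<tau> k < 0" using b unfolding gprim_minus by (simp add: abs_less_iff)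
      then show "V \<tau> k < 0" using \<tau> by (simp add: mult_less_0_iff)
    next
      assume "\<tau> * k \<le> - 1 / 2"
      then have "1 / 2 \<le> - (\<tau> * k)" by simp
      from gprim_combination_pos[OF this] have "d \<le> sqrt 2 * gprim (- (\<tau> * k)) - gprim (- (\<tau> / sqrt 2 * k))" by (simp add: d_def)
      then have "0 < \<tau> * V \<tau> k" using b by (simp add: abs_less_iff)
      then show "0 < V \<tau> k" using \<tau> by (simp add: zero_less_mult_iff)
    qed
  qed
qed

lemma V_continuous:
  assumes \<tau>: "0 < \<tau>"
  shows "continuous_on S (V \<tau>)"
proof -
  have c: "continuous_on S (\<lambda>k. \<E> (\<lambda>n. gprim (c * (\<phi> n - k))))"
    if "\<phi> \<in> borel_measurable borel" "0 < c" for \<phi> :: "real^'n \<Rightarrow> real" and c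
  proof (rule continuous_onI)
    fix x e :: real assume e: "0 < e"
    show "\<exists>d>0. \<forall>x'\<in>S. dist x' x < d \<longrightarrow> dist (\<E> (\<lambda>n. gprim (c * (\<phi> n - x')))) (\<E> (\<lambda>n. gprim (c * (\<phi> n - x)))) \<le> e"
    proof (intro exI[of _ "e / c"] conjI ballI impI)
      fix x' assume "dist x' x < e / c"
      then have "c * \<bar>x' - x\<bar> \<le> e" using that by (simp add: dist_real_def field_simps)
      then show "dist (\<E> (\<lambda>n. gprim (c * (\<phi> n - x')))) (\<E> (\<lambda>n. gprim (c * (\<phi> n - x)))) \<le> e"
        using gprim_expectation_lipschitz[OF that, of x' x] by (simp add: dist_real_def)
    qed (use that e in auto)
  qed
  show ?thesis
    unfolding V_def[abs_def] divide_inverse[of _ \<tau>]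
    by (intro continuous_on_mult continuous_on_diff continuous_on_const c kb_measurable gq_sqrt2_measurable) (use \<tau> in auto)
qed

text \<open>A zero exists between -1/(2 \<tau>) and 1/(2 \<tau>) by the signs at the ends;
  \<open>V_decreasing\<close> inside and \<open>V_sign\<close> outside make it the only sign change.
  The slope bound 1/4 gives |z - k0| <= 4 |V(k0)|, once \<open>k0\<close> is seen to lie in the same
  range.\<close>

theorem V_zero:
  "\<exists>z. (\<forall>\<^sub>F \<tau> in at_right 0. \<forall>k. (0 < V \<tau> k \<longleftrightarrow> k < z \<tau>) \<and> (V \<tau> k < 0 \<longleftrightarrow> z \<tau> < k))
    \<and> (\<lambda>\<tau>. z \<tau> - k0 \<tau>) \<in> O[at_right 0](\<lambda>\<tau>. \<tau> ^ 4)"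
proof -
  \<comment> \<open>The bound on \<open>\<tau> * z\<close> is part of the choice so that
    \<open>V_decreasing\<close> can later compare \<open>z\<close> with \<open>k0\<close>.\<close>
  define z where "z \<tau> = (SOME z. (\<forall>k. (0 < V \<tau> k \<longleftrightarrow> k < z) \<and> (V \<tau> k < 0 \<longleftrightarrow> z < k)) \<and> \<bar>\<tau> * z\<bar> \<le> 1 / 2)" for \<tau>
  have z: "\<forall>\<^sub>F \<tau> in at_right 0. (\<forall>k. (0 < V \<tau> k \<longleftrightarrow> k < z \<tau>) \<and> (V \<tau> k < 0 \<longleftrightarrow> z \<tau> < k)) \<and> \<bar>\<tau> * z \<tau>\<bar> \<le> 1 / 2"
    using V_decreasing V_sign eventually_at_right_unit
  proof eventually_elim
    fix \<tau> :: real
    assume dec: "\<forall>k k'. k \<le> k' \<longrightarrow> \<bar>\<tau> * k\<bar> \<le> 1 / 2 \<longrightarrow> \<bar>\<tau> * k'\<bar> \<le> 1 / 2 \<longrightarrow> (k' - k) / 4 \<le> V \<tau> k - V \<tau> k'"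
      and sign: "\<forall>k. (1 / 2 \<le> \<tau> * k \<longrightarrow> V \<tau> k < 0) \<and> (\<tau> * k \<le> - 1 / 2 \<longrightarrow> 0 < V \<tau> k)" and \<tau>: "0 < \<tau> \<and> \<tau> < 1"
    define b where "b = 1 / (2 * \<tau>)"
    have tb: "\<tau> * b = 1 / 2" using \<tau> by (simp add: b_def)
    have b: "0 < b" using \<tau> by (simp add: b_def)
    have Vb: "V \<tau> b < 0" "0 < V \<tau> (- b)" using sign tb by auto
    obtain y where y: "- b \<le> y" "y \<le> b" "V \<tau> y = 0"
      using IVT2'[of "V \<tau>" b 0 "- b"] Vb b V_continuous[of \<tau>] \<tau> by auto
    have ty: "\<bar>\<tau> * y\<bar> \<le> 1 / 2"
      using mult_left_mono[OF y(1), of \<tau>] mult_left_mono[OF y(2), of \<tau>] \<tau> tb by simp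
    have lo: "0 < V \<tau> k" if "k < y" for k
    proof (cases "\<tau> * k \<le> - 1 / 2")
      case False
      have "\<tau> * k \<le> \<tau> * y" using \<tau> that by (intro mult_left_mono) auto
      then have "\<bar>\<tau> * k\<bar> \<le> 1 / 2" using False ty by linarith
      then have "(y - k) / 4 \<le> V \<tau> k - V \<tau> y" using dec that ty by simp
      then show ?thesis using that y(3) by simp
    qed (use sign in blast)
    have hi: "V \<tau> k < 0" if "y < k" for k
    proof (cases "1 / 2 \<le> \<tau> * k")
      case False
      have "\<tau> * y \<le> \<tau> * k" using \<tau> that by (intro mult_left_mono) auto
      then have "\<bar>\<tau> * k\<bar> \<le> 1 / 2" using False ty by linarith
      then have "(k - y) / 4 \<le> V \<tau> y - V \<tau> k" using dec that ty by simp
      then show ?thesis using that y(3) by simp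
    qed (use sign in blast)
    have "(0 < V \<tau> k \<longleftrightarrow> k < y) \<and> (V \<tau> k < 0 \<longleftrightarrow> y < k)" for k
      using lo[of k] hi[of k] y(3) by (cases k y rule: linorder_cases) auto
    then have "\<exists>z. (\<forall>k. (0 < V \<tau> k \<longleftrightarrow> k < z) \<and> (V \<tau> k < 0 \<longleftrightarrow> z < k)) \<and> \<bar>\<tau> * z\<bar> \<le> 1 / 2"
      using ty by blast
    then show "(\<forall>k. (0 < V \<tau> k \<longleftrightarrow> k < z \<tau>) \<and> (V \<tau> k < 0 \<longleftrightarrow> z \<tau> < k)) \<and> \<bar>\<tau> * z \<tau>\<bar> \<le> 1 / 2"
      unfolding z_def by (rule someI_ex)
  qed
  define Q where "Q = 2 * (\<bar>tr H\<bar> + \<bar>bK - t3\<bar>) + 1"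
  have Q: "0 < Q" by (simp add: Q_def add_nonneg_pos)
  have ev: "\<forall>\<^sub>F \<tau> in at_right (0::real). \<tau> < 1 / Q"
    unfolding eventually_at_right_field using Q by (intro exI[of _ "1 / Q"]) auto
  have k0: "\<forall>\<^sub>F \<tau> in at_right 0. \<bar>\<tau> * k0 \<tau>\<bar> \<le> 1 / 2"
    using ev eventually_at_right_unit
  proof eventually_elim
    case (elim \<tau>)
    have "\<bar>\<tau> ^ 2 * (bK - t3)\<bar> \<le> 1 * \<bar>bK - t3\<bar>"
      unfolding abs_mult using elim by (intro mult_right_mono) (auto simp: power_le_one)
    then have "\<bar>k0 \<tau>\<bar> \<le> \<bar>tr H\<bar> + \<bar>bK - t3\<bar>"
      using abs_triangle_ineq[of "tr H" "\<tau> ^ 2 * (bK - t3)"] unfolding k0_def by simp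
    then have "2 * \<bar>k0 \<tau>\<bar> \<le> Q" unfolding Q_def by simp
    then have "\<tau> * (2 * \<bar>k0 \<tau>\<bar>) \<le> \<tau> * Q" using elim by (intro mult_left_mono) auto
    also have "\<dots> \<le> 1" using elim Q by (simp add: field_simps)
    finally show ?case using elim by (simp add: abs_mult)
  qed
  have "(\<lambda>\<tau>. z \<tau> - k0 \<tau>) \<in> O[at_right 0](\<lambda>\<tau>. V \<tau> (k0 \<tau>))"
  proof (rule bigoI[where c=4])
    show "\<forall>\<^sub>F \<tau> in at_right 0. norm (z \<tau> - k0 \<tau>) \<le> 4 * norm (V \<tau> (k0 \<tau>))"
      using z k0 V_decreasing
    proof eventually_elim
      case (elim \<tau>)
      have "V \<tau> (z \<tau>) = 0" using elim(1) by (metis less_irrefl linorder_neqE)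
      then show ?case
        using elim(3)[rule_format, of "z \<tau>" "k0 \<tau>"] elim(3)[rule_format, of "k0 \<tau>" "z \<tau>"] elim(1,2)
        by (cases "z \<tau> \<le> k0 \<tau>") auto
    qed
  qed
  then have "(\<lambda>\<tau>. z \<tau> - k0 \<tau>) \<in> O[at_right 0](\<lambda>\<tau>. \<tau> ^ 4)" using V_k0 by (rule landau_o.big_trans)
  moreover have "\<forall>\<^sub>F \<tau> in at_right 0. \<forall>k. (0 < V \<tau> k \<longleftrightarrow> k < z \<tau>) \<and> (V \<tau> k < 0 \<longleftrightarrow> z \<tau> < k)"
    using z by eventually_elim blast
  ultimately show ?thesis by blast
qed

end

section \<open>The frontier of the set after one step\<close>

lemma convolve_gauss_subgraph_ge_half:
  fixes g :: "'a::euclidean_space \<Rightarrow> real"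
  assumes "g \<in> borel_measurable borel" "0 < s"
  shows "1 / 2 \<le> convolve (gauss_kernel s) (indicator {(x, h). h \<le> g x}) (x, h) \<longleftrightarrow>
    0 \<le> \<E> (\<lambda>n. gprim ((g (x - sqrt (2 * s) *\<^sub>R n) - h) / sqrt (2 * s)))"
proof -
  have "0 < q \<Longrightarrow> 1 / 2 \<le> 1 / 2 + a / q \<longleftrightarrow> 0 \<le> a" for a q :: real
    by (auto simp: zero_le_divide_iff)
  then show ?thesis unfolding convolve_gauss_subgraph[OF assms] by simp
qed

context near_graph
begin

definition gb :: "real \<Rightarrow> real^'n \<Rightarrow> real" where "gb \<tau> x = \<tau>\<^sup>2 * kb \<tau> (x /\<^sub>R \<tau>)"

lemma gb_continuous: "0 < \<tau> \<Longrightarrow> continuous_on UNIV (gb \<tau>)"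
  unfolding gb_def[abs_def]
  by (intro continuous_intros continuous_on_compose2[OF kb_continuous]) auto

lemma g_measurable: "g \<in> borel_measurable borel"
  by (intro borel_measurable_continuous_onI g_cont)

lemma gq_rescale:
  assumes "0 < \<tau>"
  shows "(g (x - \<tau> *\<^sub>R n) - h) / \<tau> = \<tau> * (gq \<tau> (x /\<^sub>R \<tau> - n) - h / \<tau>\<^sup>2)"
proof -
  have "\<tau> *\<^sub>R (x /\<^sub>R \<tau> - n) = x - \<tau> *\<^sub>R n" using assms by (simp add: scaleR_diff_right)
  then show ?thesis using assms by (simp add: gq_def field_simps power2_eq_square)
qed

lemma half_step_graph:
  assumes t: "0 < t"
  shows "half_step t {(x, h). h \<le> g x} = {(x, h). h \<le> gb (sqrt t) x}"
proof -
  define \<tau> where "\<tau> = sqrt t"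
  have \<tau>: "0 < \<tau>" using t by (simp add: \<tau>_def)
  have s: "sqrt (2 * (t / 2)) = \<tau>" by (simp add: \<tau>_def)
  have "1 / 2 \<le> convolve (gauss_kernel (t / 2)) (indicator {(x, h). h \<le> g x}) (x, h) \<longleftrightarrow> h \<le> gb \<tau> x" for x h
  proof -
    have "1 / 2 \<le> convolve (gauss_kernel (t / 2)) (indicator {(x, h). h \<le> g x}) (x, h) \<longleftrightarrow>
      0 \<le> \<E> (\<lambda>n. gprim (\<tau> * (gq \<tau> (x /\<^sub>R \<tau> - n) - h / \<tau>\<^sup>2)))"
      using convolve_gauss_subgraph_ge_half[OF g_measurable, of "t / 2" x h] t
      unfolding s gq_rescale[OF \<tau>] by simp
    also have "\<dots> \<longleftrightarrow> h / \<tau>\<^sup>2 \<le> kb \<tau> (x /\<^sub>R \<tau>)"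
      using level_greater_iff(2)[OF gq_shift_measurable \<tau>, of \<tau> "x /\<^sub>R \<tau>" "h / \<tau>\<^sup>2"]
      by (auto simp: kb_def not_less[symmetric])
    also have "\<dots> \<longleftrightarrow> h \<le> gb \<tau> x"
      using \<tau> by (simp add: gb_def divide_le_eq mult.commute)
    finally show ?thesis .
  qed
  then show ?thesis by (auto simp: half_step_def \<tau>_def)
qed

text \<open>Defined off the axis too, because the frontier is decided by full neighbourhoods;
  continuity in all variables then makes points with positive value interior.\<close>

definition step_function :: "real \<Rightarrow> (real^'n) \<times> real \<Rightarrow> real"
  where "step_function \<tau> p = sqrt 2 * \<E> (\<lambda>n. gprim (1 / \<tau> * (gb \<tau> (fst p - \<tau> *\<^sub>R n) - snd p)))
    - \<E> (\<lambda>n. gprim (1 / (sqrt 2 * \<tau>) * (g (fst p - (sqrt 2 * \<tau>) *\<^sub>R n) - snd p)))"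

lemma step_function_continuous: "0 < \<tau> \<Longrightarrow> continuous_on UNIV (step_function \<tau>)"
  unfolding step_function_def[abs_def]
  by (intro continuous_on_diff continuous_on_mult continuous_on_const gprim_expectation_continuous gb_continuous g_cont)

lemma two_kernel_step_graph:
  assumes t: "0 < t"
  shows "two_kernel_step t {(x, h). h \<le> g x} = {p. 0 \<le> step_function (sqrt t) p}"
proof -
  define \<tau> where "\<tau> = sqrt t"
  have \<tau>: "0 < \<tau>" using t by (simp add: \<tau>_def)
  have s: "sqrt (2 * (t / 2)) = \<tau>" "sqrt (2 * t) = sqrt 2 * \<tau>" by (simp_all add: \<tau>_def real_sqrt_mult)
  have m: "gb \<tau> \<in> borel_measurable borel" by (intro borel_measurable_continuous_onI gb_continuous \<tau>)
  \<comment> \<open>The constants 1/2 combine to (r - 1)/2, so after division by r - 1 the threshold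
    1/2 is met exactly when the difference of the expectations is nonnegative.\<close>
  have th: "1 / 2 \<le> (r * (1 / 2 + A / q) - (1 / 2 + B / q)) / (r - 1) \<longleftrightarrow> 0 \<le> r * A - B"
    if "0 < q" "1 < r" for r q A B :: real
  proof -
    have "(r * (1 / 2 + A / q) - (1 / 2 + B / q)) / (r - 1) = 1 / 2 + (r * A - B) / (q * (r - 1))"
      using that by (simp add: field_simps)
    moreover have "0 < q * (r - 1)" using that by simp
    ultimately show ?thesis by (simp add: zero_le_divide_iff)
  qed
  have "(x, h) \<in> two_kernel_step t {(x, h). h \<le> g x} \<longleftrightarrow> 0 \<le> step_function \<tau> (x, h)" for x h
  proof -
    have 1: "convolve (gauss_kernel (t / 2)) (indicator (half_step t {(x, h). h \<le> g x})) (x, h)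
      = 1 / 2 + \<E> (\<lambda>n. gprim (1 / \<tau> * (gb \<tau> (x - \<tau> *\<^sub>R n) - h))) / sqrt (2 * pi)"
      unfolding half_step_graph[OF t] \<tau>_def[symmetric]
      using convolve_gauss_subgraph[OF m, of "t / 2" x h] t unfolding s by simp
    have 2: "convolve (gauss_kernel t) (indicator {(x, h). h \<le> g x}) (x, h)
      = 1 / 2 + \<E> (\<lambda>n. gprim (1 / (sqrt 2 * \<tau>) * (g (x - (sqrt 2 * \<tau>) *\<^sub>R n) - h))) / sqrt (2 * pi)"
      using convolve_gauss_subgraph[OF g_measurable, of t x h] t unfolding s by simp
    show ?thesis
      unfolding two_kernel_step_def mem_Collect_eq 1 2 step_function_def fst_conv snd_conv
      by (rule th) auto
  qed
  then show ?thesis by (auto simp: \<tau>_def)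
qed

lemma step_function_axis:
  assumes \<tau>: "0 < \<tau>"
  shows "step_function \<tau> (0, h) = \<tau> * V \<tau> (h / \<tau>\<^sup>2)"
proof -
  define k where "k = h / \<tau>\<^sup>2"
  have h: "h = \<tau>\<^sup>2 * k" using \<tau> by (simp add: k_def)
  have "gprim (1 / \<tau> * (gb \<tau> (0 - \<tau> *\<^sub>R n) - h)) = gprim (\<tau> * (kb \<tau> (- n) - k))" for n
  proof -
    have "(0 - \<tau> *\<^sub>R n) /\<^sub>R \<tau> = - n" using \<tau> by simp
    then have "1 / \<tau> * (gb \<tau> (0 - \<tau> *\<^sub>R n) - h) = \<tau> * (kb \<tau> (- n) - k)"
      unfolding gb_def h using \<tau> by (simp add: power2_eq_square field_simps)
    then show ?thesis by simp
  qed
  then have 1: "\<E> (\<lambda>n. gprim (1 / \<tau> * (gb \<tau> (0 - \<tau> *\<^sub>R n) - h))) = \<E> (\<lambda>n. gprim (\<tau> * (kb \<tau> n - k)))"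
    using gauss_expectation_uminus[of "\<lambda>n. gprim (\<tau> * (kb \<tau> n - k))"] kb_measurable[OF \<tau>] by simp
  have "gprim (1 / (sqrt 2 * \<tau>) * (g (0 - (sqrt 2 * \<tau>) *\<^sub>R n) - h)) = gprim (\<tau> / sqrt 2 * (gq \<tau> (sqrt 2 *\<^sub>R (- n)) - k))" for n
  proof -
    have "0 - (sqrt 2 * \<tau>) *\<^sub>R n = \<tau> *\<^sub>R (sqrt 2 *\<^sub>R (- n))" by (simp add: mult.commute)
    then have "1 / (sqrt 2 * \<tau>) * (g (0 - (sqrt 2 * \<tau>) *\<^sub>R n) - h) = \<tau> / sqrt 2 * (gq \<tau> (sqrt 2 *\<^sub>R (- n)) - k)"
      unfolding gq_def h using \<tau> by (simp only:) (simp add: power2_eq_square field_simps)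
    then show ?thesis by (simp only:)
  qed
  then have 2: "\<E> (\<lambda>n. gprim (1 / (sqrt 2 * \<tau>) * (g (0 - (sqrt 2 * \<tau>) *\<^sub>R n) - h))) = \<E> (\<lambda>n. gprim (\<tau> / sqrt 2 * (gq \<tau> (sqrt 2 *\<^sub>R n) - k)))"
    using gauss_expectation_uminus[of "\<lambda>n. gprim (\<tau> / sqrt 2 * (gq \<tau> (sqrt 2 *\<^sub>R n) - k))"] gq_sqrt2_measurable[of \<tau>] by simp
  show ?thesis
    unfolding step_function_def fst_conv snd_conv 1 2 V_def k_def[symmetric] using \<tau> by simp
qed

text \<open>The step set is closed, so its frontier consists of its non-interior points. On the
  axis, points below the zero have positive value and are interior, points above it are outside, and
  the zero has points of negative value arbitrarily close above.\<close>

lemma frontier_step_axis: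
  assumes t: "0 < t" and z: "\<And>k. (0 < V (sqrt t) k \<longleftrightarrow> k < z) \<and> (V (sqrt t) k < 0 \<longleftrightarrow> z < k)"
  shows "(0, h) \<in> frontier (two_kernel_step t {(x, h). h \<le> g x}) \<longleftrightarrow> h = t * z"
proof -
  define \<tau> where "\<tau> = sqrt t"
  have \<tau>: "0 < \<tau>" and \<tau>t: "\<tau>\<^sup>2 = t" using t by (simp_all add: \<tau>_def)
  define S where "S = {p. 0 \<le> step_function \<tau> p}"
  have c: "continuous_on UNIV (step_function \<tau>)" by (rule step_function_continuous[OF \<tau>])
  have closed: "closed S"
    unfolding S_def by (intro closed_Collect_le continuous_on_const c)
  have "open {p. 0 < step_function \<tau> p}"
    by (intro open_Collect_less continuous_on_const c)
  then have pos: "{p. 0 < step_function \<tau> p} \<subseteq> interior S"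
    by (intro interior_maximal) (auto simp: S_def)
  have sgn: "0 < step_function \<tau> (0, h) \<longleftrightarrow> h < t * z" "step_function \<tau> (0, h) < 0 \<longleftrightarrow> t * z < h" for h
    using z[of "h / t"] t \<tau> unfolding step_function_axis[OF \<tau>] \<tau>t \<tau>_def[symmetric]
    by (auto simp: zero_less_mult_iff mult_less_0_iff field_simps)
  have "(0, h) \<in> frontier S \<longleftrightarrow> h = t * z"
  proof
    assume "(0, h) \<in> frontier S"
    then have "(0, h) \<in> S" "(0, h) \<notin> interior S" using closed by (auto simp: frontier_def)
    then have "\<not> step_function \<tau> (0, h) < 0" "\<not> 0 < step_function \<tau> (0, h)"
    proof -
      show "\<not> step_function \<tau> (0, h) < 0" using \<open>(0, h) \<in> S\<close> by (simp add: S_def)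
      show "\<not> 0 < step_function \<tau> (0, h)" using \<open>(0, h) \<notin> interior S\<close> pos by blast
    qed
    then show "h = t * z" unfolding sgn by simp
  next
    assume h: "h = t * z"
    have "(0, h) \<in> S" using sgn(2)[of h] by (simp add: S_def h not_less[symmetric])
    moreover have "(0, h) \<notin> interior S"
    proof
      assume "(0, h) \<in> interior S"
      then obtain e where e: "0 < e" "ball (0, h) e \<subseteq> S" using mem_interior by blast
      have "(0, h + e / 2) \<in> ball ((0::real^'n), h) e" using e(1) by (simp add: dist_Pair_Pair dist_real_def)
      then have "(0, h + e / 2) \<in> S" using e(2) by blast
      then show False using sgn(2)[of "h + e / 2"] e(1) by (simp add: S_def h not_less[symmetric])
    qed
    ultimately show "(0, h) \<in> frontier S" using closed by (simp add: frontier_def)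
  qed
  then show ?thesis unfolding two_kernel_step_graph[OF t] S_def \<tau>_def .
qed

lemma filterlim_sqrt_at_right: "filterlim sqrt (at_right 0) (at_right (0::real))"
proof -
  have "(sqrt \<longlongrightarrow> sqrt 0) (at_right 0)" by (intro tendsto_real_sqrt tendsto_ident_at)
  moreover have "\<forall>\<^sub>F x in at_right (0::real). sqrt x \<in> {0<..} \<and> sqrt x \<noteq> 0"
    using eventually_at_right_unit by eventually_elim auto
  ultimately show ?thesis by (simp add: filterlim_at)
qed

text \<open>Undoes h = \<tau>^2 k with \<tau> = sqrt t: the error \<tau>^4 times t is t^3.
  Convergence of \<open>z\<close> to 0 places the frontier point in the window |h| < 1.\<close>

theorem frontier_expansion:
  obtains z where
    "\<forall>\<^sub>F t in at_right 0. {h. \<bar>h\<bar> < 1 \<and> (0, h) \<in> frontier (two_kernel_step t {(x, h). h \<le> g x})} = {z t}"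
    "(\<lambda>t. z t - (t * tr H + t\<^sup>2 * (bK - t3))) \<in> O[at_right 0](\<lambda>t. t ^ 3)"
proof -
  obtain y where y: "\<forall>\<^sub>F \<tau> in at_right 0. \<forall>k. (0 < V \<tau> k \<longleftrightarrow> k < y \<tau>) \<and> (V \<tau> k < 0 \<longleftrightarrow> y \<tau> < k)"
    and yO: "(\<lambda>\<tau>. y \<tau> - k0 \<tau>) \<in> O[at_right 0](\<lambda>\<tau>. \<tau> ^ 4)"
    using V_zero by blast
  define z where "z t = t * y (sqrt t)" for t
  have "(\<lambda>t. y (sqrt t) - k0 (sqrt t)) \<in> O[at_right 0](\<lambda>t. sqrt t ^ 4)"
    by (rule landau_o.big.compose[OF yO filterlim_sqrt_at_right])
  then have scaled: "(\<lambda>t. t * (y (sqrt t) - k0 (sqrt t))) \<in> O[at_right 0](\<lambda>t. t * sqrt t ^ 4)"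
    by (rule landau_o.big.mult[OF landau_o.big_refl])
  have e1: "\<forall>\<^sub>F t in at_right 0. t * (y (sqrt t) - k0 (sqrt t)) = z t - (t * tr H + t\<^sup>2 * (bK - t3))"
    using eventually_at_right_unit
    by eventually_elim (simp add: z_def k0_def algebra_simps power2_eq_square)
  have e2: "\<forall>\<^sub>F t in at_right (0::real). t * sqrt t ^ 4 = t ^ 3"
    using eventually_at_right_unit
  proof eventually_elim
    case (elim t)
    have "sqrt t ^ 4 = (sqrt t ^ 2) ^ 2" by (simp only: power_mult[symmetric]) simp
    then show ?case using elim by (simp add: power2_eq_square power3_eq_cube)
  qed
  have zO: "(\<lambda>t. z t - (t * tr H + t\<^sup>2 * (bK - t3))) \<in> O[at_right 0](\<lambda>t. t ^ 3)"
    using scaled unfolding landau_o.big.cong_ex[OF e1 e2] .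
  have "(z \<longlongrightarrow> 0) (at_right 0)"
  proof -
    have t0: "((\<lambda>t. t) \<longlongrightarrow> 0) (at_right (0::real))" by (rule tendsto_ident_at)
    have cube: "((\<lambda>t. t ^ 3) \<longlongrightarrow> 0) (at_right (0::real))" using tendsto_power[OF t0, of 3] by simp
    obtain c where "\<forall>\<^sub>F t in at_right 0. norm (z t - (t * tr H + t\<^sup>2 * (bK - t3))) \<le> c * norm (t ^ 3)"
      using zO by (rule landau_o.bigE)
    then have "\<forall>\<^sub>F t in at_right 0. norm (z t - (t * tr H + t\<^sup>2 * (bK - t3))) \<le> norm (t ^ 3) * c"
      by eventually_elim (simp only: mult.commute[of c])
    with cube have "((\<lambda>t. z t - (t * tr H + t\<^sup>2 * (bK - t3))) \<longlongrightarrow> 0) (at_right 0)"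
      by (rule tendsto_0_le)
    moreover have "((\<lambda>t. t * tr H + t\<^sup>2 * (bK - t3)) \<longlongrightarrow> 0 * tr H + 0\<^sup>2 * (bK - t3)) (at_right 0)"
      by (intro tendsto_intros t0)
    ultimately have "((\<lambda>t. (z t - (t * tr H + t\<^sup>2 * (bK - t3))) + (t * tr H + t\<^sup>2 * (bK - t3))) \<longlongrightarrow> 0 + (0 * tr H + 0\<^sup>2 * (bK - t3))) (at_right 0)"
      by (rule tendsto_add)
    then show ?thesis by simp
  qed
  then have small: "\<forall>\<^sub>F t in at_right 0. \<bar>z t\<bar> < 1"
    using order_tendstoD(2)[OF tendsto_rabs[of z 0 "at_right 0"], of 1] by simp
  have "\<forall>\<^sub>F t in at_right 0. \<forall>k. (0 < V (sqrt t) k \<longleftrightarrow> k < y (sqrt t)) \<and> (V (sqrt t) k < 0 \<longleftrightarrow> y (sqrt t) < k)"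
    using eventually_compose_filterlim[OF y filterlim_sqrt_at_right] .
  then have "\<forall>\<^sub>F t in at_right 0. {h. \<bar>h\<bar> < 1 \<and> (0, h) \<in> frontier (two_kernel_step t {(x, h). h \<le> g x})} = {z t}"
    using small eventually_at_right_unit
  proof eventually_elim
    case (elim t)
    then have "(0, h) \<in> frontier (two_kernel_step t {(x, h). h \<le> g x}) \<longleftrightarrow> h = z t" for h
      unfolding z_def by (intro frontier_step_axis) auto
    then show ?case using elim by auto
  qed
  then show ?thesis using zO by (rule that)
qed

end

text \<open>Frontier height and flow have the same quadratic polynomial in t:
  \<open>frontier_expansion\<close> expresses it by Gaussian means,
  \<open>mcf_time_expansion\<close> by sums of derivatives, and \<open>c\<close> identifies the two
  coefficients. For d = 3 the index sums have two terms each.\<close>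

theorem mainTheorem2:
  fixes f :: "(real^'n::finite) \<times> real \<Rightarrow> real"
  assumes "smooth_on half_space f"
    and "f (0, 0) = 0"
    and "\<And>i. Dx i f (0, 0) = 0"
    and "graph_mcf f"
  shows "\<exists>r>0. \<exists>z :: real \<Rightarrow> real.
    (\<forall>\<^sub>F t in at_right 0.
       {h. \<bar>h\<bar> < r \<and> (0, h) \<in> frontier (two_kernel_step t (subgraph f))} = {z t}) \<and>
    (\<lambda>t. z t - f (0, t)) \<in> O[at_right 0](\<lambda>t. t ^ 3) \<and>
    (\<forall>x y :: 'n. UNIV = {x, y} \<and> x \<noteq> y \<longrightarrow>
       (\<lambda>t. z t -
          (t * (Dx x (Dx x f) (0, 0) + Dx y (Dx y f) (0, 0))
           + t\<^sup>2 *
             (1 / 2 * (Dx x (Dx x (Dx x (Dx x f))) (0, 0)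
                       + 2 * Dx y (Dx y (Dx x (Dx x f))) (0, 0)
                       + Dx y (Dx y (Dx y (Dx y f))) (0, 0))
              - ((Dx x (Dx x f) (0, 0)) ^ 3
                 + 3 * Dx x (Dx x f) (0, 0) * (Dx y (Dx x f) (0, 0))\<^sup>2
                 + 3 * Dx y (Dx y f) (0, 0) * (Dx y (Dx x f) (0, 0))\<^sup>2
                 + (Dx y (Dx y f) (0, 0)) ^ 3))))
       \<in> O[at_right 0](\<lambda>t. t ^ 3))"
proof -
  note zero = zero_prod_def[symmetric]
  have f: "smooth_on half_space f" "f 0 = 0" "\<And>i. Dx i f 0 = 0" "graph_mcf f"
    using assms by (simp_all add: zero)
  define g where "g x = f (x, 0)" for x
  obtain C where C: "0 \<le> C"
    "\<And>z. norm z \<le> 1 \<Longrightarrow> \<bar>(f (z, 0) + f (- z, 0)) / 2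
        - quad (D2 f) z / 2
        - quart (D4 f) z / 24\<bar> \<le> C * norm z ^ 6"
    "\<And>z. norm z \<le> 1 \<Longrightarrow> \<bar>f (z, 0) - f (- z, 0)\<bar> \<le> C * norm z ^ 3"
    "\<And>z. norm z \<le> 1 \<Longrightarrow> \<bar>f (z, 0)\<bar> \<le> C * norm z ^ 2"
    by (rule spatial_expansion[OF f(1-3)], rule that)
  have "continuous_on UNIV g"
    unfolding g_def[abs_def]
    by (rule continuous_on_compose2[OF smooth_continuous[OF f(1)]])
      (auto intro!: continuous_intros simp: half_space_iff)
  then interpret near_graph g "D2 f" "D4 f" C
    by unfold_locales (use C D2_commute[OF f(1)] in \<open>auto simp: g_def\<close>)
  have sub: "subgraph f = {(x, h). h \<le> g x}" by (simp add: subgraph_def g_def)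
  obtain z where z: "\<forall>\<^sub>F t in at_right 0. {h. \<bar>h\<bar> < 1 \<and> (0, h) \<in> frontier (two_kernel_step t {(x, h). h \<le> g x})} = {z t}"
    and zO: "(\<lambda>t. z t - (t * tr (D2 f) + t\<^sup>2 * (bK - t3))) \<in> O[at_right 0](\<lambda>t. t ^ 3)"
    by (rule frontier_expansion)
  define c where "c = (\<Sum>i\<in>UNIV. \<Sum>k\<in>UNIV. D4 f k k i i) / 2 - (\<Sum>i\<in>UNIV. \<Sum>j\<in>UNIV. \<Sum>k\<in>UNIV. D2 f i k * D2 f k j * D2 f i j)"
  have c: "bK - t3 = c"
  proof -
    have "\<E> (quart (D4 f)) = (\<Sum>i\<in>UNIV. \<Sum>j\<in>UNIV. D4 f i i j j + D4 f i j i j + D4 f i j j i)"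
      by (rule gauss_quart)
    \<comment> \<open>Mixed derivatives commute, so the three pairings agree; the factor 3 against
      the 6 in \<open>bK\<close> leaves half the bi-Laplacian.\<close>
    also have "\<dots> = (\<Sum>i\<in>UNIV. \<Sum>j\<in>UNIV. 3 * D4 f i i j j)"
      using D4_commute(2,3)[OF f(1)] by (intro sum.cong refl) (smt (verit))
    also have "\<dots> = 3 * (\<Sum>j\<in>UNIV. \<Sum>i\<in>UNIV. D4 f i i j j)"
      by (subst sum.swap) (simp add: sum_distrib_left)
    finally have "bK = (\<Sum>i\<in>UNIV. \<Sum>k\<in>UNIV. D4 f k k i i) / 2" by (simp add: bK_def)
    moreover have "t3 = (\<Sum>i\<in>UNIV. \<Sum>j\<in>UNIV. \<Sum>k\<in>UNIV. D2 f i k * D2 f k j * D2 f i j)"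
      unfolding t3_def tr_def mmul_def sum_distrib_right
      using D2_commute[OF f(1)] by (intro sum.cong refl) simp
    ultimately show ?thesis by (simp add: c_def)
  qed
  obtain B where B: "\<And>t. 0 \<le> t \<Longrightarrow> t \<le> 1 \<Longrightarrow> \<bar>f (0, t) - (t * tr (D2 f) + t\<^sup>2 * c)\<bar> \<le> B * t ^ 3"
    by (rule mcf_time_expansion[OF f, folded tr_def c_def], rule that)
  have "(\<lambda>t. f (0, t) - (t * tr (D2 f) + t\<^sup>2 * c)) \<in> O[at_right 0](\<lambda>t. t ^ 3)"
  proof (rule bigoI[where c=B])
    show "\<forall>\<^sub>F t in at_right 0. norm (f (0, t) - (t * tr (D2 f) + t\<^sup>2 * c)) \<le> B * norm (t ^ 3)"
      using eventually_at_right_unit by eventually_elim (use B in auto)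
  qed
  from sum_in_bigo(2)[OF zO[unfolded c] this]
  have fO: "(\<lambda>t. z t - f (0, t)) \<in> O[at_right 0](\<lambda>t. t ^ 3)" by simp
  have three: "(\<lambda>t. z t -
          (t * (Dx x (Dx x f) (0, 0) + Dx y (Dx y f) (0, 0))
           + t\<^sup>2 *
             (1 / 2 * (Dx x (Dx x (Dx x (Dx x f))) (0, 0)
                       + 2 * Dx y (Dx y (Dx x (Dx x f))) (0, 0)
                       + Dx y (Dx y (Dx y (Dx y f))) (0, 0))
              - ((Dx x (Dx x f) (0, 0)) ^ 3
                 + 3 * Dx x (Dx x f) (0, 0) * (Dx y (Dx x f) (0, 0))\<^sup>2
                 + 3 * Dx y (Dx y f) (0, 0) * (Dx y (Dx x f) (0, 0))\<^sup>2
                 + (Dx y (Dx y f) (0, 0)) ^ 3))))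
       \<in> O[at_right 0](\<lambda>t. t ^ 3)" if U: "UNIV = {x, y}" and xy: "x \<noteq> y" for x y :: 'n
  proof -
    have sum2: "(\<Sum>i\<in>UNIV. F i) = F x + F y" for F :: "'n \<Rightarrow> real"
      unfolding U using xy by simp
    have d4: "D4 f y y x x = D4 f x x y y"
      using D4_commute[OF f(1)] by metis
    have d2: "D2 f y x = D2 f x y" by (rule D2_commute[OF f(1)])
    have T: "tr (D2 f) = D2 f x x + D2 f y y" by (simp add: tr_def sum2)
    have c2: "c = 1 / 2 * (D4 f x x x x + 2 * D4 f x x y y + D4 f y y y y)
        - (D2 f x x ^ 3 + 3 * D2 f x x * (D2 f x y)\<^sup>2 + 3 * D2 f y y * (D2 f x y)\<^sup>2 + D2 f y y ^ 3)"
      by (simp add: c_def sum2 d4 d2 power2_eq_square power3_eq_cube algebra_simps)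
    show ?thesis
      using zO[unfolded c T c2] by (simp only: zero D2_def D4_def)
  qed
  show ?thesis
    using z fO three unfolding sub by (intro exI[of _ 1] conjI exI[of _ z]) auto
qed

end
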